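(* Let $k>1$ be an integer, $M,N>k$ integers, $L=MN$, and $y\in H^k(0,1)$. Let noisy samples $\widetilde y_j=y(\hat x_j)+\eta_j$, $1\le j\le L$, be given, where the $\eta_j$ are independent with $\eta_j\sim\mathcal N(0,\sigma^2)$, $\sigma>0$, and let $h_M$, $\widetilde Y_i$, $Y_i$, $M_i$ be as in the context. Put $$\triangle_M^2=\frac1M\sum_{i=1}^M(\widetilde Y_i-Y_i)^2 .$$ Fix $0<p<0.37$ and let $\bar z_{M,p}$ be the unique solution of $x\exp(1-x)=p^{2/M}$ in $(1,+\infty)$. Then $$\triangle_M^2\le\frac{\bar z_{M,p}\sigma^2}{N}$$ with probability at least $1-p$. Let $\bar c>0$ be a constant, choose $\alpha=\bar c\sigma^2/N$, let $f_*$ be the unique minimizer of $$\Phi(f)=\frac1M\sum_{i=1}^M\left(\widetilde Y_i-M_i(f)\right)^2+\alpha\|f^{(k)}\|_{L^2(0,1)}^2$$ over $\mathcal H=\{f\in H^k(0,1): f(0)=y(0),\ f(1)=y(1)\}$, and put $e=f_*-y$. Let $Q$ be a constant with $\|y'\|_{L^2(0,1)}\le Q$. Then, with $\|\cdot\|=\|\cdot\|_{L^2(0,1)}$, the estimates $$\|e^{(k)}\|\le\sqrt{\frac{2\bar z_{M,p}}{\bar c}+\frac{2Q^2h_M^2}{\bar cN\sigma^2}}+2\|y^{(k)}\|,$$ $$\|e\|\le h_M\|e'\|+\sqrt{\frac{8\bar z_{M,p}\sigma^2+2\bar c\sigma^2\|y^{(k)}\|^2}{N}+\frac{8Q^2h_M^2}{N^2}}$$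 hold with probability at least $1-p$. Consequently, for each fixed $0\le j\le k-1$, there are constants $C_1$ and $C_2$, independent of $h_M$, $\sigma$ and $N$, such that, whenever $\sigma^2>h_M^2/N$, $$\|e^{(j)}\|\le C_1h_M^{k-j}+C_2\left(\frac{\sigma^2}{N}\right)^{(k-j)/(2k)}$$ with probability at least $1-p$.
   Context: The fine grid is $\hat x_j=j/L$, $0\le j\le L$. The coarse grid is $x_i=\hat x_{iN}=i/M$, $0\le i\le M$, with mesh size $h_M=1/M$. The samples are divided into $M$ consecutive groups of $N$ samples; the group averages of the noisy and exact samples are $\widetilde Y_i=\frac1N\sum_{j=1}^N\widetilde y_{(i-1)N+j}$ and $Y_i=\frac1N\sum_{j=1}^N y(\hat x_{(i-1)N+j})$ for $1\le i\le M$. For a function $f$, $M_i(f)=\frac1{h_M}\int_{x_{i-1}}^{x_i}f(x)\,dx$. The endpoint values $y(0)$ and $y(1)$ are known exactly and are used in the definition of $\mathcal H$. $H^k(0,1)$ is the usual Sobolev space; its elements are identified with their continuous representatives on $[0,1]$. The functional $\Phi$ has a unique minimizer over $\mathcal H$ for every $\alpha>0$.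
   Formalization: In the final rate, for k ≥ 3 and 1 ≤ j ≤ k−1, σ²/N is assumed bounded by an arbitrary fixed B on which C_1, C_2 may depend; uniformly in σ the claim fails (y=0, k=3, j=1, σ→∞: ‖e'‖ grows like σ, the bound like σ^{2/3}). Cases j=0 and k=2 are unchanged. *)

theory Defs
  imports "HOL-Probability.Probability"
begin

section \<open>The Sobolev space \<open>H\<^sup>k(0,1)\<close>\<close>

definition L2_fun :: "(real \<Rightarrow> real) \<Rightarrow> bool" where
  "L2_fun g \<longleftrightarrow> g \<in> borel_measurable (lebesgue_on {0<..<1})
     \<and> integrable (lebesgue_on {0<..<1}) (\<lambda>x. (g x)\<^sup>2)"

definition L2_norm :: "(real \<Rightarrow> real) \<Rightarrow> real" where
  "L2_norm g = sqrt (\<integral>x. (g x)\<^sup>2 \<partial>lebesgue_on {0<..<1})"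

text \<open>Test functions \<open>C\<^sub>c\<^sup>\<infinity>(0,1)\<close>, extended by zero to the real line.\<close>

definition test_fun :: "(real \<Rightarrow> real) \<Rightarrow> bool" where
  "test_fun \<phi> \<longleftrightarrow> (\<forall>n. (deriv ^^ n) \<phi> differentiable_on UNIV)
     \<and> compact (closure {x. \<phi> x \<noteq> 0}) \<and> closure {x. \<phi> x \<noteq> 0} \<subseteq> {0<..<1}"

definition is_weak_deriv :: "nat \<Rightarrow> (real \<Rightarrow> real) \<Rightarrow> (real \<Rightarrow> real) \<Rightarrow> bool" where
  "is_weak_deriv n f g \<longleftrightarrow> (\<forall>\<phi>. test_fun \<phi> \<longrightarrow>
     (\<integral>x. f x * (deriv ^^ n) \<phi> x \<partial>lebesgue_on {0<..<1})
       = (-1) ^ n * (\<integral>x. g x * \<phi> x \<partial>lebesgue_on {0<..<1}))"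

text \<open>Elements of \<open>H\<^sup>k(0,1)\<close> (with \<open>k \<ge> 1\<close>) are identified with their continuous
  representatives on \<open>[0,1]\<close>.  They are total functions here, whose values outside
  \<open>[0,1]\<close> are irrelevant throughout.\<close>

definition sobolev :: "nat \<Rightarrow> (real \<Rightarrow> real) set" where
  "sobolev k = {f. continuous_on {0..1} f \<and> (\<forall>n\<le>k. \<exists>g. L2_fun g \<and> is_weak_deriv n f g)}"

text \<open>The weak derivative is determined only up to null sets; the choice of
  representative does not affect its \<open>L\<^sup>2\<close> norm.\<close>

definition weak_deriv :: "nat \<Rightarrow> (real \<Rightarrow> real) \<Rightarrow> real \<Rightarrow> real" where
  "weak_deriv n f = (SOME g. L2_fun g \<and> is_weak_deriv n f g)"

section \<open>Noisy samples and their group averages\<close>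

definition gaussian_noise :: "'w measure \<Rightarrow> nat \<Rightarrow> real \<Rightarrow> (nat \<Rightarrow> 'w \<Rightarrow> real) \<Rightarrow> bool" where
  "gaussian_noise P L \<sigma> \<eta> \<longleftrightarrow> prob_space P
     \<and> prob_space.indep_vars P (\<lambda>_. borel) \<eta> {1..L}
     \<and> (\<forall>j\<in>{1..L}. distributed P lborel (\<eta> j) (normal_density 0 \<sigma>))"

definition exact_samples :: "nat \<Rightarrow> (real \<Rightarrow> real) \<Rightarrow> nat \<Rightarrow> real" where
  "exact_samples L y j = y (real j / real L)"

definition noisy_samples ::
    "nat \<Rightarrow> (real \<Rightarrow> real) \<Rightarrow> (nat \<Rightarrow> 'w \<Rightarrow> real) \<Rightarrow> 'w \<Rightarrow> nat \<Rightarrow> real" where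
  "noisy_samples L y \<eta> \<omega> j = exact_samples L y j + \<eta> j \<omega>"

definition group_avg :: "nat \<Rightarrow> (nat \<Rightarrow> real) \<Rightarrow> nat \<Rightarrow> real" where
  "group_avg N s i = (1 / real N) * (\<Sum>j=1..N. s ((i - 1) * N + j))"

definition mesh :: "nat \<Rightarrow> real" where
  "mesh M = 1 / real M"

definition cell_avg :: "nat \<Rightarrow> (real \<Rightarrow> real) \<Rightarrow> nat \<Rightarrow> real" where
  "cell_avg M f i = (1 / mesh M) *
     (\<integral>x. f x \<partial>lebesgue_on {(real i - 1) / real M .. real i / real M})"

definition noise_level_sq ::
    "nat \<Rightarrow> nat \<Rightarrow> (real \<Rightarrow> real) \<Rightarrow> (nat \<Rightarrow> 'w \<Rightarrow> real) \<Rightarrow> 'w \<Rightarrow> real" where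
  "noise_level_sq M N y \<eta> \<omega> = (1 / real M) *
     (\<Sum>i=1..M. (group_avg N (noisy_samples (M * N) y \<eta> \<omega>) i
                 - group_avg N (exact_samples (M * N) y) i)\<^sup>2)"

definition zbar :: "nat \<Rightarrow> real \<Rightarrow> real" where
  "zbar M p = (THE x. 1 < x \<and> x * exp (1 - x) = p powr (2 / real M))"

section \<open>The regularised least-squares problem\<close>

definition Phi :: "nat \<Rightarrow> nat \<Rightarrow> real \<Rightarrow> (nat \<Rightarrow> real) \<Rightarrow> (real \<Rightarrow> real) \<Rightarrow> real" where
  "Phi k M \<alpha> Y f = (1 / real M) * (\<Sum>i=1..M. (Y i - cell_avg M f i)\<^sup>2)
     + \<alpha> * (L2_norm (weak_deriv k f))\<^sup>2"

definition admissible :: "nat \<Rightarrow> (real \<Rightarrow> real) \<Rightarrow> (real \<Rightarrow> real) set" where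
  "admissible k y = {f \<in> sobolev k. f 0 = y 0 \<and> f 1 = y 1}"

text \<open>\<open>fs \<omega>\<close> is the minimizer for the data belonging to the outcome \<open>\<omega>\<close>.  Since functions
  are total, it is unique only as a function on \<open>[0,1]\<close>; hence a predicate rather than a
  definite description.\<close>

definition reconstruction ::
    "nat \<Rightarrow> nat \<Rightarrow> nat \<Rightarrow> real \<Rightarrow> (real \<Rightarrow> real) \<Rightarrow> 'w measure
      \<Rightarrow> (nat \<Rightarrow> 'w \<Rightarrow> real) \<Rightarrow> ('w \<Rightarrow> real \<Rightarrow> real) \<Rightarrow> bool" where
  "reconstruction k M N \<alpha> y P \<eta> fs \<longleftrightarrow> (\<forall>\<omega>\<in>space P.
     is_arg_min (Phi k M \<alpha> (group_avg N (noisy_samples (M * N) y \<eta> \<omega>)))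
       (\<lambda>f. f \<in> admissible k y) (fs \<omega>))"

end

theory Submission
  imports Defs
begin

text \<open>The normalised group averages of the noise are independent standard normal variables, so
  \<open>M N \<triangle>\<^sub>M\<^sup>2 / \<sigma>\<^sup>2\<close> is chi-square with \<open>M\<close> degrees of freedom; the Chernoff bound for its tail
  at \<open>z M\<close> is \<open>(z exp (1 - z))\<^sup>M\<^sup>/\<^sup>2\<close>, which equals \<open>p\<close> for \<open>z = zbar M p\<close>. On the resulting event,
  comparing the minimizer with \<open>y\<close> bounds \<open>\<parallel>e\<^sup>(\<^sup>k\<^sup>)\<parallel>\<close> and the mean square of the cell averages of \<open>e\<close>;
  the quadrature error of the exact samples is at most \<open>Q h\<^sub>M / N\<close>. The rates follow from an
  interpolation inequality for cell averages: on a block of \<open>k\<close> neighbouring cells, the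
  differences of the primitive of \<open>e\<close> give, by the mean value theorem, points where each
  derivative of order less than \<open>k\<close> is controlled by the cell averages, and the derivatives oscillate between
  such points only as much as \<open>e\<^sup>(\<^sup>k\<^sup>)\<close> allows. The same inequality, with the variational inequality of
  the minimizer, makes the error norms Lipschitz functions of the data; this is why the events
  are measurable although \<open>fs\<close> is given outcome by outcome.\<close>

subsection \<open>Test functions\<close>

text \<open>The constants of the rates must be fixed before \<open>M\<close>, \<open>N\<close> and
  \<sigma>. The estimate of \<open>e\<close> by \<open>mesh M\<close> times the norm of
  \<open>e'\<close> shows only one power of the mesh; interpolating with \<open>n = M\<close> cells
  passes from the averages to \<open>e\<close> at once and yields \<open>mesh M ^ k\<close>. A
  second interpolation, with a number of cells unrelated to \<open>M\<close>, gives the intermediate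
  derivatives. For the same reason \<open>zbar M p\<close> needs a bound free of \<open>M\<close>.

  Large noise is the obstacle behind the alternatives \<open>j = 0\<close>, \<open>k = 2\<close> or
  \<open>\<sigma>\<^sup>2 / N \<le> B\<close>. When \<open>\<sigma>\<^sup>2 / N\<close> exceeds 1,
  the balancing scale is longer than the unit interval. For k \<ge> 3 a polynomial of degree below k
  that vanishes at 0 and 1, such as x (1 - x), is invisible to the penalty and can follow noise of
  size \<open>\<sigma> / sqrt N\<close> in all its derivatives. For k = 2 the endpoint values leave
  no such polynomial but 0.

  Since \<open>sobolev\<close> is defined by testing, all pointwise arguments pass through the du
  Bois-Reymond lemma, which needs an explicit supply of test functions; this is why the development
  begins with exp(-1/x).\<close>

definition flat :: "real poly \<Rightarrow> real \<Rightarrow> real" where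
  "flat p x = (if 0 < x then poly p (1 / x) * exp (- (1 / x)) else 0)"

lemma poly_times_exp_minus_tendsto_0:
  fixes p :: "real poly"
  shows "((\<lambda>t. poly p t * exp (- t)) \<longlongrightarrow> 0) at_top"
proof -
  have "((\<lambda>t. \<Sum>i\<le>degree p. coeff p i * (t ^ i / exp t)) \<longlongrightarrow> (\<Sum>i\<le>degree p. coeff p i * 0)) at_top"
    by (intro tendsto_intros tendsto_power_div_exp_0)
  then show ?thesis
    by (simp add: poly_altdef sum_distrib_right exp_minus divide_inverse mult.assoc)
qed

text \<open>For x > 0 the derivative of p(1/x) exp(-1/x) is (p - p')(1/x) exp(-1/x) / x^2, and 1/x^2
  is the polynomial \<open>[:0, 0, 1:]\<close> evaluated at 1/x. The family is therefore closed
  under differentiation, and one argument at 0 settles all orders.\<close>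

lemma flat_has_derivative:
  "(flat p has_real_derivative flat ([:0, 0, 1:] * (p - pderiv p)) x) (at x)"
proof -
  consider "x > 0" | "x < 0" | "x = 0" by linarith
  then show ?thesis
  proof cases
    case 1
    have "((\<lambda>x. poly p (1 / x) * exp (- (1 / x))) has_real_derivative
        flat ([:0, 0, 1:] * (p - pderiv p)) x) (at x)"
      using 1 by (auto intro!: derivative_eq_intros DERIV_chain2[OF poly_DERIV]
          simp: flat_def field_simps power2_eq_square)
    moreover have "\<forall>\<^sub>F z in nhds x. flat p z = poly p (1 / z) * exp (- (1 / z))"
      using eventually_nhds_in_open[of "{0<..}" x] 1
      by (auto elim!: eventually_mono simp: flat_def)
    ultimately show ?thesis
      by (subst DERIV_cong_ev) auto
  next
    case 2
    moreover have "\<forall>\<^sub>F z in nhds x. flat p z = 0"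
      using eventually_nhds_in_open[of "{..<0}" x] 2
      by (auto elim!: eventually_mono simp: flat_def)
    ultimately show ?thesis
      by (subst DERIV_cong_ev[of x x _ "\<lambda>_. 0"]) (auto simp: flat_def)
  next
    case 3
    \<comment> \<open>With t = 1/h the difference quotient at 0 from the right is t p(t) exp(-t),
      and \<open>pCons 0 p\<close> is the polynomial t p(t).\<close>
    have "((\<lambda>h. poly (pCons 0 p) (inverse h) * exp (- inverse h)) \<longlongrightarrow> 0) (at_right 0)"
      by (rule filterlim_compose[OF poly_times_exp_minus_tendsto_0 filterlim_inverse_at_top_right])
    moreover have "\<forall>\<^sub>F h in at_right (0::real). poly (pCons 0 p) (inverse h) * exp (- inverse h) = flat p h / h"
      by (auto simp: eventually_at_right_field flat_def field_simps intro!: exI[of _ 1])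
    ultimately have "((\<lambda>h. flat p h / h) \<longlongrightarrow> 0) (at_right 0)"
      using tendsto_cong by fastforce
    moreover have "((\<lambda>h. flat p h / h) \<longlongrightarrow> 0) (at_left 0)"
      by (rule tendsto_eventually)
        (auto simp: eventually_at_left_field flat_def intro!: exI[of _ "-1"])
    ultimately have "((\<lambda>h. flat p h / h) \<longlongrightarrow> 0) (at 0)"
      by (simp add: filterlim_split_at)
    then show ?thesis
      using 3 by (simp add: DERIV_def flat_def)
  qed
qed

text \<open>Each generator has its derivative in the algebra, so all its members are smooth.\<close>

inductive flat_algebra :: "(real \<Rightarrow> real) \<Rightarrow> bool" where
  flat: "flat_algebra (\<lambda>x. flat p (a + b * x))"
| const: "flat_algebra (\<lambda>x. c)"
| add: "flat_algebra f \<Longrightarrow> flat_algebra g \<Longrightarrow> flat_algebra (\<lambda>x. f x + g x)"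
| mult: "flat_algebra f \<Longrightarrow> flat_algebra g \<Longrightarrow> flat_algebra (\<lambda>x. f x * g x)"

lemma flat_algebra_has_derivative:
  "flat_algebra f \<Longrightarrow> \<exists>f'. flat_algebra f' \<and> (\<forall>x. (f has_real_derivative f' x) (at x))"
proof (induction rule: flat_algebra.induct)
  case (flat p a b)
  show ?case
  proof (intro exI conjI allI)
    show "flat_algebra (\<lambda>x. flat ([:0, 0, 1:] * (p - pderiv p)) (a + b * x) * b)"
      by (intro flat_algebra.intros)
    show "((\<lambda>x. flat p (a + b * x)) has_real_derivative
        flat ([:0, 0, 1:] * (p - pderiv p)) (a + b * x) * b) (at x)" for x
      by (rule DERIV_chain2[OF flat_has_derivative]) (auto intro!: derivative_eq_intros)
  qed
next
  case (const c)
  show ?case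
    by (rule exI[of _ "\<lambda>x. 0"]) (auto intro!: flat_algebra.intros)
next
  case (add f g)
  then obtain f' g' where "flat_algebra f'" "flat_algebra g'"
    "\<forall>x. (f has_real_derivative f' x) (at x)" "\<forall>x. (g has_real_derivative g' x) (at x)"
    by blast
  then show ?case
    by (intro exI[of _ "\<lambda>x. f' x + g' x"]) (auto intro!: flat_algebra.intros DERIV_add)
next
  case (mult f g)
  then obtain f' g' where "flat_algebra f'" "flat_algebra g'"
    "\<forall>x. (f has_real_derivative f' x) (at x)" "\<forall>x. (g has_real_derivative g' x) (at x)"
    by blast
  with mult show ?case
    by (intro exI[of _ "\<lambda>x. f' x * g x + g' x * f x"])
      (auto intro!: flat_algebra.intros DERIV_mult)
qed

lemma flat_algebra_smooth:
  assumes "flat_algebra f"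
  shows "(deriv ^^ n) f differentiable_on UNIV" and "flat_algebra ((deriv ^^ n) f)"
proof -
  show *: "flat_algebra ((deriv ^^ n) f)" for n
  proof (induction n)
    case (Suc n)
    obtain f' where f': "flat_algebra f'"
      "\<forall>x. ((deriv ^^ n) f has_real_derivative f' x) (at x)"
      using flat_algebra_has_derivative[OF Suc] by blast
    then have "(deriv ^^ Suc n) f = f'"
      by (auto intro: DERIV_imp_deriv)
    then show ?case using f' by simp
  qed (use assms in simp)
  show "(deriv ^^ n) f differentiable_on UNIV"
    using flat_algebra_has_derivative[OF *[of n]]
    by (metis differentiable_on_def differentiable_at_withinI real_differentiable_def)
qed

text \<open>The parameter \<open>m\<close> steepens both flanks without moving the support: as it
  grows, each factor tends to 1 inside the interval, so the bumps converge pointwise to the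
  indicator of the open interval and stay below 1.\<close>

definition bump :: "real \<Rightarrow> real \<Rightarrow> real \<Rightarrow> real \<Rightarrow> real" where
  "bump m a b x = flat 1 (m * (x - a)) * flat 1 (m * (b - x))"

lemma flat_algebra_bump: "flat_algebra (bump m a b)"
proof -
  have "flat_algebra (\<lambda>x. flat 1 (- (m * a) + m * x) * flat 1 (m * b + (- m) * x))"
    by (intro flat_algebra.intros)
  then show ?thesis
    by (simp add: bump_def[abs_def] algebra_simps)
qed

lemma flat_one: "0 \<le> flat 1 x" "flat 1 x \<le> 1"
  by (auto simp: flat_def)

lemma bump_bounds: "0 \<le> bump m a b x" "bump m a b x \<le> 1"
  by (auto simp: bump_def flat_one mult_le_one)

lemma bump_nonzero_iff: "0 < m \<Longrightarrow> bump m a b x \<noteq> 0 \<longleftrightarrow> a < x \<and> x < b"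
  by (auto simp: bump_def flat_def zero_less_mult_iff)

lemma bump_tendsto_indicator:
  "(\<lambda>m. bump (real (Suc m)) a b x) \<longlonglongrightarrow> indicator {a<..<b} x"
proof (cases "a < x \<and> x < b")
  case True
  have "(\<lambda>m. exp (- (1 / (x - a) * inverse (real (Suc m)))) * exp (- (1 / (b - x) * inverse (real (Suc m)))))
    \<longlonglongrightarrow> exp (- (1 / (x - a) * 0)) * exp (- (1 / (b - x) * 0))"
    by (intro tendsto_intros LIMSEQ_inverse_real_of_nat)
  moreover have "bump (real (Suc m)) a b x =
    exp (- (1 / (x - a) * inverse (real (Suc m)))) * exp (- (1 / (b - x) * inverse (real (Suc m))))" for m
    using True by (simp add: bump_def flat_def zero_less_mult_iff field_simps del: of_nat_Suc)
  ultimately show ?thesis using True by simp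
next
  case False
  have "bump (real (Suc m)) a b x = 0" for m
    using bump_nonzero_iff[of "real (Suc m)" a b x] False by auto
  then show ?thesis using False by simp
qed

section \<open>Functions with compact support in the unit interval\<close>

lemma test_funI:
  assumes "\<And>n. (deriv ^^ n) \<phi> differentiable_on UNIV"
    and "0 < a" "b < 1" "\<And>x. \<phi> x \<noteq> 0 \<Longrightarrow> x \<in> {a..b}"
  shows "test_fun \<phi>"
proof -
  have *: "closure {x. \<phi> x \<noteq> 0} \<subseteq> {a..b}"
    using assms(4) by (intro closure_minimal) auto
  then have "compact (closure {x. \<phi> x \<noteq> 0})"
    by (meson bounded_closed_interval bounded_subset closed_closure compact_eq_bounded_closed)
  with * assms show ?thesis
    unfolding test_fun_def by (auto dest!: subsetD)
qed

lemma test_fun_flat_algebra: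
  assumes "flat_algebra \<phi>" "0 < a" "b < 1" "\<And>x. \<phi> x \<noteq> 0 \<Longrightarrow> x \<in> {a..b}"
  shows "test_fun \<phi>"
  using assms flat_algebra_smooth by (intro test_funI) auto

lemma test_fun_bump: "0 < m \<Longrightarrow> 0 < a \<Longrightarrow> b < 1 \<Longrightarrow> test_fun (bump m a b)"
  using bump_nonzero_iff[of m a b] flat_algebra_bump
  by (intro test_fun_flat_algebra[where a=a and b=b]) (auto simp: less_imp_le)

lemma test_fun_support:
  assumes "test_fun \<phi>"
  obtains a b where "0 < a" "a < b" "b < 1" "\<And>x. x \<notin> {a..b} \<Longrightarrow> \<phi> x = 0"
proof -
  define S where "S = closure {x. \<phi> x \<noteq> 0}"
  have S: "compact S" "S \<subseteq> {0<..<1}" and out: "\<And>x. x \<notin> S \<Longrightarrow> \<phi> x = 0"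
    using assms closure_subset[of "{x. \<phi> x \<noteq> 0}"] by (auto simp: test_fun_def S_def)
  show thesis
  proof (cases "S = {}")
    case True
    with out that[of "1/3" "2/3"] show thesis by simp
  next
    case False
    obtain l u where l: "l \<in> S" "\<forall>x\<in>S. l \<le> x" and u: "u \<in> S" "\<forall>x\<in>S. x \<le> u"
      using compact_attains_inf[OF S(1) False] compact_attains_sup[OF S(1) False] by metis
    with S have "0 < l" "l \<le> u" "u < 1" by auto
    show thesis
    \<comment> \<open>Halving the left end keeps it positive and makes the interval nondegenerate
      even if l = u.\<close>
    proof (rule that[of "l / 2" u])
      show "\<phi> x = 0" if "x \<notin> {l / 2..u}" for x
        using that l(2) u(2) \<open>0 < l\<close> by (intro out) (auto simp: field_simps)
    qed (use \<open>0 < l\<close> \<open>l \<le> u\<close> \<open>u < 1\<close> in auto)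
  qed
qed

lemma test_fun_deriv:
  assumes "test_fun \<phi>"
  shows "test_fun (deriv \<phi>)"
proof -
  obtain a b where ab: "0 < a" "a < b" "b < 1" "\<And>x. x \<notin> {a..b} \<Longrightarrow> \<phi> x = 0"
    using test_fun_support[OF assms] by metis
  have "x \<in> {a..b}" if "deriv \<phi> x \<noteq> 0" for x
  proof (rule ccontr)
    assume "x \<notin> {a..b}"
    then have "\<forall>\<^sub>F z in nhds x. \<phi> z = 0"
      using ab(4) by (intro eventually_mono[OF eventually_nhds_in_open[of "- {a..b}" x]]) auto
    then have "deriv \<phi> x = deriv (\<lambda>_. 0) x"
      by (intro deriv_cong_ev) auto
    with that show False by simp
  qed
  moreover have "(deriv ^^ n) (deriv \<phi>) differentiable_on UNIV" for n
    using assms unfolding test_fun_def by (metis funpow_swap1 funpow.simps(2) comp_apply)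
  ultimately show ?thesis
    using ab by (intro test_funI[where a=a and b=b]) auto
qed

lemma test_fun_funpow_deriv: "test_fun \<phi> \<Longrightarrow> test_fun ((deriv ^^ n) \<phi>)"
  by (induction n) (auto intro: test_fun_deriv)

lemma test_fun_has_derivative:
  assumes "test_fun \<phi>"
  shows "(\<phi> has_real_derivative deriv \<phi> x) (at x)"
proof -
  have "(deriv ^^ 0) \<phi> differentiable_on UNIV"
    using assms unfolding test_fun_def by blast
  then show ?thesis
    by (simp add: differentiable_on_def DERIV_deriv_iff_real_differentiable)
qed

lemma test_fun_continuous: "test_fun \<phi> \<Longrightarrow> continuous_on S \<phi>"
  by (meson test_fun_has_derivative DERIV_isCont continuous_at_imp_continuous_on)

text \<open>The primitive from 0 vanishes to the left of the support of \<open>h\<close> for free;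
  the zero mean is exactly what makes it vanish to the right. This characterises the functions that
  occur as \<open>deriv \<phi>\<close> in weak formulations, within the algebra of explicit
  functions.\<close>

lemma test_fun_antiderivative:
  assumes h: "flat_algebra h" and ab: "0 < a" "a < b" "b < 1"
    and supp: "\<And>x. x \<notin> {a..b} \<Longrightarrow> h x = 0" and mean: "integral {0..1} h = 0"
  obtains \<phi> where "test_fun \<phi>" "deriv \<phi> = h"
proof -
  define \<phi> where "\<phi> x = integral {0..x} h" for x
  have cont: "continuous_on S h" for S
    using flat_algebra_has_derivative[OF h]
    by (metis DERIV_isCont continuous_at_imp_continuous_on)
  have left: "\<phi> x = 0" if "x < a" for x
  proof -
    have "integral {0..x} h = integral {0..x} (\<lambda>x. 0)"
      using supp that by (intro integral_cong) auto
    then show ?thesis by (simp add: \<phi>_def)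
  qed
  have right: "\<phi> x = 0" if "b < x" for x
  proof -
    have int: "h integrable_on {c..d}" for c d
      by (intro integrable_continuous_real cont)
    have z: "integral {b..y} h = 0" for y
    proof -
      have "integral {b..y} h = integral {b..y} (\<lambda>x. 0)"
        using supp by (intro integral_spike[of "{b}"]) auto
      then show ?thesis by simp
    qed
    have "integral {0..b} h + integral {b..1} h = integral {0..1} h"
      using ab by (intro Henstock_Kurzweil_Integration.integral_combine int) auto
    moreover have "integral {0..b} h + integral {b..x} h = integral {0..x} h"
      using ab that by (intro Henstock_Kurzweil_Integration.integral_combine int) auto
    ultimately show ?thesis using z mean by (simp add: \<phi>_def)
  qed
  have der: "(\<phi> has_real_derivative h x) (at x)" for x
  proof (cases "x < a")
    case True
    then have "\<forall>\<^sub>F z in nhds x. \<phi> z = 0"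
      using eventually_nhds_in_open[of "{..<a}" x] left by (auto elim!: eventually_mono)
    then show ?thesis
      using supp[of x] True by (subst DERIV_cong_ev[of x x _ "\<lambda>_. 0"]) auto
  next
    case False
    then have "(\<phi> has_real_derivative h x) (at x within {0..x + 1})"
      unfolding \<phi>_def using ab by (intro integral_has_real_derivative cont) auto
    then show ?thesis
      using False ab by (subst (asm) at_within_Icc_at) auto
  qed
  then have d: "deriv \<phi> = h"
    by (auto intro: DERIV_imp_deriv)
  have "(deriv ^^ n) \<phi> differentiable_on UNIV" for n
  proof (cases n)
    case 0
    then show ?thesis using der
      by (auto simp: differentiable_on_def real_differentiable_def)
  next
    case (Suc m)
    then have "(deriv ^^ n) \<phi> = (deriv ^^ m) h"
      using d by (simp add: funpow_swap1)
    then show ?thesis using flat_algebra_smooth[OF h] by simp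
  qed
  then have "test_fun \<phi>"
    using left right ab by (intro test_funI[where a=a and b=b]) (auto simp: not_less[symmetric])
  with d show thesis using that by blast
qed

subsection \<open>The fundamental lemma and weak derivatives\<close>

lemma absolutely_integrable_times_continuous:
  fixes f g :: "real \<Rightarrow> real"
  assumes "f absolutely_integrable_on {a..b}" "continuous_on {a..b} g"
  shows "(\<lambda>x. f x * g x) absolutely_integrable_on {a..b}"
proof -
  have "(\<lambda>x. g x * f x) absolutely_integrable_on {a..b}"
    by (intro absolutely_integrable_bounded_measurable_product_real assms
        continuous_imp_measurable_on_sets_lebesgue compact_imp_bounded compact_continuous_image) auto
  then show ?thesis by (simp add: mult.commute)
qed

lemma absolutely_integrable_on_Icc_subset:
  fixes f :: "real \<Rightarrow> real"
  assumes "f absolutely_integrable_on {a..b}" "a \<le> c" "d \<le> b"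
  shows "f absolutely_integrable_on {c..d}"
  using absolutely_integrable_on_subinterval[OF assms(1), of c d] assms by auto

lemma lebesgue_integral_Ioo_eq:
  fixes h :: "real \<Rightarrow> real"
  assumes "h absolutely_integrable_on {a..b}"
  shows "(\<integral>x. h x \<partial>lebesgue_on {a<..<b}) = integral {a..b} h"
proof -
  have "h absolutely_integrable_on {a<..<b}"
    using assms absolutely_integrable_on_Icc_iff_Ioo by blast
  then have "integrable (lebesgue_on {a<..<b}) h"
    by (intro absolutely_integrable_imp_integrable) auto
  then have "(\<integral>x. h x \<partial>lebesgue_on {a<..<b}) = integral {a<..<b} h"
    by (intro lebesgue_integral_eq_integral) auto
  then show ?thesis
    by (simp add: integral_open_interval_real)
qed

text \<open>By Lebesgue differentiation, almost every value of \<open>w\<close> is a limit of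
  averages over intervals [x, x + h], and all these averages are 0. The extension \<open>v\<close>
  by zero is integrable on every interval, as the differentiation theorem demands.\<close>

lemma negligible_integrals_zero:
  fixes w :: "real \<Rightarrow> real"
  assumes "w integrable_on {0..1}"
    and zero: "\<And>a b. 0 < a \<Longrightarrow> a < b \<Longrightarrow> b < 1 \<Longrightarrow> integral {a..b} w = 0"
  obtains N where "negligible N" "\<And>x. x \<in> {0..1} - N \<Longrightarrow> w x = 0"
proof -
  define v where "v x = (if x \<in> {0..1} then w x else 0)" for x
  have "v integrable_on UNIV"
    unfolding v_def using assms(1) integrable_restrict_UNIV by blast
  then have "\<And>a b. v integrable_on cbox a b"
    by (meson integrable_on_subcbox top_greatest)
  then obtain N where N: "negligible N" "\<And>x e. \<lbrakk>x \<notin> N; 0 < e\<rbrakk> \<Longrightarrow>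
      \<exists>d>0. \<forall>h. 0 < h \<and> h < d \<longrightarrow> norm (integral (cbox x (x + h *\<^sub>R One)) v /\<^sub>R h ^ DIM(real) - v x) < e"
    by (rule integrable_ccontinuous_explicit[of v]) blast
  show thesis
  proof (rule that[of "N \<union> {0, 1}"])
    show "negligible (N \<union> {0, 1})" using N(1) by simp
    fix x :: real assume x: "x \<in> {0..1} - (N \<union> {0, 1})"
    show "w x = 0"
    proof (rule ccontr)
      assume "w x \<noteq> 0"
      with N(2)[of x "\<bar>w x\<bar>"] x obtain d where d: "d > 0"
        "\<And>h. 0 < h \<Longrightarrow> h < d \<Longrightarrow> \<bar>integral {x..x + h} v / h - v x\<bar> < \<bar>w x\<bar>"
        by (auto simp: divide_inverse mult.commute)
      define h where "h = min d (1 - x) / 2"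
      have h: "0 < h" "h < d" "x + h < 1" using d(1) x by (auto simp: h_def min_def field_simps)
      have "integral {x..x + h} v = integral {x..x + h} w"
        using x h by (intro integral_cong) (auto simp: v_def)
      also have "\<dots> = 0" using x h by (intro zero) auto
      finally show False using d(2)[OF h(1,2)] x by (simp add: v_def)
    qed
  qed
qed

text \<open>Bumps suffice as test functions: letting \<open>m\<close> grow, dominated convergence
  with majorant \<open>\<bar>v x\<bar>\<close> turns the hypothesis into vanishing integrals over
  all intervals compactly inside (0,1).\<close>

lemma fundamental_lemma_bump:
  fixes v :: "real \<Rightarrow> real"
  assumes v: "v absolutely_integrable_on {0..1}"
    and zero: "\<And>m a b. 0 < m \<Longrightarrow> 0 < a \<Longrightarrow> a < b \<Longrightarrow> b < 1 \<Longrightarrow>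
      integral {0..1} (\<lambda>x. v x * bump m a b x) = 0"
  obtains N where "negligible N" "\<And>x. x \<in> {0..1} - N \<Longrightarrow> v x = 0"
proof (rule negligible_integrals_zero[of v])
  show "v integrable_on {0..1}" using v by (rule set_lebesgue_integral_eq_integral)
  fix a b :: real assume ab: "0 < a" "a < b" "b < 1"
  have "(\<lambda>m. integral {0..1} (\<lambda>x. v x * bump (real (Suc m)) a b x)) \<longlonglongrightarrow>
      integral {0..1} (\<lambda>x. v x * indicator {a<..<b} x)"
  proof (rule dominated_convergence)
    show "(\<lambda>x. v x * bump (real (Suc m)) a b x) integrable_on {0..1}" for m
      using ab by (intro set_lebesgue_integral_eq_integral(1) absolutely_integrable_times_continuous v
          test_fun_continuous test_fun_bump) auto
    show "(\<lambda>x. \<bar>v x\<bar>) integrable_on {0..1}"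
      using v by (simp add: absolutely_integrable_on_def)
    show "norm (v x * bump (real (Suc m)) a b x) \<le> \<bar>v x\<bar>" for m x
      using bump_bounds[of "real (Suc m)" a b x] by (simp add: abs_mult mult_left_le del: of_nat_Suc)
    show "(\<lambda>m. v x * bump (real (Suc m)) a b x) \<longlonglongrightarrow> v x * indicator {a<..<b} x" for x
      by (intro tendsto_intros bump_tendsto_indicator)
  qed
  then have "integral {0..1} (\<lambda>x. v x * indicator {a<..<b} x) = 0"
    using zero[OF _ ab] by (simp add: LIMSEQ_const_iff del: of_nat_Suc)
  moreover have "integral {0..1} (\<lambda>x. v x * indicator {a<..<b} x) = integral {0..1} (\<lambda>x. if x \<in> {a<..<b} then v x else 0)"
    by (intro integral_cong) (auto simp: indicator_def)
  moreover have "\<dots> = integral ({0..1} \<inter> {a<..<b}) v"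
    by (subst Henstock_Kurzweil_Integration.integral_restrict_Int) (simp add: Int_commute)
  moreover have "{0..1} \<inter> {a<..<b} = {a<..<b}" using ab by auto
  ultimately show "integral {a..b} v = 0"
    by (simp add: integral_open_interval_real)
qed (use that in blast)

text \<open>The defect \<open>H\<close> of the product rule is bounded over \<open>[a,b]\<close> by a multiple of
  \<open>(b - a) \<integral>\<^sub>a\<^sup>b \<bar>g\<bar>\<close>, hence has derivative zero.\<close>

lemma integration_by_parts_indefinite:
  fixes g \<phi> \<phi>' :: "real \<Rightarrow> real"
  assumes g: "g absolutely_integrable_on {0..1}"
    and der: "\<And>x. x \<in> {0..1} \<Longrightarrow> (\<phi> has_real_derivative \<phi>' x) (at x within {0..1})"
    and cont: "continuous_on {0..1} \<phi>'"
  shows "integral {0..1} (\<lambda>x. integral {0..x} g * \<phi>' x) + integral {0..1} (\<lambda>x. g x * \<phi> x)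
    = integral {0..1} g * \<phi> 1"
proof -
  define G where "G x = integral {0..x} g" for x
  \<comment> \<open>\<open>A\<close> dominates the increments of \<open>G\<close>. Its continuity is
    what makes the bound \<open>key\<close> below of smaller order than b - a.\<close>
  define A where "A x = integral {0..x} (\<lambda>t. \<bar>g t\<bar>)" for x
  define H where "H x = G x * \<phi> x - integral {0..x} (\<lambda>x. G x * \<phi>' x) - integral {0..x} (\<lambda>x. g x * \<phi> x)" for x
  have gi: "g integrable_on {0..1}" and ga: "(\<lambda>t. \<bar>g t\<bar>) integrable_on {0..1}"
    using g by (auto simp: absolutely_integrable_on_def)
  have contG: "continuous_on {0..1} G" and contA: "continuous_on {0..1} A"
    unfolding G_def A_def by (intro indefinite_integral_continuous_1 gi ga)+
  have cphi: "continuous_on {0..1} \<phi>"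
    using der DERIV_continuous_on by blast
  have "compact (\<phi>' ` {0..1})" by (intro compact_continuous_image cont compact_Icc)
  then have "\<exists>C. \<forall>x\<in>{0..1}. \<bar>\<phi>' x\<bar> \<le> C"
    by (auto dest!: compact_imp_bounded simp: bounded_iff)
  then obtain C where C: "\<And>x. x \<in> {0..1} \<Longrightarrow> \<bar>\<phi>' x\<bar> \<le> C"
    by blast
  have C0: "0 \<le> C" using C[of 0] by auto
  have i1: "(\<lambda>x. G x * \<phi>' x) integrable_on {0..1}"
    by (intro integrable_continuous_real continuous_intros contG cont)
  have i2: "(\<lambda>x. g x * \<phi> x) integrable_on {0..1}"
    by (intro set_lebesgue_integral_eq_integral(1) absolutely_integrable_times_continuous g cphi)
  have sub: "h integrable_on {a..b}" if "h integrable_on {0..1}" "0 \<le> a" "b \<le> 1" for h :: "real \<Rightarrow> real" and a b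
    using that integrable_on_subinterval[of h "{0..1}" a b] by auto
  have diff: "integral {0..b} h - integral {0..a} h = integral {a..b} h"
    if "h integrable_on {0..1}" "0 \<le> a" "a \<le> b" "b \<le> 1" for h :: "real \<Rightarrow> real" and a b
    using Henstock_Kurzweil_Integration.integral_combine[of 0 a b h] sub[OF that(1), of 0 b] that by auto
  have lip: "\<bar>\<phi> t - \<phi> s\<bar> \<le> C * \<bar>t - s\<bar>" if "t \<in> {0..1}" "s \<in> {0..1}" for s t
  proof -
    have "norm (\<phi> t - \<phi> s) \<le> C * norm (t - s)"
      by (rule field_differentiable_bound[OF convex_real_interval(5)[of 0 1] der]) (use C that in auto)
    then show ?thesis by simp
  qed
  have Gdiff: "\<bar>G t - G s\<bar> \<le> A b - A a" if "0 \<le> a" "a \<le> s" "s \<le> t" "t \<le> b" "b \<le> 1" for a b s t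
  proof -
    have "\<bar>G t - G s\<bar> = \<bar>integral {s..t} g\<bar>"
      unfolding G_def using diff[OF gi, of s t] that by simp
    also have "\<dots> \<le> integral {s..t} (\<lambda>x. \<bar>g x\<bar>)"
      using integral_norm_bound_integral[of g "{s..t}" "\<lambda>x. \<bar>g x\<bar>"] sub[OF gi, of s t] sub[OF ga, of s t] that by auto
    also have "\<dots> \<le> integral {a..b} (\<lambda>x. \<bar>g x\<bar>)"
      using that by (intro integral_subset_le sub[OF ga]) auto
    also have "\<dots> = A b - A a" unfolding A_def using diff[OF ga, of a b] that by simp
    finally show ?thesis .
  qed
  have key: "\<bar>H b - H a\<bar> \<le> 2 * C * (b - a) * (A b - A a)" if "0 \<le> a" "a \<le> b" "b \<le> 1" for a b
  proof -
    have ftc: "(\<phi>' has_integral (\<phi> b - \<phi> a)) {a..b}"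
    proof (rule fundamental_theorem_of_calculus)
      show "a \<le> b" using that by simp
      show "(\<phi> has_vector_derivative \<phi>' x) (at x within {a..b})" if "x \<in> {a..b}" for x
        using der[of x] that \<open>0 \<le> a\<close> \<open>b \<le> 1\<close>
        by (auto simp: has_real_derivative_iff_has_vector_derivative intro: has_vector_derivative_within_subset)
    qed
    have e1: "((\<lambda>x. (G b - G x) * \<phi>' x) has_integral (G b * (\<phi> b - \<phi> a) - integral {a..b} (\<lambda>x. G x * \<phi>' x))) {a..b}"
      unfolding left_diff_distrib using sub[OF i1, of a b] that
      by (intro has_integral_diff has_integral_mult_right ftc integrable_integral) auto
    have e2: "((\<lambda>x. g x * (\<phi> a - \<phi> x)) has_integral (integral {a..b} g * \<phi> a - integral {a..b} (\<lambda>x. g x * \<phi> x))) {a..b}"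
      unfolding right_diff_distrib using sub[OF i2, of a b] sub[OF gi, of a b] that
      by (intro has_integral_diff has_integral_mult_left integrable_integral) auto
    have Gab: "G b - G a = integral {a..b} g" unfolding G_def using diff[OF gi] that by simp
    \<comment> \<open>Writing the increment of \<open>G x * \<phi> x\<close> as G(b) (\<phi>(b) -
      \<phi>(a)) + (G(b) - G(a)) \<phi>(a) makes both defects integrals of increments: one of G
      against the derivative of \<phi>, one of \<phi> against g.\<close>
    have "H b - H a = (G b * (\<phi> b - \<phi> a) - integral {a..b} (\<lambda>x. G x * \<phi>' x)) + (integral {a..b} g * \<phi> a - integral {a..b} (\<lambda>x. g x * \<phi> x))"
      unfolding H_def Gab[symmetric] using diff[OF i1, of a b] diff[OF i2, of a b] that
      by (simp add: algebra_simps)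
    moreover have "\<bar>G b * (\<phi> b - \<phi> a) - integral {a..b} (\<lambda>x. G x * \<phi>' x)\<bar> \<le> (A b - A a) * C * (b - a)"
    proof -
      have "norm (G b * (\<phi> b - \<phi> a) - integral {a..b} (\<lambda>x. G x * \<phi>' x)) \<le> ((A b - A a) * C) * measure lborel (cbox a b)"
      proof (rule has_integral_bound[of _ "\<lambda>x. (G b - G x) * \<phi>' x"])
        show "0 \<le> (A b - A a) * C" using Gdiff[of a a b b] that C0 by simp
        show "norm ((G b - G x) * \<phi>' x) \<le> (A b - A a) * C" if "x \<in> cbox a b" for x
          unfolding norm_mult using that \<open>0 \<le> a\<close> \<open>b \<le> 1\<close> Gdiff[of a x b b] Gdiff[of a a b b] C[of x]
          by (intro mult_mono) auto
      qed (use e1 in simp)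
      then show ?thesis using that by simp
    qed
    moreover have "\<bar>integral {a..b} g * \<phi> a - integral {a..b} (\<lambda>x. g x * \<phi> x)\<bar> \<le> (A b - A a) * (C * (b - a))"
    proof -
      have "norm (integral {a..b} (\<lambda>x. g x * (\<phi> a - \<phi> x))) \<le> integral {a..b} (\<lambda>x. \<bar>g x\<bar> * (C * (b - a)))"
      proof (rule integral_norm_bound_integral)
        show "(\<lambda>x. g x * (\<phi> a - \<phi> x)) integrable_on {a..b}" using e2 by blast
        show "(\<lambda>x. \<bar>g x\<bar> * (C * (b - a))) integrable_on {a..b}"
          using sub[OF ga, of a b] that by (intro integrable_on_mult_left) auto
        show "norm (g x * (\<phi> a - \<phi> x)) \<le> \<bar>g x\<bar> * (C * (b - a))" if "x \<in> {a..b}" for x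
        proof -
          have "\<bar>\<phi> a - \<phi> x\<bar> \<le> C * \<bar>a - x\<bar>" using that \<open>0 \<le> a\<close> \<open>b \<le> 1\<close> by (intro lip) auto
          also have "\<dots> \<le> C * (b - a)" using that C0 by (intro mult_left_mono) auto
          finally show ?thesis by (simp add: abs_mult mult_left_mono)
        qed
      qed
      also have "\<dots> = (A b - A a) * (C * (b - a))"
        unfolding A_def using diff[OF ga, of a b] that by simp
      finally show ?thesis using e2 by (simp add: integral_unique)
    qed
    ultimately show ?thesis by (simp add: algebra_simps)
  qed
  have "(H has_real_derivative 0) (at x within {0..1})" if x: "x \<in> {0..1}" for x
  proof -
    have sym: "\<bar>H z - H x\<bar> \<le> 2 * C * \<bar>z - x\<bar> * \<bar>A z - A x\<bar>" if "z \<in> {0..1}" for z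
    proof (cases "x \<le> z")
      case True
      then show ?thesis using key[of x z] that x Gdiff[of x x x z] by auto
    next
      case False
      then show ?thesis using key[of z x] that x Gdiff[of z z z x] by (auto simp: abs_minus_commute)
    qed
    have "((\<lambda>z. 2 * C * \<bar>A z - A x\<bar>) \<longlongrightarrow> 2 * C * \<bar>A x - A x\<bar>) (at x within {0..1})"
      using contA x by (intro tendsto_intros) (auto simp: continuous_on)
    then have "((\<lambda>z. 2 * C * \<bar>A z - A x\<bar>) \<longlongrightarrow> 0) (at x within {0..1})" by simp
    then have "((\<lambda>z. (H z - H x) / (z - x)) \<longlongrightarrow> 0) (at x within {0..1})"
    proof (rule Lim_null_comparison[rotated])
      show "\<forall>\<^sub>F z in at x within {0..1}. norm ((H z - H x) / (z - x)) \<le> 2 * C * \<bar>A z - A x\<bar>"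
        unfolding eventually_at_filter
      proof (intro always_eventually allI impI)
        fix z assume "z \<noteq> x" "z \<in> {0..1}"
        then show "norm ((H z - H x) / (z - x)) \<le> 2 * C * \<bar>A z - A x\<bar>"
          using sym[of z] by (simp add: divide_le_eq mult.assoc mult.left_commute mult.commute)
      qed
    qed
    then show ?thesis by (simp add: has_field_derivative_iff)
  qed
  then have "H 1 = H 0"
    using has_field_derivative_zero_constant[of "{0..1::real}" H] by auto
  then show ?thesis
    by (simp add: H_def G_def)
qed

text \<open>Integration by parts shows that \<open>w\<close>, the difference of \<open>u\<close> and
  the primitive of \<open>g\<close>, annihilates every derivative of a test function. Any bump
  becomes such a derivative once the multiple \<open>d\<close> of one fixed bump
  \<open>\<phi>0\<close> removes its mean. Hence \<open>w\<close> minus its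
  \<open>\<phi>0\<close>-weighted mean \<open>c\<close> annihilates all bumps.\<close>

lemma du_Bois_Reymond:
  fixes u g :: "real \<Rightarrow> real"
  assumes u: "u absolutely_integrable_on {0..1}" and g: "g absolutely_integrable_on {0..1}"
    and weak: "\<And>\<phi>. test_fun \<phi> \<Longrightarrow>
      integral {0..1} (\<lambda>x. u x * deriv \<phi> x) = - integral {0..1} (\<lambda>x. g x * \<phi> x)"
  obtains c N where "negligible N" "\<And>x. x \<in> {0..1} - N \<Longrightarrow> u x = c + integral {0..x} g"
proof -
  define w where "w x = u x - integral {0..x} g" for x
  have "continuous_on {0..1} (\<lambda>x. integral {0..x} g)"
    by (intro indefinite_integral_continuous_1 set_lebesgue_integral_eq_integral(1) g)
  then have G: "(\<lambda>x. integral {0..x} g) absolutely_integrable_on {0..1}"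
    by (rule absolutely_integrable_continuous_real)
  have w: "w absolutely_integrable_on {0..1}"
    unfolding w_def by (intro set_integral_diff u G)
  have prod: "(\<lambda>x. h x * \<psi> x) integrable_on {0..1}"
    if "h absolutely_integrable_on {0..1}" "continuous_on {0..1} \<psi>" for h \<psi> :: "real \<Rightarrow> real"
    using that by (intro set_lebesgue_integral_eq_integral(1) absolutely_integrable_times_continuous)
  have wderiv: "integral {0..1} (\<lambda>x. w x * deriv \<phi> x) = 0" if \<phi>: "test_fun \<phi>" for \<phi>
  proof -
    have c: "continuous_on {0..1} (deriv \<phi>)"
      by (intro test_fun_continuous test_fun_deriv \<phi>)
    have "integral {0..1} (\<lambda>x. integral {0..x} g * deriv \<phi> x) + integral {0..1} (\<lambda>x. g x * \<phi> x) = integral {0..1} g * \<phi> 1"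
      by (rule integration_by_parts_indefinite[OF g _ c])
        (rule has_field_derivative_at_within[OF test_fun_has_derivative[OF \<phi>]])
    moreover have "\<phi> 1 = 0"
      using test_fun_support[OF \<phi>] by (metis atLeastAtMost_iff not_less)
    ultimately show ?thesis
      using weak[OF \<phi>] prod[OF u c] prod[OF G c]
      by (simp add: w_def left_diff_distrib Henstock_Kurzweil_Integration.integral_diff)
  qed
  define \<phi>0 where "\<phi>0 = bump 1 (1/3) (2/3)"
  have t0: "continuous_on S \<phi>0" for S
    unfolding \<phi>0_def by (intro test_fun_continuous test_fun_bump) auto
  have I0: "integral {0..1} \<phi>0 \<noteq> 0"
  proof
    assume "integral {0..1} \<phi>0 = 0"
    then have "\<phi>0 (1/2) = 0"
      using integral_eq_0_iff[of 0 1 \<phi>0] t0 bump_bounds(1)[of 1 "1/3" "2/3"] by (auto simp: \<phi>0_def)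
    then show False using bump_nonzero_iff[of 1 "1/3" "2/3" "1/2"] by (simp add: \<phi>0_def)
  qed
  define c where "c = integral {0..1} (\<lambda>x. w x * \<phi>0 x) / integral {0..1} \<phi>0"
  obtain N where N: "negligible N" "\<And>x. x \<in> {0..1} - N \<Longrightarrow> w x - c = 0"
  proof (rule fundamental_lemma_bump[of "\<lambda>x. w x - c"])
    show "(\<lambda>x. w x - c) absolutely_integrable_on {0..1}"
      by (intro set_integral_diff w absolutely_integrable_continuous_real continuous_intros)
    fix m a b :: real assume mab: "0 < m" "0 < a" "a < b" "b < 1"
    define \<psi> where "\<psi> = bump m a b"
    define d where "d = integral {0..1} \<psi> / integral {0..1} \<phi>0"
    have tp: "continuous_on S \<psi>" for S
      unfolding \<psi>_def using mab by (intro test_fun_continuous test_fun_bump) auto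
    have "flat_algebra (\<lambda>x. \<psi> x + - d * \<phi>0 x)"
      unfolding \<psi>_def \<phi>0_def by (intro flat_algebra.add flat_algebra.mult flat_algebra.const flat_algebra_bump)
    then obtain \<phi> where \<phi>: "test_fun \<phi>" "deriv \<phi> = (\<lambda>x. \<psi> x + - d * \<phi>0 x)"
    proof (rule test_fun_antiderivative[where a="min a (1/3)" and b="max b (2/3)"])
      show "integral {0..1} (\<lambda>x. \<psi> x + - d * \<phi>0 x) = 0"
        using I0 by (simp add: integral_diff integrable_continuous_real tp t0 continuous_on_mult_left d_def)
      show "\<psi> x + - d * \<phi>0 x = 0" if "x \<notin> {min a (1 / 3)..max b (2 / 3)}" for x
        using that bump_nonzero_iff[of m a b x] bump_nonzero_iff[of 1 "1/3" "2/3" x] mab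
        by (auto simp: \<psi>_def \<phi>0_def)
    qed (use mab in auto)
    have i: "(\<lambda>x. w x * \<psi> x) integrable_on {0..1}" "(\<lambda>x. w x * \<phi>0 x) integrable_on {0..1}"
      by (intro prod w tp t0)+
    have "0 = integral {0..1} (\<lambda>x. w x * \<psi> x - d * (w x * \<phi>0 x))"
      using wderiv[OF \<phi>(1)] unfolding \<phi>(2) by (simp add: algebra_simps)
    also have "\<dots> = integral {0..1} (\<lambda>x. w x * \<psi> x) - d * integral {0..1} (\<lambda>x. w x * \<phi>0 x)"
      using i by (simp add: Henstock_Kurzweil_Integration.integral_diff integrable_on_mult_right)
    also have "\<dots> = integral {0..1} (\<lambda>x. w x * \<psi> x) - c * integral {0..1} \<psi>"
      by (simp add: c_def d_def)
    also have "\<dots> = integral {0..1} (\<lambda>x. (w x - c) * \<psi> x)"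
      using i by (simp add: left_diff_distrib Henstock_Kurzweil_Integration.integral_diff
          integrable_continuous_real tp continuous_on_mult_left)
    finally show "integral {0..1} (\<lambda>x. (w x - c) * bump m a b x) = 0" by (simp add: \<psi>_def)
  qed (use that in blast)
  show thesis
    using N(2) by (intro that[OF N(1), of c]) (force simp: w_def)
qed

subsection \<open>Square integrable functions\<close>

lemma L2_funD:
  assumes "L2_fun g"
  shows "(\<lambda>x. (g x)\<^sup>2) absolutely_integrable_on {0..1}" and "g absolutely_integrable_on {0..1}"
    and "g \<in> borel_measurable (lebesgue_on {0<..<1})"
proof -
  show m: "g \<in> borel_measurable (lebesgue_on {0<..<1})"
    using assms unfolding L2_fun_def by blast
  have "(\<lambda>x. (g x)\<^sup>2) absolutely_integrable_on {0<..<1}"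
    using assms unfolding L2_fun_def
    by (simp add: integrable_on_lebesgue_on nonnegative_absolutely_integrable_1)
  then show sq: "(\<lambda>x. (g x)\<^sup>2) absolutely_integrable_on {0..1}"
    using absolutely_integrable_on_Icc_iff_Ioo by blast
  have "g absolutely_integrable_on {0<..<1}"
  proof (rule measurable_bounded_by_integrable_imp_absolutely_integrable[OF m])
    have "(\<lambda>x. 1 + (g x)\<^sup>2) integrable_on {0..1}"
      using sq by (intro integrable_add set_lebesgue_integral_eq_integral(1) integrable_const_ivl)
    then show "(\<lambda>x. 1 + (g x)\<^sup>2) integrable_on {0<..<1}"
      by (simp add: integrable_on_open_interval_real)
    show "norm (g x) \<le> 1 + (g x)\<^sup>2" for x
    proof -
      have "0 \<le> (\<bar>g x\<bar> - 1)\<^sup>2" by simp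
      then show ?thesis by (simp add: power2_eq_square algebra_simps)
    qed
  qed auto
  then show "g absolutely_integrable_on {0..1}"
    using absolutely_integrable_on_Icc_iff_Ioo by blast
qed

lemma L2_norm_eq: "L2_fun g \<Longrightarrow> L2_norm g = sqrt (integral {0..1} (\<lambda>x. (g x)\<^sup>2))"
  unfolding L2_norm_def by (simp add: lebesgue_integral_Ioo_eq L2_funD(1))

lemma L2_funI:
  assumes "g \<in> borel_measurable (lebesgue_on {0<..<1})" "(\<lambda>x. (g x)\<^sup>2) integrable_on {0..1}"
  shows "L2_fun g"
proof -
  have "(\<lambda>x. (g x)\<^sup>2) absolutely_integrable_on {0..1}"
    using assms(2) by (rule nonnegative_absolutely_integrable_1) auto
  then have "(\<lambda>x. (g x)\<^sup>2) absolutely_integrable_on {0<..<1}"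
    using absolutely_integrable_on_Icc_iff_Ioo by blast
  with assms show ?thesis
    unfolding L2_fun_def by (auto intro: absolutely_integrable_imp_integrable)
qed

lemma L2_fun_continuous:
  assumes "continuous_on {0..1} g"
  shows "L2_fun g"
  using assms by (intro L2_funI continuous_imp_measurable_on_sets_lebesgue integrable_continuous_real
      continuous_intros) (auto intro: continuous_on_subset)

lemma L2_fun_mult:
  assumes f: "L2_fun f" and g: "L2_fun g"
  shows "(\<lambda>x. f x * g x) absolutely_integrable_on {0..1}"
proof -
  have "(\<lambda>x. f x * g x) absolutely_integrable_on {0<..<1}"
  proof (rule measurable_bounded_by_integrable_imp_absolutely_integrable)
    show "(\<lambda>x. f x * g x) \<in> borel_measurable (lebesgue_on {0<..<1})"
      using f g by (intro borel_measurable_times L2_funD(3))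
    have "(\<lambda>x. (f x)\<^sup>2 + (g x)\<^sup>2) integrable_on {0..1}"
      by (intro integrable_add set_lebesgue_integral_eq_integral(1) L2_funD(1) f g)
    then show "(\<lambda>x. (f x)\<^sup>2 + (g x)\<^sup>2) integrable_on {0<..<1}"
      by (simp add: integrable_on_open_interval_real)
    show "norm (f x * g x) \<le> (f x)\<^sup>2 + (g x)\<^sup>2" for x
    proof -
      have "0 \<le> (\<bar>f x\<bar> - \<bar>g x\<bar>)\<^sup>2" by simp
      then have "2 * (\<bar>f x\<bar> * \<bar>g x\<bar>) \<le> (f x)\<^sup>2 + (g x)\<^sup>2" by (simp add: power2_eq_square algebra_simps)
      moreover have "0 \<le> \<bar>f x\<bar> * \<bar>g x\<bar>" by simp
      ultimately show ?thesis unfolding real_norm_def abs_mult by linarith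
    qed
  qed auto
  then show ?thesis using absolutely_integrable_on_Icc_iff_Ioo by blast
qed

lemma L2_fun_lincomb:
  assumes f: "L2_fun f" and g: "L2_fun g"
  shows "L2_fun (\<lambda>x. a * f x + b * g x)"
    and "integral {0..1} (\<lambda>x. (a * f x + b * g x)\<^sup>2) =
      a\<^sup>2 * integral {0..1} (\<lambda>x. (f x)\<^sup>2) + 2 * a * b * integral {0..1} (\<lambda>x. f x * g x)
        + b\<^sup>2 * integral {0..1} (\<lambda>x. (g x)\<^sup>2)"
proof -
  have eq: "(\<lambda>x. (a * f x + b * g x)\<^sup>2) = (\<lambda>x. a\<^sup>2 * (f x)\<^sup>2 + 2 * a * b * (f x * g x) + b\<^sup>2 * (g x)\<^sup>2)"
    by (auto simp: power2_eq_square algebra_simps)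
  have "((\<lambda>x. (a * f x + b * g x)\<^sup>2) has_integral
     (a\<^sup>2 * integral {0..1} (\<lambda>x. (f x)\<^sup>2) + 2 * a * b * integral {0..1} (\<lambda>x. f x * g x)
        + b\<^sup>2 * integral {0..1} (\<lambda>x. (g x)\<^sup>2))) {0..1}"
    unfolding eq
    by (intro has_integral_add has_integral_mult_right integrable_integral
        set_lebesgue_integral_eq_integral(1) L2_funD(1) L2_fun_mult f g)
  then show "L2_fun (\<lambda>x. a * f x + b * g x)"
    and "integral {0..1} (\<lambda>x. (a * f x + b * g x)\<^sup>2) =
      a\<^sup>2 * integral {0..1} (\<lambda>x. (f x)\<^sup>2) + 2 * a * b * integral {0..1} (\<lambda>x. f x * g x)
        + b\<^sup>2 * integral {0..1} (\<lambda>x. (g x)\<^sup>2)"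
    using L2_funD(3)[OF f] L2_funD(3)[OF g] by (auto intro!: L2_funI integral_unique)
qed

lemma L2_norm_nonneg: "0 \<le> L2_norm g"
  by (simp add: L2_norm_def)

lemma L2_norm_sq: "L2_fun g \<Longrightarrow> (L2_norm g)\<^sup>2 = integral {0..1} (\<lambda>x. (g x)\<^sup>2)"
  by (simp add: L2_norm_eq integral_nonneg L2_funD(1) set_lebesgue_integral_eq_integral(1))

lemma L2_inner_le:
  assumes f: "L2_fun f" and g: "L2_fun g"
  shows "integral {0..1} (\<lambda>x. f x * g x) \<le> L2_norm f * L2_norm g"
proof (cases "L2_norm f = 0 \<or> L2_norm g = 0")
  case False
  then have pos: "0 < L2_norm f" "0 < L2_norm g"
    using L2_norm_nonneg[of f] L2_norm_nonneg[of g] by linarith+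
  have "0 \<le> integral {0..1} (\<lambda>x. (L2_norm g * f x + (- L2_norm f) * g x)\<^sup>2)"
    by (intro integral_nonneg set_lebesgue_integral_eq_integral(1) L2_funD(1) L2_fun_lincomb f g) auto
  also have "\<dots> = 2 * (L2_norm f * L2_norm g) * (L2_norm f * L2_norm g - integral {0..1} (\<lambda>x. f x * g x))"
    unfolding L2_fun_lincomb(2)[OF f g] L2_norm_sq[OF f, symmetric] L2_norm_sq[OF g, symmetric]
    by (simp add: power2_eq_square algebra_simps)
  finally have "0 \<le> (2 * (L2_norm f * L2_norm g)) * (L2_norm f * L2_norm g - integral {0..1} (\<lambda>x. f x * g x))" .
  moreover have "0 < 2 * (L2_norm f * L2_norm g)" using pos by simp
  ultimately show ?thesis by (subst (asm) zero_le_mult_iff) linarith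
next
  case True
  have z: "integral {0..1} (\<lambda>x. f x * g x) \<le> 0" if f: "L2_fun f" and g: "L2_fun g" and 0: "L2_norm f = 0" for f g
  proof (rule ccontr)
    assume pos: "\<not> integral {0..1} (\<lambda>x. f x * g x) \<le> 0"
    define I where "I = integral {0..1} (\<lambda>x. f x * g x)"
    \<comment> \<open>When the norm of \<open>f\<close> is 0, the integral of the square of g - t f
      is affine in t; this t makes it equal to -1.\<close>
    define t where "t = ((L2_norm g)\<^sup>2 + 1) / (2 * I)"
    have "0 \<le> integral {0..1} (\<lambda>x. ((- t) * f x + 1 * g x)\<^sup>2)"
      by (intro integral_nonneg set_lebesgue_integral_eq_integral(1) L2_funD(1) L2_fun_lincomb f g) auto
    also have "\<dots> = - (2 * t * I) + (L2_norm g)\<^sup>2"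
      unfolding L2_fun_lincomb(2)[OF f g] L2_norm_sq[OF f, symmetric] L2_norm_sq[OF g, symmetric] 0 I_def
      by simp
    also have "2 * t * I = (L2_norm g)\<^sup>2 + 1" using pos by (simp add: t_def I_def)
    finally show False by simp
  qed
  from True show ?thesis
    using z[OF f g] z[OF g f] by (auto simp: mult.commute)
qed

lemma L2_norm_triangle:
  assumes f: "L2_fun f" and g: "L2_fun g"
  shows "L2_norm (\<lambda>x. f x + g x) \<le> L2_norm f + L2_norm g"
proof (rule power2_le_imp_le)
  have "(L2_norm (\<lambda>x. f x + g x))\<^sup>2 = integral {0..1} (\<lambda>x. (1 * f x + 1 * g x)\<^sup>2)"
    using L2_norm_sq[OF L2_fun_lincomb(1)[OF f g, of 1 1]] by simp
  also have "\<dots> = (L2_norm f)\<^sup>2 + 2 * integral {0..1} (\<lambda>x. f x * g x) + (L2_norm g)\<^sup>2"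
    unfolding L2_fun_lincomb(2)[OF f g] L2_norm_sq[OF f, symmetric] L2_norm_sq[OF g, symmetric] by simp
  also have "\<dots> \<le> (L2_norm f + L2_norm g)\<^sup>2"
    using L2_inner_le[OF f g] by (simp add: power2_sum)
  finally show "(L2_norm (\<lambda>x. f x + g x))\<^sup>2 \<le> (L2_norm f + L2_norm g)\<^sup>2" .
qed (simp add: L2_norm_nonneg)

lemma L2_norm_cmult: "L2_norm (\<lambda>x. c * g x) = \<bar>c\<bar> * L2_norm g"
  by (simp add: L2_norm_def power_mult_distrib real_sqrt_mult)

lemma L2_norm_diff_le:
  assumes f: "L2_fun f" and g: "L2_fun g"
  shows "\<bar>L2_norm f - L2_norm g\<bar> \<le> L2_norm (\<lambda>x. f x - g x)"
proof -
  have d: "L2_fun (\<lambda>x. f x - g x)" "L2_fun (\<lambda>x. g x - f x)"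
    using L2_fun_lincomb(1)[OF f g, of 1 "-1"] L2_fun_lincomb(1)[OF g f, of 1 "-1"] by simp_all
  have "L2_norm (\<lambda>x. g x - f x) = L2_norm (\<lambda>x. f x - g x)"
    using L2_norm_cmult[of "-1" "\<lambda>x. f x - g x"] by simp
  then show ?thesis
    using L2_norm_triangle[OF g d(1)] L2_norm_triangle[OF f d(2)] by simp
qed

lemma L2_norm_cong_negligible:
  assumes f: "L2_fun f" and g: "L2_fun g" and N: "negligible N" "\<And>x. x \<in> {0..1} - N \<Longrightarrow> f x = g x"
  shows "L2_norm f = L2_norm g"
proof -
  have "integral {0..1} (\<lambda>x. (f x)\<^sup>2) = integral {0..1} (\<lambda>x. (g x)\<^sup>2)"
    using N by (intro integral_spike[OF N(1)]) auto
  then show ?thesis by (simp add: L2_norm_eq f g)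
qed

subsection \<open>Classical structure of Sobolev functions\<close>

lemma L2_fun_times_continuous:
  assumes "L2_fun g" "continuous_on {0..1} \<phi>"
  shows "(\<lambda>x. g x * \<phi> x) absolutely_integrable_on {0..1}"
  by (intro absolutely_integrable_times_continuous L2_funD(2) assms)

lemma is_weak_deriv_iff:
  assumes f: "L2_fun f" and g: "L2_fun g"
  shows "is_weak_deriv n f g \<longleftrightarrow> (\<forall>\<phi>. test_fun \<phi> \<longrightarrow>
    integral {0..1} (\<lambda>x. f x * (deriv ^^ n) \<phi> x) = (-1) ^ n * integral {0..1} (\<lambda>x. g x * \<phi> x))"
proof -
  have "(\<integral>x. f x * (deriv ^^ n) \<phi> x \<partial>lebesgue_on {0<..<1}) = integral {0..1} (\<lambda>x. f x * (deriv ^^ n) \<phi> x)"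
    "(\<integral>x. g x * \<phi> x \<partial>lebesgue_on {0<..<1}) = integral {0..1} (\<lambda>x. g x * \<phi> x)"
    if "test_fun \<phi>" for \<phi>
    by (intro lebesgue_integral_Ioo_eq L2_fun_times_continuous f g test_fun_continuous
        test_fun_funpow_deriv that)+
  then show ?thesis unfolding is_weak_deriv_def by simp
qed

lemma weak_deriv_unique:
  assumes g: "L2_fun g" "is_weak_deriv n f g" and h: "L2_fun h" "is_weak_deriv n f h"
  obtains N where "negligible N" "\<And>x. x \<in> {0..1} - N \<Longrightarrow> g x = h x"
proof -
  obtain N where "negligible N" "\<And>x. x \<in> {0..1} - N \<Longrightarrow> g x - h x = 0"
  proof (rule fundamental_lemma_bump[of "\<lambda>x. g x - h x"])
    show "(\<lambda>x. g x - h x) absolutely_integrable_on {0..1}"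
      by (intro set_integral_diff L2_funD g h)
    fix m a b :: real assume "0 < m" "0 < a" "a < b" "b < 1"
    then have t: "test_fun (bump m a b)" by (intro test_fun_bump)
    have e: "(\<integral>x. v x * bump m a b x \<partial>lebesgue_on {0<..<1}) = integral {0..1} (\<lambda>x. v x * bump m a b x)"
      and i: "(\<lambda>x. v x * bump m a b x) integrable_on {0..1}" if "L2_fun v" for v
      by (intro set_lebesgue_integral_eq_integral(1) lebesgue_integral_Ioo_eq L2_fun_times_continuous
          that test_fun_continuous t)+
    have "(-1) ^ n * integral {0..1} (\<lambda>x. g x * bump m a b x) = (-1) ^ n * integral {0..1} (\<lambda>x. h x * bump m a b x)"
      using g(2)[unfolded is_weak_deriv_def, rule_format, OF t]
        h(2)[unfolded is_weak_deriv_def, rule_format, OF t]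
      unfolding e[OF g(1)] e[OF h(1)] by linarith
    then have "integral {0..1} (\<lambda>x. g x * bump m a b x) = integral {0..1} (\<lambda>x. h x * bump m a b x)"
      by simp
    then show "integral {0..1} (\<lambda>x. (g x - h x) * bump m a b x) = 0"
      using i[OF g(1)] i[OF h(1)] by (simp add: left_diff_distrib Henstock_Kurzweil_Integration.integral_diff)
  qed (use that in blast)
  then show thesis using that by auto
qed

text \<open>\<open>weak_deriv\<close> is an arbitrary choice of representative. Two representatives
  agree off a null set, so its norm may be computed from whichever weak derivative is at
  hand.\<close>

lemma weak_deriv_norm_eq:
  assumes g: "L2_fun g" "is_weak_deriv n f g"
  shows "L2_norm (weak_deriv n f) = L2_norm g"
proof -
  have w: "L2_fun (weak_deriv n f) \<and> is_weak_deriv n f (weak_deriv n f)"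
    unfolding weak_deriv_def by (rule someI[of _ g]) (use assms in simp)
  obtain N where "negligible N" "\<And>x. x \<in> {0..1} - N \<Longrightarrow> weak_deriv n f x = g x"
    using weak_deriv_unique[of "weak_deriv n f" n f g] w g by blast
  then show ?thesis
    using L2_norm_cong_negligible[of "weak_deriv n f" g N] w g by blast
qed

lemma sobolev_continuous: "f \<in> sobolev k \<Longrightarrow> continuous_on {0..1} f"
  by (simp add: sobolev_def)

lemma sobolev_L2_fun: "f \<in> sobolev k \<Longrightarrow> L2_fun f"
  by (intro L2_fun_continuous sobolev_continuous)

lemma sobolev_weak_deriv:
  assumes "f \<in> sobolev k" "n \<le> k"
  shows "L2_fun (weak_deriv n f)" and "is_weak_deriv n f (weak_deriv n f)"
proof -
  obtain g where "L2_fun g \<and> is_weak_deriv n f g"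
    using assms unfolding sobolev_def by blast
  then have "L2_fun (weak_deriv n f) \<and> is_weak_deriv n f (weak_deriv n f)"
    unfolding weak_deriv_def by (rule someI[where P="\<lambda>g. L2_fun g \<and> is_weak_deriv n f g"])
  then show "L2_fun (weak_deriv n f)" and "is_weak_deriv n f (weak_deriv n f)" by auto
qed

lemma is_weak_deriv_lincomb:
  assumes L: "L2_fun f" "L2_fun h" "L2_fun f'" "L2_fun h'"
    and w: "is_weak_deriv n f f'" "is_weak_deriv n h h'"
  shows "is_weak_deriv n (\<lambda>x. a * f x + b * h x) (\<lambda>x. a * f' x + b * h' x)"
proof -
  have lin: "integral {0..1} (\<lambda>x. (a * p x + b * q x) * \<phi> x) =
      a * integral {0..1} (\<lambda>x. p x * \<phi> x) + b * integral {0..1} (\<lambda>x. q x * \<phi> x)"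
    if "L2_fun p" "L2_fun q" "test_fun \<phi>" for p q \<phi>
  proof (rule integral_unique)
    have "((\<lambda>x. a * (p x * \<phi> x) + b * (q x * \<phi> x)) has_integral
      (a * integral {0..1} (\<lambda>x. p x * \<phi> x) + b * integral {0..1} (\<lambda>x. q x * \<phi> x))) {0..1}"
      by (intro has_integral_add has_integral_mult_right integrable_integral
          set_lebesgue_integral_eq_integral(1) L2_fun_times_continuous test_fun_continuous that)
    then show "((\<lambda>x. (a * p x + b * q x) * \<phi> x) has_integral
      (a * integral {0..1} (\<lambda>x. p x * \<phi> x) + b * integral {0..1} (\<lambda>x. q x * \<phi> x))) {0..1}"
      by (simp add: algebra_simps)
  qed
  have w': "integral {0..1} (\<lambda>x. f x * (deriv ^^ n) \<phi> x) = (-1) ^ n * integral {0..1} (\<lambda>x. f' x * \<phi> x)"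
     "integral {0..1} (\<lambda>x. h x * (deriv ^^ n) \<phi> x) = (-1) ^ n * integral {0..1} (\<lambda>x. h' x * \<phi> x)"
    if "test_fun \<phi>" for \<phi>
    using w that by (simp_all add: is_weak_deriv_iff[OF L(1,3)] is_weak_deriv_iff[OF L(2,4)])
  have "integral {0..1} (\<lambda>x. (a * f x + b * h x) * (deriv ^^ n) \<phi> x) =
      (-1) ^ n * integral {0..1} (\<lambda>x. (a * f' x + b * h' x) * \<phi> x)" if "test_fun \<phi>" for \<phi>
    unfolding lin[OF L(1,2) test_fun_funpow_deriv[OF that]] lin[OF L(3,4) that] w'[OF that]
    by (simp add: algebra_simps)
  then show ?thesis
    by (subst is_weak_deriv_iff) (auto intro!: L2_fun_lincomb(1) L)
qed

lemma sobolev_lincomb: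
  assumes f: "f \<in> sobolev k" and h: "h \<in> sobolev k"
  shows "(\<lambda>x. a * f x + b * h x) \<in> sobolev k"
    and "n \<le> k \<Longrightarrow> L2_norm (weak_deriv n (\<lambda>x. a * f x + b * h x)) =
      L2_norm (\<lambda>x. a * weak_deriv n f x + b * weak_deriv n h x)"
proof -
  have *: "L2_fun (\<lambda>x. a * weak_deriv n f x + b * weak_deriv n h x)"
    "is_weak_deriv n (\<lambda>x. a * f x + b * h x) (\<lambda>x. a * weak_deriv n f x + b * weak_deriv n h x)"
    if "n \<le> k" for n
    by (intro L2_fun_lincomb(1) is_weak_deriv_lincomb sobolev_weak_deriv[OF f that]
        sobolev_weak_deriv[OF h that] sobolev_L2_fun[OF f] sobolev_L2_fun[OF h])+
  have "continuous_on {0..1} (\<lambda>x. a * f x + b * h x)"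
    by (intro continuous_intros sobolev_continuous[OF f] sobolev_continuous[OF h])
  then show "(\<lambda>x. a * f x + b * h x) \<in> sobolev k"
    using * unfolding sobolev_def by blast
  show "n \<le> k \<Longrightarrow> L2_norm (weak_deriv n (\<lambda>x. a * f x + b * h x)) =
      L2_norm (\<lambda>x. a * weak_deriv n f x + b * weak_deriv n h x)"
    by (intro weak_deriv_norm_eq *)
qed

lemma sobolev_diff: "f \<in> sobolev k \<Longrightarrow> h \<in> sobolev k \<Longrightarrow> (\<lambda>x. f x - h x) \<in> sobolev k"
  using sobolev_lincomb(1)[of f k h 1 "-1"] by simp

lemma L2_norm_weak_deriv_0:
  assumes "L2_fun f"
  shows "L2_norm (weak_deriv 0 f) = L2_norm f"
  using assms by (intro weak_deriv_norm_eq) (auto simp: is_weak_deriv_def)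

text \<open>\<open>deriv_chain k u\<close> says that \<open>u 0\<close> is of class \<open>C\<^sup>k\<^sup>-\<^sup>1\<close> on \<open>[0,1]\<close> with derivatives
  \<open>u n\<close>, and that \<open>u (k - 1)\<close> is absolutely continuous with square integrable derivative \<open>u k\<close>.\<close>

definition deriv_chain :: "nat \<Rightarrow> (nat \<Rightarrow> real \<Rightarrow> real) \<Rightarrow> bool" where
  "deriv_chain k u \<longleftrightarrow> (\<forall>n<k. continuous_on {0..1} (u n)
      \<and> (\<forall>x\<in>{0..1}. u n x = u n 0 + integral {0..x} (u (Suc n)))) \<and> L2_fun (u k)"

lemma continuous_eq_off_negligible:
  fixes f g :: "real \<Rightarrow> real"
  assumes "continuous_on {0..1} f" "continuous_on {0..1} g"
    and N: "negligible N" "\<And>x. x \<in> {0..1} - N \<Longrightarrow> f x = g x" and x: "x \<in> {0..1}"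
  shows "f x = g x"
proof -
  have c: "continuous_on {0..1} (\<lambda>x. \<bar>f x - g x\<bar>)"
    by (intro continuous_intros assms)
  have "integral {0..1} (\<lambda>x. \<bar>f x - g x\<bar>) = integral {0..1} (\<lambda>x::real. 0)"
    by (rule integral_spike[OF N(1)]) (simp add: N(2))
  then show ?thesis
    using integral_eq_0_iff[of 0 1 "\<lambda>x. \<bar>f x - g x\<bar>"] c x by auto
qed

text \<open>Testing with \<phi>' in place of \<phi> makes the weak derivative of order n + 1 the
  weak derivative of the one of order n, so du Bois-Reymond writes the latter as a constant plus a
  primitive, off a null set. Orders below \<open>k\<close> are replaced by these continuous
  versions, while order \<open>k\<close> keeps its representative. At order 0 two continuous
  functions agree almost everywhere, hence on all of [0,1].\<close>

lemma sobolev_deriv_chain: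
  assumes f: "f \<in> sobolev k" and k: "0 < k"
  obtains u where "deriv_chain k u" "\<And>x. x \<in> {0..1} \<Longrightarrow> u 0 x = f x"
    "\<And>n. n \<le> k \<Longrightarrow> L2_norm (weak_deriv n f) = L2_norm (u n)"
proof -
  define g where "g n = weak_deriv n f" for n
  have g: "L2_fun (g n)" "is_weak_deriv n f (g n)" if "n \<le> k" for n
    using sobolev_weak_deriv[OF f that] by (auto simp: g_def)
  have ex: "\<exists>c N. negligible N \<and> (\<forall>x\<in>{0..1} - N. g n x = c + integral {0..x} (g (Suc n)))" if n: "n < k" for n
  proof -
    obtain c N where "negligible N" "\<And>x. x \<in> {0..1} - N \<Longrightarrow> g n x = c + integral {0..x} (g (Suc n))"
    proof (rule du_Bois_Reymond[of "g n" "g (Suc n)"])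
      fix \<phi> assume t: "test_fun \<phi>"
      have "(-1) ^ n * integral {0..1} (\<lambda>x. g n x * deriv \<phi> x) = (-1) ^ Suc n * integral {0..1} (\<lambda>x. g (Suc n) x * \<phi> x)"
      proof -
        have "(-1) ^ n * integral {0..1} (\<lambda>x. g n x * deriv \<phi> x) = integral {0..1} (\<lambda>x. f x * (deriv ^^ n) (deriv \<phi>) x)"
          using is_weak_deriv_iff[OF sobolev_L2_fun[OF f] g(1)] g(2)[of n] n test_fun_deriv[OF t] by auto
        also have "(deriv ^^ n) (deriv \<phi>) = (deriv ^^ Suc n) \<phi>"
          by (simp add: funpow_swap1)
        also have "integral {0..1} (\<lambda>x. f x * (deriv ^^ Suc n) \<phi> x) = (-1) ^ Suc n * integral {0..1} (\<lambda>x. g (Suc n) x * \<phi> x)"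
          using is_weak_deriv_iff[OF sobolev_L2_fun[OF f] g(1)[of "Suc n"]] g(2)[of "Suc n"] n t by auto
        finally show ?thesis .
      qed
      then show "integral {0..1} (\<lambda>x. g n x * deriv \<phi> x) = - integral {0..1} (\<lambda>x. g (Suc n) x * \<phi> x)"
        by (cases "even n") simp_all
    qed (use n in \<open>auto intro!: L2_funD g\<close>)
    then show ?thesis by blast
  qed
  then obtain c N where cN: "\<And>n. n < k \<Longrightarrow> negligible (N n)"
    "\<And>n x. n < k \<Longrightarrow> x \<in> {0..1} - N n \<Longrightarrow> g n x = c n + integral {0..x} (g (Suc n))"
    by metis
  define u where "u n x = (if n < k then c n + integral {0..x} (g (Suc n)) else g n x)" for n x
  have ug: "\<exists>N. negligible N \<and> (\<forall>x\<in>{0..1} - N. u n x = g n x)" for n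
    using cN[of n] by (intro exI[of _ "if n < k then N n else {}"]) (auto simp: u_def)
  have int: "integral {0..x} (u n) = integral {0..x} (g n)" if "x \<in> {0..1}" for n x
  proof -
    obtain N' where "negligible N'" "\<And>x. x \<in> {0..1} - N' \<Longrightarrow> u n x = g n x"
      using ug[of n] by blast
    then show ?thesis
      using that by (intro integral_spike[of N']) auto
  qed
  have cont: "continuous_on {0..1} (u n)" if "n < k" for n
    using that unfolding u_def
    by (auto intro!: continuous_intros indefinite_integral_continuous_1
        set_lebesgue_integral_eq_integral(1) L2_funD g)
  have L2u: "L2_fun (u n)" if "n \<le> k" for n
  proof (cases "n < k")
    case True
    then show ?thesis using cont L2_fun_continuous by blast
  next
    case False
    then have "u n = g n" by (auto simp: u_def)
    then show ?thesis using g that by simp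
  qed
  have chain: "deriv_chain k u"
    unfolding deriv_chain_def
  proof (intro conjI allI impI ballI)
    fix n x assume n: "n < k" and x: "x \<in> {0..1::real}"
    show "u n x = u n 0 + integral {0..x} (u (Suc n))"
      unfolding int[OF x] using n by (simp add: u_def)
  qed (use cont L2u in auto)
  obtain N0 where N0: "negligible N0" "\<And>x. x \<in> {0..1} - N0 \<Longrightarrow> g 0 x = f x"
    using weak_deriv_unique[of "g 0" 0 f f] g[of 0] sobolev_L2_fun[OF f]
    by (auto simp: is_weak_deriv_def)
  obtain N1 where N1: "negligible N1" "\<And>x. x \<in> {0..1} - N1 \<Longrightarrow> u 0 x = g 0 x"
    using ug[of 0] by blast
  have "u 0 x = f x" if "x \<in> {0..1}" for x
    using continuous_eq_off_negligible[of "u 0" f "N0 \<union> N1"] N0 N1 cont[OF k] sobolev_continuous[OF f] that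
    by auto
  moreover have "L2_norm (weak_deriv n f) = L2_norm (u n)" if "n \<le> k" for n
  proof -
    obtain N2 where "negligible N2" "\<And>x. x \<in> {0..1} - N2 \<Longrightarrow> u n x = g n x"
      using ug[of n] by blast
    then show ?thesis
      using L2_norm_cong_negligible[of "u n" "g n" N2] L2u[OF that] g(1)[OF that] by (simp add: g_def)
  qed
  ultimately show thesis using that chain by blast
qed

subsection \<open>Interpolation by cell averages\<close>

lemma deriv_chainD:
  assumes "deriv_chain k u" "m < k"
  shows "continuous_on {0..1} (u m)"
    and "x \<in> {0..1} \<Longrightarrow> u m x = u m 0 + integral {0..x} (u (Suc m))"
  using assms unfolding deriv_chain_def by blast+

lemma deriv_chain_derivative:
  assumes u: "deriv_chain k u" and m: "Suc m < k" and x: "x \<in> {0..1}"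
  shows "(u m has_real_derivative u (Suc m) x) (at x within {0..1})"
proof -
  have "((\<lambda>x. integral {0..x} (u (Suc m))) has_real_derivative u (Suc m) x) (at x within {0..1})"
    by (rule integral_has_real_derivative[OF deriv_chainD(1)[OF u m] x])
  then have "((\<lambda>x. u m 0 + integral {0..x} (u (Suc m))) has_real_derivative 0 + u (Suc m) x) (at x within {0..1})"
    by (intro DERIV_add DERIV_const)
  then have "((\<lambda>x. u m 0 + integral {0..x} (u (Suc m))) has_real_derivative u (Suc m) x) (at x within {0..1})"
    by simp
  then show ?thesis
  proof (rule has_field_derivative_transform_within[where d=1])
    show "u m 0 + integral {0..z} (u (Suc m)) = u m z" if "z \<in> {0..1}" for z
      using deriv_chainD(2)[OF u Suc_lessD[OF m] that] by (rule sym)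
  qed (use x in auto)
qed

lemma deriv_chain_L2:
  assumes u: "deriv_chain k u" and "m \<le> k"
  shows "L2_fun (u m)"
proof (cases "m = k")
  case True
  then show ?thesis using u unfolding deriv_chain_def by blast
next
  case False
  then show ?thesis using assms by (intro L2_fun_continuous deriv_chainD(1)[OF u]) auto
qed

lemma deriv_chain_diff:
  assumes u: "deriv_chain k u" and m: "m < k" and ab: "0 \<le> a" "a \<le> b" "b \<le> 1"
  shows "u m b - u m a = integral {a..b} (u (Suc m))"
proof -
  have "u (Suc m) integrable_on {0..1}"
    using u m by (intro set_lebesgue_integral_eq_integral(1) L2_funD deriv_chain_L2) auto
  then have "u (Suc m) integrable_on {0..b}"
    using ab integrable_on_subinterval[of _ "{0..1}" 0 b] by auto
  then have "integral {0..a} (u (Suc m)) + integral {a..b} (u (Suc m)) = integral {0..b} (u (Suc m))"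
    using ab by (intro Henstock_Kurzweil_Integration.integral_combine) auto
  moreover have "u m a = u m 0 + integral {0..a} (u (Suc m))" "u m b = u m 0 + integral {0..b} (u (Suc m))"
    using ab by (intro deriv_chainD(2)[OF u m]; simp)+
  ultimately show ?thesis by linarith
qed

section \<open>Iterated differences and cells\<close>

definition fdiff :: "real \<Rightarrow> (real \<Rightarrow> real) \<Rightarrow> real \<Rightarrow> real" where
  "fdiff d f x = f (x + d) - f x"

text \<open>The induction applies to the chain \<open>fdiff d (v m)\<close>, whose derivatives are
  again differences. It leaves a single difference of \<open>v n\<close>, to which the ordinary mean
  value theorem applies and which supplies the last factor d.\<close>

lemma fdiff_funpow_mean_value:
  assumes d: "0 < d"
    and der: "\<And>m x. m < n \<Longrightarrow> x \<in> {a..a + real n * d} \<Longrightarrow>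
      (v m has_real_derivative v (Suc m) x) (at x within {a..a + real n * d})"
  shows "\<exists>\<xi>\<in>{a..a + real n * d}. (fdiff d ^^ n) (v 0) a = d ^ n * v n \<xi>"
  using der
proof (induction n arbitrary: v)
  case 0
  show ?case by simp
next
  case (Suc n)
  have len: "a + real (Suc n) * d = a + real n * d + d" by (simp add: algebra_simps)
  note der = Suc.prems[unfolded len]
  have "\<exists>\<xi>\<in>{a..a + real n * d}. (fdiff d ^^ n) (fdiff d (v 0)) a = d ^ n * fdiff d (v n) \<xi>"
  proof (rule Suc.IH[of "\<lambda>m. fdiff d (v m)"])
    fix m x assume m: "m < n" and x: "x \<in> {a..a + real n * d}"
    have 1: "(v m has_real_derivative v (Suc m) x) (at x within {a..a + real n * d})"
      using m x d by (intro DERIV_subset[OF der]) auto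
    have "(v m has_real_derivative v (Suc m) (x + d)) (at (x + d) within (\<lambda>x. x + d) ` {a..a + real n * d})"
      using m x d by (intro DERIV_subset[OF der]) auto
    then have "(v m \<circ> (\<lambda>x. x + d) has_real_derivative v (Suc m) (x + d) * 1) (at x within {a..a + real n * d})"
      by (rule DERIV_image_chain) (auto intro!: derivative_eq_intros)
    then show "(fdiff d (v m) has_real_derivative fdiff d (v (Suc m)) x) (at x within {a..a + real n * d})"
      unfolding fdiff_def[abs_def] using DERIV_diff[OF _ 1] by (fastforce simp: o_def)
  qed
  then obtain \<xi> where \<xi>: "\<xi> \<in> {a..a + real n * d}"
    "(fdiff d ^^ n) (fdiff d (v 0)) a = d ^ n * fdiff d (v n) \<xi>" by blast
  have "\<exists>\<zeta>\<in>{\<xi><..<\<xi> + d}. v n (\<xi> + d) - v n \<xi> = v (Suc n) \<zeta> * (\<xi> + d - \<xi>)"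
  proof (rule mvt_simple[of \<xi> "\<xi> + d" "v n" "\<lambda>x. (*) (v (Suc n) x)"])
    fix x assume "\<xi> \<le> x" "x \<le> \<xi> + d"
    then have "(v n has_real_derivative v (Suc n) x) (at x within {\<xi>..\<xi> + d})"
      using \<xi>(1) d by (intro DERIV_subset[OF der]) auto
    then show "(v n has_derivative (*) (v (Suc n) x)) (at x within {\<xi>..\<xi> + d})"
      by (simp add: has_field_derivative_def)
  qed (use d in simp)
  then obtain \<zeta> where \<zeta>: "\<zeta> \<in> {\<xi><..<\<xi> + d}" "fdiff d (v n) \<xi> = d * v (Suc n) \<zeta>"
    by (auto simp: fdiff_def)
  have "(fdiff d ^^ Suc n) (v 0) a = d ^ Suc n * v (Suc n) \<zeta>"
    using \<xi>(2) \<zeta>(2) by (simp add: funpow_swap1)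
  moreover have "\<zeta> \<in> {a..a + real (Suc n) * d}"
    unfolding len using \<zeta>(1) \<xi>(1) by auto
  ultimately show ?case by blast
qed

lemma fdiff_funpow_bound:
  assumes "\<And>i. i \<le> m \<Longrightarrow> \<bar>g (a + real i * d)\<bar> \<le> B"
  shows "\<bar>(fdiff d ^^ m) g a\<bar> \<le> 2 ^ m * B"
  using assms
proof (induction m arbitrary: a)
  case 0
  from "0"[of 0] show ?case by simp
next
  case (Suc m)
  have "\<bar>(fdiff d ^^ m) g a\<bar> \<le> 2 ^ m * B"
    using Suc.prems by (intro Suc.IH) auto
  moreover have "\<bar>(fdiff d ^^ m) g (a + d)\<bar> \<le> 2 ^ m * B"
  proof (rule Suc.IH)
    fix i assume "i \<le> m"
    then show "\<bar>g (a + d + real i * d)\<bar> \<le> B"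
      using Suc.prems[of "Suc i"] by (simp add: algebra_simps)
  qed
  ultimately show ?case by (simp add: fdiff_def[of d "(fdiff d ^^ m) g"])
qed

text \<open>Cell i ends at the grid point i/n, so the cells between the grid points b/n and (b +
  m)/n are those numbered b + 1 to b + m; this is why the index set is open on the left.\<close>

lemma integral_cells:
  fixes h :: "real \<Rightarrow> real"
  assumes h: "h integrable_on {0..1}" and "0 < n" "b + m \<le> n"
  shows "(\<Sum>i\<in>{b<..b + m}. integral {(real i - 1) / real n..real i / real n} h)
    = integral {real b / real n..real (b + m) / real n} h"
  using assms(3)
proof (induction m)
  case (Suc m)
  have "{b<..b + Suc m} = insert (b + Suc m) {b<..b + m}" by auto
  then have "(\<Sum>i\<in>{b<..b + Suc m}. integral {(real i - 1) / real n..real i / real n} h)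
    = integral {real b / real n..real (b + m) / real n} h
      + integral {real (b + m) / real n..real (b + Suc m) / real n} h"
    using Suc by simp
  also have "\<dots> = integral {real b / real n..real (b + Suc m) / real n} h"
  proof (rule Henstock_Kurzweil_Integration.integral_combine)
    have "real (b + Suc m) / real n \<le> 1" using Suc.prems \<open>0 < n\<close> by simp
    then show "h integrable_on {real b / real n..real (b + Suc m) / real n}"
      by (intro integrable_on_subinterval[OF h]) auto
  qed (auto simp: divide_right_mono)
  finally show ?case .
qed simp

lemma integral_cells_unit:
  fixes h :: "real \<Rightarrow> real"
  assumes h: "h integrable_on {0..1}" and "0 < n"
  shows "(\<Sum>i=1..n. integral {(real i - 1) / real n..real i / real n} h) = integral {0..1} h"
  using integral_cells[OF h, of n 0 n] assms(2) by (simp add: atLeastSucAtMost_greaterThanAtMost)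

lemma cell_avg_eq:
  assumes f: "continuous_on {0..1} f" and i: "1 \<le> i" "i \<le> n"
  shows "cell_avg n f i = real n * integral {(real i - 1) / real n..real i / real n} f"
proof -
  have "{(real i - 1) / real n..real i / real n} \<subseteq> {0..1}"
    using i by (auto simp: field_simps)
  then have "f absolutely_integrable_on {(real i - 1) / real n..real i / real n}"
    by (intro absolutely_integrable_continuous_real continuous_on_subset[OF f])
  then have "integrable (lebesgue_on {(real i - 1) / real n..real i / real n}) f"
    by (intro absolutely_integrable_imp_integrable) auto
  then show ?thesis
    unfolding cell_avg_def mesh_def by (simp add: lebesgue_integral_eq_integral)
qed

text \<open>Cauchy-Schwarz against the constant 1, read off from the nonnegative integral of the
  square of |g| - t, where t is the mean of |g|.\<close>

lemma integral_abs_sq_le: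
  fixes g :: "real \<Rightarrow> real"
  assumes g: "g absolutely_integrable_on {a..b}" and g2: "(\<lambda>x. (g x)\<^sup>2) integrable_on {a..b}" and ab: "a \<le> b"
  shows "(integral {a..b} (\<lambda>x. \<bar>g x\<bar>))\<^sup>2 \<le> (b - a) * integral {a..b} (\<lambda>x. (g x)\<^sup>2)"
proof (cases "a = b")
  case False
  define I where "I = integral {a..b} (\<lambda>x. \<bar>g x\<bar>)"
  define t where "t = I / (b - a)"
  have ga: "(\<lambda>x. \<bar>g x\<bar>) integrable_on {a..b}"
    using g by (simp add: absolutely_integrable_on_def)
  have "((\<lambda>x. (g x)\<^sup>2 - 2 * t * \<bar>g x\<bar> + t\<^sup>2) has_integral
      (integral {a..b} (\<lambda>x. (g x)\<^sup>2) - 2 * t * I + t\<^sup>2 * (b - a))) {a..b}"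
    unfolding I_def using has_integral_const_real[of "t\<^sup>2" a b] ab
    by (intro has_integral_add has_integral_diff has_integral_mult_right integrable_integral g2 ga)
      (simp add: mult.commute)
  then have "0 \<le> integral {a..b} (\<lambda>x. (g x)\<^sup>2) - 2 * t * I + t\<^sup>2 * (b - a)"
  proof (rule has_integral_nonneg)
    fix x
    have "0 \<le> (\<bar>g x\<bar> - t)\<^sup>2" by simp
    then show "0 \<le> (g x)\<^sup>2 - 2 * t * \<bar>g x\<bar> + t\<^sup>2" by (simp add: power2_diff mult.commute mult.left_commute)
  qed
  then have "0 \<le> (b - a) * (integral {a..b} (\<lambda>x. (g x)\<^sup>2) - 2 * t * I + t\<^sup>2 * (b - a))"
    using ab by (intro mult_nonneg_nonneg) auto
  also have "\<dots> = (b - a) * integral {a..b} (\<lambda>x. (g x)\<^sup>2) - I\<^sup>2"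
  proof -
    have "I = t * (b - a)" using False by (simp add: t_def)
    then show ?thesis unfolding power2_eq_square by algebra
  qed
  finally show ?thesis by (simp add: I_def)
qed simp

lemma deriv_chain_oscillation:
  assumes u: "deriv_chain k u" and m: "m < k" and ab: "0 \<le> a" "b \<le> 1"
    and x: "x \<in> {a..b}" and z: "z \<in> {a..b}"
  shows "\<bar>u m x - u m z\<bar> \<le> integral {a..b} (\<lambda>t. \<bar>u (Suc m) t\<bar>)"
proof -
  have L2: "L2_fun (u (Suc m))" using u m by (intro deriv_chain_L2) auto
  have ai: "u (Suc m) absolutely_integrable_on {s..t}" if "0 \<le> s" "t \<le> 1" for s t
    by (rule absolutely_integrable_on_Icc_subset[OF L2_funD(2)[OF L2] that])
  have *: "\<bar>u m t - u m s\<bar> \<le> integral {a..b} (\<lambda>t. \<bar>u (Suc m) t\<bar>)" if "a \<le> s" "s \<le> t" "t \<le> b" for s t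
  proof -
    have 1: "u (Suc m) absolutely_integrable_on {s..t}" "u (Suc m) absolutely_integrable_on {a..b}"
      using that ab by (auto intro!: ai)
    have "\<bar>u m t - u m s\<bar> = norm (integral {s..t} (u (Suc m)))"
      using that ab by (subst deriv_chain_diff[OF u m]) auto
    also have "\<dots> \<le> integral {s..t} (\<lambda>t. \<bar>u (Suc m) t\<bar>)"
      using 1 by (intro integral_norm_bound_integral) (auto simp: absolutely_integrable_on_def)
    also have "\<dots> \<le> integral {a..b} (\<lambda>t. \<bar>u (Suc m) t\<bar>)"
      using 1 that by (intro integral_subset_le) (auto simp: absolutely_integrable_on_def)
    finally show ?thesis .
  qed
  show ?thesis
  proof (cases "z \<le> x")
    case True
    then show ?thesis using *[of z x] x z by auto
  next
    case False
    then show ?thesis using *[of x z] x z by (auto simp: abs_minus_commute)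
  qed
qed

text \<open>Of the m + 1 differences applied to the primitive, one produces cell integrals and the
  other m cost the factor 2^m. They involve m + 1 \<le> k adjacent cells, which fit into the block.
  Dividing by the powers of the step 1/n gives n^m.\<close>

lemma deriv_chain_block_point:
  assumes u: "deriv_chain k u" and m: "m < k" and n: "b + k \<le> n"
  shows "\<exists>\<xi>\<in>{real b / real n..real (b + k) / real n}.
    \<bar>u m \<xi>\<bar> \<le> 2 ^ m * real n ^ m * (\<Sum>l\<in>{b<..b + k}. \<bar>cell_avg n (u 0) l\<bar>)"
proof -
  define d where "d = 1 / real n"
  define a where "a = real b / real n"
  define B where "B = (\<Sum>l\<in>{b<..b + k}. \<bar>cell_avg n (u 0) l\<bar>)"
  define S where "S x = integral {0..x} (u 0)" for x
  have n0: "0 < real n" and d0: "0 < d" using m n by (auto simp: d_def)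
  have c0: "continuous_on {0..1} (u 0)" using u m by (intro deriv_chainD) auto
  have end_: "a + real (Suc m) * d \<le> real (b + k) / real n"
  proof -
    have "real (Suc m) * d \<le> real k * d" using m d0 by (intro mult_right_mono) auto
    then show ?thesis by (simp add: a_def d_def add_divide_distrib)
  qed
  also have "\<dots> \<le> 1" using n n0 by simp
  finally have end1: "a + real (Suc m) * d \<le> 1" .
  have a0: "0 \<le> a" by (simp add: a_def)
  \<comment> \<open>\<open>case_nat S u\<close> puts the primitive \<open>S\<close> in front of the
    chain, so that its member of index \<open>Suc m\<close> is \<open>u m\<close>.\<close>
  have "\<exists>\<xi>\<in>{a..a + real (Suc m) * d}. (fdiff d ^^ Suc m) (case_nat S u 0) a = d ^ Suc m * case_nat S u (Suc m) \<xi>"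
  proof (rule fdiff_funpow_mean_value[OF d0])
    fix j x assume j: "j < Suc m" and x: "x \<in> {a..a + real (Suc m) * d}"
    have "(case_nat S u j has_real_derivative case_nat S u (Suc j) x) (at x within {0..1})"
    proof (cases j)
      case 0
      have "x \<in> {0..1}" using x a0 end1 by auto
      then show ?thesis unfolding 0 S_def by (auto intro: integral_has_real_derivative[OF c0])
    next
      case (Suc i)
      then have "Suc i < k" using j m by simp
      moreover have "x \<in> {0..1}" using x a0 end1 by auto
      ultimately show ?thesis unfolding Suc using deriv_chain_derivative[OF u] by simp
    qed
    then show "(case_nat S u j has_real_derivative case_nat S u (Suc j) x) (at x within {a..a + real (Suc m) * d})"
      by (rule DERIV_subset) (use a0 end1 in auto)
  qed
  then obtain \<xi> where \<xi>: "\<xi> \<in> {a..a + real (Suc m) * d}" "(fdiff d ^^ m) (fdiff d S) a = d ^ Suc m * u m \<xi>"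
    by (auto simp: funpow_swap1)
  have "\<bar>(fdiff d ^^ m) (fdiff d S) a\<bar> \<le> 2 ^ m * (d * B)"
  proof (rule fdiff_funpow_bound)
    fix i assume i: "i \<le> m"
    let ?l = "b + i + 1"
    have eq: "a + real i * d = (real ?l - 1) / real n" "a + real i * d + d = real ?l / real n"
      using n0 by (auto simp: a_def d_def field_simps)
    have le: "real ?l / real n \<le> 1" using i m n n0 by simp
    have i0: "u 0 integrable_on {0..real ?l / real n}"
      using le by (intro integrable_continuous_real continuous_on_subset[OF c0]) auto
    have "integral {0..(real ?l - 1) / real n} (u 0) + integral {(real ?l - 1) / real n..real ?l / real n} (u 0)
       = integral {0..real ?l / real n} (u 0)"
      using n0 by (intro Henstock_Kurzweil_Integration.integral_combine i0) (auto simp: divide_right_mono)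
    then have "fdiff d S (a + real i * d) = integral {(real ?l - 1) / real n..real ?l / real n} (u 0)"
      unfolding fdiff_def S_def eq(2) unfolding eq(1) by simp
    also have "\<dots> = d * cell_avg n (u 0) ?l"
      using n0 i m n by (subst cell_avg_eq[OF c0]) (auto simp: d_def)
    finally have "\<bar>fdiff d S (a + real i * d)\<bar> = d * \<bar>cell_avg n (u 0) ?l\<bar>"
      using d0 by (simp add: abs_mult)
    also have "\<dots> \<le> d * B"
      unfolding B_def using d0 i m by (intro mult_left_mono member_le_sum) auto
    finally show "\<bar>fdiff d S (a + real i * d)\<bar> \<le> d * B" .
  qed
  then have "d ^ Suc m * \<bar>u m \<xi>\<bar> \<le> 2 ^ m * (d * B)"
    using \<xi>(2) d0 by (simp add: abs_mult power_abs)
  then have "d ^ m * \<bar>u m \<xi>\<bar> \<le> 2 ^ m * B"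
    using d0 by (simp add: mult.assoc mult.left_commute)
  then have "\<bar>u m \<xi>\<bar> \<le> 2 ^ m * real n ^ m * B"
    using n0 by (simp add: d_def power_divide field_simps)
  then show ?thesis
    using \<xi>(1) end_ unfolding B_def a_def by (intro bexI[of _ \<xi>]) auto
qed

text \<open>The induction descends from the derivative of order k - 1, with \<open>t\<close>
  counting the steps. At each level the value is at most that at the special point plus the integral
  of the next derivative over the block. The block length k/n contributes a power of 1/n and a
  factor k, and absorbing the value at the special point turns k into k + 1.\<close>

lemma deriv_chain_block_sup:
  assumes u: "deriv_chain k u" and n: "b + k \<le> n" and t: "t < k"
    and x: "x \<in> {real b / real n..real (b + k) / real n}"
  shows "\<bar>u (k - 1 - t) x\<bar> \<le> 2 ^ k * real (k + 1) ^ t *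
    (real n ^ (k - 1 - t) * (\<Sum>l\<in>{b<..b + k}. \<bar>cell_avg n (u 0) l\<bar>)
      + (1 / real n) ^ t * integral {real b / real n..real (b + k) / real n} (\<lambda>x. \<bar>u k x\<bar>))"
  using t x
proof (induction t arbitrary: x)
  have n0: "0 < real n" using t n by auto
  define \<alpha> where "\<alpha> = real b / real n"
  define \<beta> where "\<beta> = real (b + k) / real n"
  define B where "B = (\<Sum>l\<in>{b<..b + k}. \<bar>cell_avg n (u 0) l\<bar>)"
  define R where "R = integral {\<alpha>..\<beta>} (\<lambda>x. \<bar>u k x\<bar>)"
  have \<alpha>: "0 \<le> \<alpha>" "\<alpha> \<le> \<beta>" "\<beta> \<le> 1" using n n0 by (auto simp: \<alpha>_def \<beta>_def divide_right_mono)
  have B0: "0 \<le> B" by (simp add: B_def sum_nonneg)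
  have uk: "(\<lambda>x. \<bar>u m x\<bar>) integrable_on {\<alpha>..\<beta>}" if "m \<le> k" for m
    using absolutely_integrable_on_Icc_subset[OF L2_funD(2)[OF deriv_chain_L2[OF u that]] \<alpha>(1,3)]
    by (simp add: absolutely_integrable_on_def)
  have R0: "0 \<le> R" unfolding R_def by (intro integral_nonneg uk) auto
  note fold = \<alpha>_def[symmetric] \<beta>_def[symmetric] B_def[symmetric] R_def[symmetric]
  have start: "\<bar>u m x\<bar> \<le> 2 ^ k * real n ^ m * B + integral {\<alpha>..\<beta>} (\<lambda>x. \<bar>u (Suc m) x\<bar>)"
    if m: "m < k" and x: "x \<in> {\<alpha>..\<beta>}" for m x
  proof -
    obtain \<xi> where \<xi>: "\<xi> \<in> {\<alpha>..\<beta>}" "\<bar>u m \<xi>\<bar> \<le> 2 ^ m * real n ^ m * B"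
      using deriv_chain_block_point[OF u m n] unfolding fold by blast
    note \<xi>(2)
    also have "2 ^ m * real n ^ m * B \<le> 2 ^ k * real n ^ m * B"
      using m B0 by (intro mult_right_mono power_increasing) auto
    finally show ?thesis
      using deriv_chain_oscillation[OF u m \<alpha>(1,3) x \<xi>(1)] by linarith
  qed
  {
    case 0
    then have "\<bar>u (k - 1) x\<bar> \<le> 2 ^ k * real n ^ (k - 1) * B + R"
      using start[of "k - 1" x] unfolding fold by (simp add: R_def)
    also have "\<dots> \<le> 2 ^ k * real n ^ (k - 1) * B + 2 ^ k * R"
      using R0 by (simp add: mult_le_cancel_right1)
    finally show ?case unfolding fold by (simp add: algebra_simps)
  next
    case (Suc t)
    define m where "m = k - 1 - Suc t"
    have m: "m < k" "Suc m = k - 1 - t" using Suc.prems by (auto simp: m_def)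
    define E where "E = 2 ^ k * real (k + 1) ^ t * (real n ^ Suc m * B + (1 / real n) ^ t * R)"
    have "integral {\<alpha>..\<beta>} (\<lambda>x. \<bar>u (Suc m) x\<bar>) \<le> integral {\<alpha>..\<beta>} (\<lambda>x. E)"
    proof (intro integral_le uk)
      show "\<bar>u (Suc m) x\<bar> \<le> E" if "x \<in> {\<alpha>..\<beta>}" for x
        using Suc.IH[of x] Suc.prems(1) that unfolding fold m(2) E_def by simp
    qed (use m in auto)
    also have "\<dots> = real k / real n * E"
      using \<alpha>(2) by (simp add: \<alpha>_def \<beta>_def add_divide_distrib)
    also have "\<dots> = 2 ^ k * real (k + 1) ^ t * real k * (real n ^ m * B + (1 / real n) ^ Suc t * R)"
      using n0 by (simp add: E_def field_simps)
    finally have "\<bar>u m x\<bar> \<le> 2 ^ k * real n ^ m * B + 2 ^ k * real (k + 1) ^ t * real k * (real n ^ m * B + (1 / real n) ^ Suc t * R)"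
      using start[OF m(1), of x] Suc.prems(2) unfolding fold by linarith
    also have "\<dots> \<le> 2 ^ k * real (k + 1) ^ t * (real n ^ m * B + (1 / real n) ^ Suc t * R) + 2 ^ k * real (k + 1) ^ t * real k * (real n ^ m * B + (1 / real n) ^ Suc t * R)"
    proof -
      have "2 ^ k * (real n ^ m * B) \<le> 2 ^ k * real (k + 1) ^ t * (real n ^ m * B + (1 / real n) ^ Suc t * R)"
        using B0 R0 by (intro mult_mono) (auto intro!: one_le_power)
      then show ?thesis by (simp add: mult.assoc)
    qed
    also have "\<dots> = 2 ^ k * real (k + 1) ^ Suc t * (real n ^ m * B + (1 / real n) ^ Suc t * R)"
      by (simp add: algebra_simps)
    finally show ?case unfolding fold m_def .
  }
qed

definition mean_sq_avg :: "nat \<Rightarrow> (real \<Rightarrow> real) \<Rightarrow> real" where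
  "mean_sq_avg n f = (1 / real n) * (\<Sum>i=1..n. (cell_avg n f i)\<^sup>2)"

text \<open>Each cell \<open>i\<close> lies in a block of \<open>k\<close> consecutive cells; the blocks chosen below meet
  a given cell at most \<open>2k\<close> times.\<close>

lemma deriv_chain_interpolation:
  assumes u: "deriv_chain k u" and k: "0 < k" and n: "k \<le> n" and j: "j < k"
  shows "integral {0..1} (\<lambda>x. (u j x)\<^sup>2) \<le> 4 * (real k)\<^sup>2 * (2 ^ k * real (k + 1) ^ k)\<^sup>2 *
    (real n ^ (2 * j) * mean_sq_avg n (u 0) + (1 / real n) ^ (2 * (k - j)) * integral {0..1} (\<lambda>x. (u k x)\<^sup>2))"
proof -
  define E where "E = 2 ^ k * real (k + 1) ^ k"
  define cell where "cell i = {(real i - 1) / real n..real i / real n}" for i :: nat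
  define q where "q i = integral (cell i) (\<lambda>x. (u k x)\<^sup>2)" for i
  \<comment> \<open>The share of cell i in the squared pointwise bound on a block. The factor k
    comes from Cauchy-Schwarz over the k cells. The integral term carries the block length k/n and
    the power 2 (k - 1 - j) of 1/n, which together leave the factor n in front of the power 2 (k -
    j).\<close>
  define a where "a i = 2 * E\<^sup>2 * real k * (real n ^ (2 * j) * (cell_avg n (u 0) i)\<^sup>2
      + real n * (1 / real n) ^ (2 * (k - j)) * q i)" for i
  have n0: "0 < real n" "0 < n" using k n by auto
  have cell_sub: "cell i \<subseteq> {0..1}" if "i \<in> {1..n}" for i
    using that by (auto simp: cell_def field_simps)
  have sq: "(\<lambda>x. (u m x)\<^sup>2) integrable_on {0..1}" if "m \<le> k" for m
    by (intro set_lebesgue_integral_eq_integral(1) L2_funD(1) deriv_chain_L2[OF u that])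
  have sqc: "(\<lambda>x. (u m x)\<^sup>2) integrable_on cell i" if "m \<le> k" "i \<in> {1..n}" for m i
    using integrable_on_subinterval[OF sq[OF that(1)]] cell_sub[OF that(2)] by (auto simp: cell_def)
  have q0: "0 \<le> q i" if "i \<in> {1..n}" for i
    unfolding q_def using sqc[OF order_refl that] by (intro integral_nonneg) auto
  have a0: "0 \<le> a i" if "i \<in> {1..n}" for i
    unfolding a_def using q0[OF that] by simp
  have loc: "integral (cell i) (\<lambda>x. (u j x)\<^sup>2) \<le> (1 / real n) * (\<Sum>l\<in>{l\<in>{1..n}. l < i + k \<and> i < l + k}. a l)"
    if i: "i \<in> {1..n}" for i
  proof -
    \<comment> \<open>The block starts with cell i unless it would overrun the right end; in that
      case it consists of the last k cells.\<close>
    define b where "b = min (i - 1) (n - k)"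
    have b: "b + k \<le> n" "b < i" "i \<le> b + k" using i n k by (auto simp: b_def)
    define \<alpha> where "\<alpha> = real b / real n"
    define \<beta> where "\<beta> = real (b + k) / real n"
    define B where "B = (\<Sum>l\<in>{b<..b + k}. \<bar>cell_avg n (u 0) l\<bar>)"
    define R where "R = integral {\<alpha>..\<beta>} (\<lambda>x. \<bar>u k x\<bar>)"
    note fold = \<alpha>_def[symmetric] \<beta>_def[symmetric] B_def[symmetric] R_def[symmetric]
    have \<alpha>: "0 \<le> \<alpha>" "\<alpha> \<le> \<beta>" "\<beta> \<le> 1" "\<beta> - \<alpha> = real k / real n"
      using b n0 by (simp_all add: \<alpha>_def \<beta>_def divide_right_mono flip: diff_divide_distrib)
    have B2: "B\<^sup>2 \<le> real k * (\<Sum>l\<in>{b<..b + k}. (cell_avg n (u 0) l)\<^sup>2)"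
    proof -
      have "B\<^sup>2 = (\<Sum>l\<in>{b<..b + k}. 1 * \<bar>cell_avg n (u 0) l\<bar>)\<^sup>2" by (simp add: B_def)
      also have "\<dots> \<le> (\<Sum>l\<in>{b<..b + k}. 1\<^sup>2) * (\<Sum>l\<in>{b<..b + k}. \<bar>cell_avg n (u 0) l\<bar>\<^sup>2)"
        by (rule Cauchy_Schwarz_ineq_sum)
      finally show ?thesis by simp
    qed
    have R2: "R\<^sup>2 \<le> real k / real n * (\<Sum>l\<in>{b<..b + k}. q l)"
    proof -
      have "R\<^sup>2 \<le> (\<beta> - \<alpha>) * integral {\<alpha>..\<beta>} (\<lambda>x. (u k x)\<^sup>2)"
        unfolding R_def
      proof (rule integral_abs_sq_le)
        show "u k absolutely_integrable_on {\<alpha>..\<beta>}"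
          by (rule absolutely_integrable_on_Icc_subset[OF L2_funD(2)[OF deriv_chain_L2[OF u order_refl]] \<alpha>(1,3)])
        show "(\<lambda>x. (u k x)\<^sup>2) integrable_on {\<alpha>..\<beta>}"
          using \<alpha> by (intro integrable_on_subinterval[OF sq[OF order_refl]]) auto
      qed (rule \<alpha>)
      also have "integral {\<alpha>..\<beta>} (\<lambda>x. (u k x)\<^sup>2) = (\<Sum>l\<in>{b<..b + k}. q l)"
        unfolding q_def cell_def \<alpha>_def \<beta>_def using integral_cells[OF sq[OF order_refl] n0(2) b(1)] by simp
      finally show ?thesis unfolding \<alpha>(4) .
    qed
    have pt: "(u j x)\<^sup>2 \<le> (\<Sum>l\<in>{b<..b + k}. a l)" if x: "x \<in> cell i" for x
    proof -
      have "(real i - 1) / real n \<ge> \<alpha>" "real i / real n \<le> \<beta>"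
        unfolding \<alpha>_def \<beta>_def using b by (auto intro!: divide_right_mono)
      then have x': "x \<in> {\<alpha>..\<beta>}" using x by (auto simp: cell_def)
      define t where "t = k - 1 - j"
      have t: "t < k" "k - 1 - t = j" using j by (auto simp: t_def)
      have R0: "0 \<le> R" "0 \<le> B"
        using absolutely_integrable_on_Icc_subset[OF L2_funD(2)[OF deriv_chain_L2[OF u order_refl]] \<alpha>(1,3)]
        unfolding R_def B_def by (auto intro!: integral_nonneg sum_nonneg simp: absolutely_integrable_on_def)
      have "\<bar>u j x\<bar> \<le> 2 ^ k * real (k + 1) ^ t * (real n ^ j * B + (1 / real n) ^ t * R)"
        using deriv_chain_block_sup[OF u b(1) t(1), of x] x' unfolding fold t(2) by simp
      also have "\<dots> \<le> E * (real n ^ j * B + (1 / real n) ^ t * R)"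
        unfolding E_def using R0 t by (intro mult_right_mono mult_left_mono power_increasing) auto
      finally have "\<bar>u j x\<bar>\<^sup>2 \<le> (E * (real n ^ j * B + (1 / real n) ^ t * R))\<^sup>2"
        by (intro power_mono) auto
      also have "\<dots> \<le> E\<^sup>2 * (2 * (real n ^ j * B)\<^sup>2 + 2 * ((1 / real n) ^ t * R)\<^sup>2)"
      proof -
        have "0 \<le> (real n ^ j * B - (1 / real n) ^ t * R)\<^sup>2" by simp
        then show ?thesis unfolding power_mult_distrib[of E]
          by (intro mult_left_mono) (auto simp: power2_sum power2_diff)
      qed
      also have "\<dots> = 2 * E\<^sup>2 * (real n ^ (2 * j) * B\<^sup>2 + (1 / real n) ^ (2 * t) * R\<^sup>2)"
        by (simp add: power_mult_distrib power_mult[symmetric] mult.commute algebra_simps)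
      also have "\<dots> \<le> 2 * E\<^sup>2 * (real n ^ (2 * j) * (real k * (\<Sum>l\<in>{b<..b + k}. (cell_avg n (u 0) l)\<^sup>2))
          + (1 / real n) ^ (2 * t) * (real k / real n * (\<Sum>l\<in>{b<..b + k}. q l)))"
        by (intro mult_left_mono add_mono B2 R2) auto
      also have "(1 / real n) ^ (2 * t) * (real k / real n * (\<Sum>l\<in>{b<..b + k}. q l))
          = real k * (real n * (1 / real n) ^ (2 * (k - j)) * (\<Sum>l\<in>{b<..b + k}. q l))"
      proof -
        have "2 * (k - j) = Suc (Suc (2 * t))" using j by (simp add: t_def)
        then show ?thesis using n0 by simp
      qed
      also have "2 * E\<^sup>2 * (real n ^ (2 * j) * (real k * (\<Sum>l\<in>{b<..b + k}. (cell_avg n (u 0) l)\<^sup>2))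
          + real k * (real n * (1 / real n) ^ (2 * (k - j)) * (\<Sum>l\<in>{b<..b + k}. q l))) = (\<Sum>l\<in>{b<..b + k}. a l)"
        unfolding a_def by (simp add: sum_distrib_left sum_distrib_right sum.distrib algebra_simps)
      finally show ?thesis by simp
    qed
    have "integral (cell i) (\<lambda>x. (u j x)\<^sup>2) \<le> integral (cell i) (\<lambda>x. \<Sum>l\<in>{b<..b + k}. a l)"
      using j i by (intro integral_le sqc pt) (auto simp: cell_def)
    also have "\<dots> = (1 / real n) * (\<Sum>l\<in>{b<..b + k}. a l)"
      unfolding cell_def using n0 by (simp add: divide_right_mono diff_divide_distrib)
    also have "\<dots> \<le> (1 / real n) * (\<Sum>l\<in>{l\<in>{1..n}. l < i + k \<and> i < l + k}. a l)"
      using b a0 by (intro mult_left_mono sum_mono2) auto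
    finally show ?thesis .
  qed
  have "integral {0..1} (\<lambda>x. (u j x)\<^sup>2) = (\<Sum>i=1..n. integral (cell i) (\<lambda>x. (u j x)\<^sup>2))"
    unfolding cell_def using j by (intro integral_cells_unit[symmetric] sq n0) auto
  also have "\<dots> \<le> (\<Sum>i=1..n. (1 / real n) * (\<Sum>l\<in>{l\<in>{1..n}. l < i + k \<and> i < l + k}. a l))"
    by (intro sum_mono loc) auto
  also have "\<dots> = (1 / real n) * (\<Sum>i=1..n. \<Sum>l=1..n. if l < i + k \<and> i < l + k then a l else 0)"
    unfolding sum_distrib_left[symmetric] by (subst sum.inter_filter) simp_all
  also have "\<dots> = (1 / real n) * (\<Sum>l=1..n. \<Sum>i=1..n. if l < i + k \<and> i < l + k then a l else 0)"
    by (subst sum.swap) simp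
  also have "\<dots> \<le> (1 / real n) * (\<Sum>l=1..n. 2 * real k * a l)"
  proof (intro mult_left_mono sum_mono)
    fix l assume l: "l \<in> {1..n}"
    have "(\<Sum>i=1..n. if l < i + k \<and> i < l + k then a l else 0) = (\<Sum>i\<in>{i\<in>{1..n}. l < i + k \<and> i < l + k}. a l)"
      by (rule sum.inter_filter[symmetric]) simp
    also have "\<dots> = real (card {i\<in>{1..n}. l < i + k \<and> i < l + k}) * a l" by simp
    also have "\<dots> \<le> real (2 * k) * a l"
    proof (intro mult_right_mono a0 l)
      have "card {i\<in>{1..n}. l < i + k \<and> i < l + k} \<le> card {l - k..<l + k}"
        by (intro card_mono) auto
      then show "real (card {i\<in>{1..n}. l < i + k \<and> i < l + k}) \<le> real (2 * k)" by simp
    qed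
    finally show "(\<Sum>i=1..n. if l < i + k \<and> i < l + k then a l else 0) \<le> 2 * real k * a l" by simp
  qed auto
  also have "\<dots> = 4 * (real k)\<^sup>2 * E\<^sup>2 * (real n ^ (2 * j) * mean_sq_avg n (u 0) + (1 / real n) ^ (2 * (k - j)) * (\<Sum>l=1..n. q l))"
    using n0 unfolding a_def mean_sq_avg_def
    by (simp add: sum_distrib_left sum_distrib_right sum.distrib power2_eq_square algebra_simps sum_divide_distrib)
  also have "(\<Sum>l=1..n. q l) = integral {0..1} (\<lambda>x. (u k x)\<^sup>2)"
    unfolding q_def cell_def by (intro integral_cells_unit sq n0) auto
  finally show ?thesis unfolding E_def .
qed

subsection \<open>Concentration of the noise level\<close>

text \<open>Since x > 1, y < x (1 + (y - x)) \<le> x exp(y - x). This strict decrease gives the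
  uniqueness behind the definite description in \<open>zbar\<close>.\<close>

lemma x_exp_less:
  fixes x y :: real
  assumes "1 < x" "x < y"
  shows "y * exp (1 - y) < x * exp (1 - x)"
proof -
  have "1 * (y - x) < x * (y - x)"
    using assms by (intro mult_strict_right_mono) auto
  then have "y < x * (1 + (y - x))" by (simp add: algebra_simps)
  also have "\<dots> \<le> x * exp (y - x)"
    using assms exp_ge_add_one_self[of "y - x"] by (intro mult_left_mono) auto
  finally have "y * exp (1 - y) < x * exp (y - x) * exp (1 - y)" by simp
  then show ?thesis by (simp add: mult.assoc exp_add[symmetric])
qed

text \<open>The last bound does not involve M, as constants independent of the mesh require. It
  follows from p^2 \<le> p^(2/M) and x \<le> 2 exp(x/2), which together turn the defining equation
  into p^2 \<le> 2 exp(1 - x/2).\<close>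

lemma zbar:
  assumes p: "0 < p" "p < 1" and M: "0 < M"
  shows "1 < zbar M p" and "zbar M p * exp (1 - zbar M p) = p powr (2 / real M)"
    and "zbar M p \<le> 2 * (1 + ln (2 / p\<^sup>2))"
proof -
  define v where "v = p powr (2 / real M)"
  have v: "0 < v" "v < 1" using p M powr_less_mono2[of "2 / real M" p 1] by (auto simp: v_def)
  have "p powr 2 \<le> p powr (2 / real M)"
    using p M by (intro powr_mono') (auto simp: field_simps)
  then have vp: "p\<^sup>2 \<le> v" using p by (simp add: v_def powr_numeral)
  have bound: "x \<le> 2 * (1 + ln (2 / p\<^sup>2))" if "v \<le> x * exp (1 - x)" for x
  proof -
    have "x \<le> 2 * exp (x / 2)" using exp_ge_add_one_self[of "x / 2"] by linarith
    then have "x * exp (1 - x) \<le> 2 * exp (x / 2) * exp (1 - x)" by (intro mult_right_mono) auto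
    then have "p\<^sup>2 \<le> 2 * exp (1 - x / 2)" using that vp by (simp add: mult.assoc exp_add[symmetric])
    then have "p\<^sup>2 / 2 \<le> exp (1 - x / 2)" by simp
    then have "ln (p\<^sup>2 / 2) \<le> ln (exp (1 - x / 2))" using p by (subst ln_le_cancel_iff) auto
    moreover have "ln (p\<^sup>2 / 2) = - ln (2 / p\<^sup>2)" using p by (simp add: ln_div)
    ultimately show ?thesis by simp
  qed
  \<comment> \<open>Any point beyond the bound just proved already has x exp(1 - x) below v, so it
    serves as right end for the intermediate value theorem.\<close>
  define b where "b = max 2 (2 * (1 + ln (2 / p\<^sup>2)) + 1)"
  have b1: "1 \<le> b" by (simp add: b_def)
  have "b * exp (1 - b) \<le> v"
  proof (rule ccontr)
    assume "\<not> b * exp (1 - b) \<le> v"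
    then have "b \<le> 2 * (1 + ln (2 / p\<^sup>2))" by (intro bound) simp
    then show False by (simp add: b_def)
  qed
  moreover have "continuous_on {1..b} (\<lambda>x. x * exp (1 - x))" by (intro continuous_intros)
  ultimately obtain x where x: "1 \<le> x" "x \<le> b" "x * exp (1 - x) = v"
    using IVT2'[of "\<lambda>x. x * exp (1 - x)" b v 1] v b1 by auto
  then have "1 < x" using v by (cases "x = 1") auto
  have "\<exists>!x. 1 < x \<and> x * exp (1 - x) = v"
  proof (rule ex1I[of _ x])
    fix y assume y: "1 < y \<and> y * exp (1 - y) = v"
    then show "y = x"
      using x_exp_less[of x y] x_exp_less[of y x] \<open>1 < x\<close> x(3) by (cases x y rule: linorder_cases) auto
  qed (use x \<open>1 < x\<close> in auto)
  then have "1 < zbar M p \<and> zbar M p * exp (1 - zbar M p) = v"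
    unfolding zbar_def v_def by (rule theI')
  then show "1 < zbar M p" "zbar M p * exp (1 - zbar M p) = p powr (2 / real M)"
    "zbar M p \<le> 2 * (1 + ln (2 / p\<^sup>2))"
    using bound[of "zbar M p"] by (auto simp: v_def)
qed

text \<open>Multiplying the standard normal density by this exponential leaves the Gaussian exponent
  -x^2 / (2 z): the result is sqrt z times the density of variance z, whose total mass is
  known.\<close>

lemma (in prob_space) nn_expectation_exp_square_normal:
  assumes X: "distributed M lborel X std_normal_density" and z: "1 < z"
  shows "(\<integral>\<^sup>+\<omega>. ennreal (exp ((1 - 1 / z) / 2 * (X \<omega>)\<^sup>2)) \<partial>M) = ennreal (sqrt z)"
proof -
  have eq: "std_normal_density x * exp ((1 - 1 / z) / 2 * x\<^sup>2) = sqrt z * normal_density 0 (sqrt z) x" for x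
  proof -
    have "- x\<^sup>2 / 2 + (1 - 1 / z) / 2 * x\<^sup>2 = - x\<^sup>2 / (2 * z)" using z by (simp add: field_simps)
    then have "exp (- x\<^sup>2 / 2) * exp ((1 - 1 / z) / 2 * x\<^sup>2) = exp (- x\<^sup>2 / (2 * z))"
      by (simp add: exp_add[symmetric])
    then show ?thesis
      using z unfolding normal_density_def by (simp add: real_sqrt_mult)
  qed
  have "(\<integral>\<^sup>+\<omega>. ennreal (exp ((1 - 1 / z) / 2 * (X \<omega>)\<^sup>2)) \<partial>M)
    = (\<integral>\<^sup>+x. ennreal (std_normal_density x) * ennreal (exp ((1 - 1 / z) / 2 * x\<^sup>2)) \<partial>lborel)"
    by (rule distributed_nn_integral[OF X, symmetric]) simp
  also have "\<dots> = (\<integral>\<^sup>+x. ennreal (sqrt z) * ennreal (normal_density 0 (sqrt z) x) \<partial>lborel)"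
    unfolding ennreal_mult[symmetric, OF normal_density_nonneg exp_ge_zero] eq
    using z by (simp add: ennreal_mult)
  also have "\<dots> = ennreal (sqrt z) * (\<integral>\<^sup>+x. ennreal (normal_density 0 (sqrt z) x) \<partial>lborel)"
    by (rule nn_integral_cmult) simp
  also have "(\<integral>\<^sup>+x. ennreal (normal_density 0 (sqrt z) x) \<partial>lborel) = ennreal 1"
    using z by (subst nn_integral_eq_integral) auto
  finally show ?thesis by simp
qed

lemma (in prob_space) chi_square_tail:
  assumes I: "finite I" and ind: "indep_vars (\<lambda>_. borel) X I"
    and X: "\<And>i. i \<in> I \<Longrightarrow> distributed M lborel (X i) std_normal_density" and z: "1 < z"
  shows "prob {\<omega>\<in>space M. z * real (card I) \<le> (\<Sum>i\<in>I. (X i \<omega>)\<^sup>2)} \<le> (sqrt (z * exp (1 - z))) ^ card I"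
proof -
  \<comment> \<open>The minimizer of exp(-t z) / sqrt(1 - 2 t), the Chernoff bound per degree of
    freedom. Here 1 - 2 t = 1/z and t z = (z - 1)/2, whence the value sqrt(z exp(1 - z)).\<close>
  define t where "t = (1 - 1 / z) / 2"
  have t: "0 < t" using z by (simp add: t_def)
  have [measurable]: "X i \<in> borel_measurable M" if "i \<in> I" for i
    using ind that by (auto simp: indep_vars_def)
  have "emeasure M {\<omega>\<in>space M. z * real (card I) \<le> (\<Sum>i\<in>I. (X i \<omega>)\<^sup>2)}
    \<le> ennreal (exp (- t * (z * real (card I)))) *
      (\<integral>\<^sup>+\<omega>\<in>space M. ennreal (exp (t * (\<Sum>i\<in>I. (X i \<omega>)\<^sup>2))) \<partial>M)"
    by (rule Chernoff_ineq_nn_integral_ge[OF t]) auto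
  also have "(\<integral>\<^sup>+\<omega>\<in>space M. ennreal (exp (t * (\<Sum>i\<in>I. (X i \<omega>)\<^sup>2))) \<partial>M)
    = (\<integral>\<^sup>+\<omega>. (\<Prod>i\<in>I. ennreal (exp (t * (X i \<omega>)\<^sup>2))) \<partial>M)"
    by (intro nn_integral_cong) (simp add: sum_distrib_left exp_sum[OF I] prod_ennreal)
  also have "\<dots> = (\<Prod>i\<in>I. \<integral>\<^sup>+\<omega>. ennreal (exp (t * (X i \<omega>)\<^sup>2)) \<partial>M)"
    by (rule indep_vars_nn_integral[OF I indep_vars_compose2[OF ind, of "\<lambda>_ x. ennreal (exp (t * x\<^sup>2))"]]) auto
  also have "\<dots> = (\<Prod>i\<in>I. ennreal (sqrt z))"
    unfolding t_def by (intro prod.cong refl nn_expectation_exp_square_normal X z)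
  also have "\<dots> = ennreal (sqrt z ^ card I)"
    using z by (simp add: ennreal_power)
  also have "ennreal (exp (- t * (z * real (card I)))) * ennreal (sqrt z ^ card I)
    = ennreal (exp (- t * z) ^ card I * sqrt z ^ card I)"
    using z by (simp add: ennreal_mult exp_of_nat_mult[symmetric] mult_ac)
  also have "exp (- t * z) ^ card I * sqrt z ^ card I = (sqrt (z * exp (1 - z))) ^ card I"
  proof -
    have "exp (- t * z) = exp ((1 - z) / 2)" using z by (simp add: t_def field_simps)
    also have "\<dots> = sqrt (exp (1 - z))"
      by (rule real_sqrt_unique[symmetric]) (simp_all add: power2_eq_square exp_add[symmetric])
    finally show ?thesis by (simp add: power_mult_distrib[symmetric] real_sqrt_mult mult.commute)
  qed
  finally show ?thesis
    using z by (simp add: emeasure_eq_measure)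
qed

section \<open>Gaussian noise averaged over groups\<close>

context
  fixes P :: "'w measure" and M N :: nat and \<sigma> :: real and \<eta> :: "nat \<Rightarrow> 'w \<Rightarrow> real"
  assumes noise: "gaussian_noise P (M * N) \<sigma> \<eta>" and M: "0 < M" and N: "0 < N" and \<sigma>: "0 < \<sigma>"
begin

interpretation P: prob_space P
  using noise by (simp add: gaussian_noise_def)

definition group_index :: "nat \<Rightarrow> nat set" where
  "group_index i = (\<lambda>j. (i - 1) * N + j) ` {1..N}"

lemma group_index_le: "i \<in> {1..M} \<Longrightarrow> j \<in> {1..N} \<Longrightarrow> (i - 1) * N + j \<in> {1..M * N}"
proof -
  assume i: "i \<in> {1..M}" and j: "j \<in> {1..N}"
  then have "(i - 1) * N + j \<le> (i - 1) * N + N" by simp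
  also have "\<dots> = i * N" using i by (cases i) auto
  also have "\<dots> \<le> M * N" using i by simp
  finally show ?thesis using j by simp
qed

lemma disjoint_group_index: "disjoint_family_on group_index {1..M}"
proof -
  have less: False
    if "i < i'" "1 \<le> i" "(i - 1) * N + j = (i' - 1) * N + j'" "j \<le> N" "1 \<le> j'" for i i' j j'
  proof -
    have "(i - 1) * N + N = i * N" using that by (cases i) auto
    also have "\<dots> \<le> (i' - 1) * N" using that by (intro mult_right_mono) auto
    finally show False using that by linarith
  qed
  have "i = i'" if i: "i \<in> {1..M}" "i' \<in> {1..M}" and l: "l \<in> group_index i" "l \<in> group_index i'" for i i' l
  proof -
    obtain j j' where "j \<in> {1..N}" "j' \<in> {1..N}" "l = (i - 1) * N + j" "l = (i' - 1) * N + j'"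
      using l unfolding group_index_def by blast
    then show ?thesis
      using less[of i i' j j'] less[of i' i j' j] i by (cases i i' rule: linorder_cases) auto
  qed
  then show ?thesis
    unfolding disjoint_family_on_def by blast
qed

text \<open>The exact samples cancel, so only the noise remains, whatever \<open>y\<close> is. The
  sum of a group has variance N \<sigma>^2, and the normalising factor makes it standard
  normal.\<close>

lemma noise_level_sq_eq:
  "noise_level_sq M N y \<eta> \<omega> = \<sigma>\<^sup>2 / (real M * real N) *
    (\<Sum>i=1..M. (1 / (sqrt (real N) * \<sigma>) * (\<Sum>l\<in>group_index i. \<eta> l \<omega>))\<^sup>2)"
proof -
  define T where "T i = (\<Sum>l\<in>group_index i. \<eta> l \<omega>)" for i
  have T: "T i = (\<Sum>j=1..N. \<eta> ((i - 1) * N + j) \<omega>)" for i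
    unfolding T_def group_index_def by (subst sum.reindex) (auto simp: inj_on_def)
  have "group_avg N (noisy_samples (M * N) y \<eta> \<omega>) i - group_avg N (exact_samples (M * N) y) i = T i / real N" for i
    unfolding group_avg_def noisy_samples_def T by (simp add: sum.distrib diff_divide_distrib[symmetric])
  then have "noise_level_sq M N y \<eta> \<omega> = (1 / real M) * (\<Sum>i=1..M. (T i / real N)\<^sup>2)"
    unfolding noise_level_sq_def by simp
  also have "(\<Sum>i=1..M. (T i / real N)\<^sup>2) = (\<Sum>i=1..M. \<sigma>\<^sup>2 / real N * (1 / (sqrt (real N) * \<sigma>) * T i)\<^sup>2)"
    using N \<sigma> by (intro sum.cong refl) (simp add: power_mult_distrib power_divide, simp add: power2_eq_square)
  finally show ?thesis
    unfolding T_def sum_distrib_left[symmetric] by simp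
qed

lemma noise_level_concentration:
  assumes p: "0 < p" "p < 1"
  shows "{\<omega> \<in> space P. noise_level_sq M N y \<eta> \<omega> \<le> zbar M p * \<sigma>\<^sup>2 / real N} \<in> sets P"
    and "measure P {\<omega> \<in> space P. noise_level_sq M N y \<eta> \<omega> \<le> zbar M p * \<sigma>\<^sup>2 / real N} \<ge> 1 - p"
proof -
  define X where "X i \<omega> = 1 / (sqrt (real N) * \<sigma>) * (\<Sum>l\<in>group_index i. \<eta> l \<omega>)" for i \<omega>
  define z where "z = zbar M p"
  have z: "1 < z" "z * exp (1 - z) = p powr (2 / real M)"
    using zbar[OF p M] by (auto simp: z_def)
  have sub: "group_index i \<subseteq> {1..M * N}" if "i \<in> {1..M}" for i
    unfolding group_index_def using group_index_le[OF that] by blast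
  have ind0: "P.indep_vars (\<lambda>_. borel) \<eta> {1..M * N}"
    using noise by (simp add: gaussian_noise_def)
  have "P.indep_vars (\<lambda>i. PiM (group_index i) (\<lambda>_. borel)) (\<lambda>i \<omega>. restrict (\<lambda>l. \<eta> l \<omega>) (group_index i)) {1..M}"
    by (rule P.indep_vars_restrict[OF ind0 sub disjoint_group_index])
  then have "P.indep_vars (\<lambda>_. borel) (\<lambda>i \<omega>. (\<lambda>f. 1 / (sqrt (real N) * \<sigma>) * (\<Sum>l\<in>group_index i. f l))
      (restrict (\<lambda>l. \<eta> l \<omega>) (group_index i))) {1..M}"
    by (rule P.indep_vars_compose2) (auto intro!: borel_measurable_times borel_measurable_sum measurable_component_singleton)
  then have ind: "P.indep_vars (\<lambda>_. borel) X {1..M}"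
    by (simp add: X_def[abs_def] cong: sum.cong)
  have dist: "distributed P lborel (X i) std_normal_density" if i: "i \<in> {1..M}" for i
  proof -
    have c: "card (group_index i) = N"
      unfolding group_index_def by (subst card_image) (auto simp: inj_on_def)
    have "distributed P lborel (\<lambda>\<omega>. \<Sum>l\<in>group_index i. \<eta> l \<omega>)
        (normal_density (\<Sum>l\<in>group_index i. 0) (sqrt (\<Sum>l\<in>group_index i. \<sigma>\<^sup>2)))"
      using N \<sigma> sub[OF i] noise
      by (intro P.sum_indep_normal P.indep_vars_subset[OF ind0 sub[OF i]])
        (auto simp: gaussian_noise_def group_index_def)
    then have "distributed P lborel (\<lambda>\<omega>. \<Sum>l\<in>group_index i. \<eta> l \<omega>) (normal_density 0 (sqrt (real N) * \<sigma>))"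
      using c \<sigma> by (simp add: real_sqrt_mult)
    then have "distributed P lborel (\<lambda>\<omega>. 0 + 1 / (sqrt (real N) * \<sigma>) * (\<Sum>l\<in>group_index i. \<eta> l \<omega>))
       (normal_density (0 + 1 / (sqrt (real N) * \<sigma>) * 0) (\<bar>1 / (sqrt (real N) * \<sigma>)\<bar> * (sqrt (real N) * \<sigma>)))"
      using N \<sigma> by (intro P.normal_density_affine) auto
    moreover have "\<bar>1 / (sqrt (real N) * \<sigma>)\<bar> * (sqrt (real N) * \<sigma>) = 1" using N \<sigma> by (simp add: abs_mult)
    ultimately show ?thesis by (simp add: X_def[abs_def])
  qed
  have [measurable]: "X i \<in> borel_measurable P" if "i \<in> {1..M}" for i
    using ind that by (auto simp: P.indep_vars_def)
  have le_iff: "noise_level_sq M N y \<eta> \<omega> \<le> z * \<sigma>\<^sup>2 / real N \<longleftrightarrow> (\<Sum>i=1..M. (X i \<omega>)\<^sup>2) \<le> z * real M" for \<omega>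
    unfolding noise_level_sq_eq X_def[symmetric] using M N \<sigma> by (simp add: field_simps)
  have "{\<omega> \<in> space P. (\<Sum>i=1..M. (X i \<omega>)\<^sup>2) \<le> z * real M} \<in> sets P" by measurable
  then show A: "{\<omega> \<in> space P. noise_level_sq M N y \<eta> \<omega> \<le> zbar M p * \<sigma>\<^sup>2 / real N} \<in> sets P"
    by (simp add: le_iff z_def[symmetric])
  have B: "{\<omega>\<in>space P. z * real (card {1..M}) \<le> (\<Sum>i=1..M. (X i \<omega>)\<^sup>2)} \<in> sets P"
    by measurable
  have "P.prob {\<omega>\<in>space P. z * real (card {1..M}) \<le> (\<Sum>i=1..M. (X i \<omega>)\<^sup>2)} \<le> (sqrt (z * exp (1 - z))) ^ card {1..M}"
    by (rule P.chi_square_tail[OF _ ind dist z(1)]) auto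
  also have "\<dots> = p"
  proof -
    have "sqrt (p powr (2 / real M)) = p powr (1 / real M)"
      using p by (simp add: powr_half_sqrt[symmetric] powr_powr)
    then show ?thesis using z(2) p M by (simp add: powr_realpow[symmetric] powr_powr)
  qed
  finally have bad: "P.prob {\<omega>\<in>space P. z * real (card {1..M}) \<le> (\<Sum>i=1..M. (X i \<omega>)\<^sup>2)} \<le> p" .
  \<comment> \<open>The tail event includes equality, so its complement is the strict inequality and
    lies inside the wanted event.\<close>
  have "1 - p \<le> 1 - P.prob {\<omega>\<in>space P. z * real (card {1..M}) \<le> (\<Sum>i=1..M. (X i \<omega>)\<^sup>2)}" using bad by simp
  also have "\<dots> = P.prob (space P - {\<omega>\<in>space P. z * real (card {1..M}) \<le> (\<Sum>i=1..M. (X i \<omega>)\<^sup>2)})"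
    by (rule P.prob_compl[OF B, symmetric])
  also have "\<dots> \<le> P.prob {\<omega> \<in> space P. noise_level_sq M N y \<eta> \<omega> \<le> zbar M p * \<sigma>\<^sup>2 / real N}"
    by (rule P.finite_measure_mono[OF _ A]) (auto simp: le_iff z_def[symmetric])
  finally show "measure P {\<omega> \<in> space P. noise_level_sq M N y \<eta> \<omega> \<le> zbar M p * \<sigma>\<^sup>2 / real N} \<ge> 1 - p" .
qed

end

subsection \<open>Deterministic estimates\<close>

lemma cell_avg_lincomb:
  assumes f: "continuous_on {0..1} f" and g: "continuous_on {0..1} g" and i: "1 \<le> i" "i \<le> n"
  shows "cell_avg n (\<lambda>x. a * f x + b * g x) i = a * cell_avg n f i + b * cell_avg n g i"
proof -
  have sub: "{(real i - 1) / real n..real i / real n} \<subseteq> {0..1}"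
    using i by (auto simp: field_simps)
  have "integral {(real i - 1) / real n..real i / real n} (\<lambda>x. a * f x + b * g x)
    = a * integral {(real i - 1) / real n..real i / real n} f + b * integral {(real i - 1) / real n..real i / real n} g"
    by (intro integral_unique has_integral_add has_integral_mult_right integrable_integral
        integrable_continuous_real continuous_on_subset[OF f sub] continuous_on_subset[OF g sub])
  then show ?thesis
    using i f g by (simp add: cell_avg_eq continuous_intros algebra_simps)
qed

lemma cell_avg_diff:
  assumes "continuous_on {0..1} f" "continuous_on {0..1} g" "1 \<le> i" "i \<le> n"
  shows "cell_avg n (\<lambda>x. f x - g x) i = cell_avg n f i - cell_avg n g i"
  using cell_avg_lincomb[OF assms, of 1 "-1"] by simp

lemma mean_sq_avg_nonneg: "0 \<le> mean_sq_avg n f"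
  by (simp add: mean_sq_avg_def sum_nonneg)

lemma mean_sq_avg_cong:
  assumes f: "continuous_on {0..1} f" and g: "continuous_on {0..1} g"
    and eq: "\<And>x. x \<in> {0..1} \<Longrightarrow> f x = g x"
  shows "mean_sq_avg n f = mean_sq_avg n g"
proof -
  have "cell_avg n f i = cell_avg n g i" if "i \<in> {1..n}" for i
  proof -
    have "{(real i - 1) / real n..real i / real n} \<subseteq> {0..1}"
      using that by (auto simp: field_simps)
    then have "integral {(real i - 1) / real n..real i / real n} f = integral {(real i - 1) / real n..real i / real n} g"
      using eq by (intro integral_cong) auto
    then show ?thesis using that by (simp add: cell_avg_eq f g)
  qed
  then show ?thesis by (simp add: mean_sq_avg_def)
qed

text \<open>On each cell, \<open>f\<close> minus its average is orthogonal to the constants.\<close>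

lemma cell_variance:
  assumes f: "continuous_on {0..1} f" and i: "1 \<le> i" "i \<le> n"
  defines "cell \<equiv> {(real i - 1) / real n..real i / real n}"
  shows "integral cell (\<lambda>x. (f x - cell_avg n f i)\<^sup>2) = integral cell (\<lambda>x. (f x)\<^sup>2) - (cell_avg n f i)\<^sup>2 / real n"
    and "(\<lambda>x. (f x - cell_avg n f i)\<^sup>2) integrable_on cell"
proof -
  define m where "m = cell_avg n f i"
  have n: "0 < real n" using i by simp
  have sub: "cell \<subseteq> {0..1}" using i by (auto simp: cell_def field_simps)
  have fc: "continuous_on cell f" by (rule continuous_on_subset[OF f sub])
  have m: "integral cell f = m / real n" unfolding m_def cell_def using i by (simp add: cell_avg_eq[OF f i])
  have len: "real i / real n - (real i - 1) / real n = 1 / real n"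
    by (simp add: diff_divide_distrib)
  have "(real i - 1) / real n \<le> real i / real n" by (simp add: divide_right_mono)
  then have "((\<lambda>x. m\<^sup>2) has_integral m\<^sup>2 / real n) cell"
    using has_integral_const_real[of "m\<^sup>2" "(real i - 1) / real n" "real i / real n"]
    unfolding cell_def by (simp add: len)
  then have "((\<lambda>x. (f x)\<^sup>2 - 2 * m * f x + m\<^sup>2) has_integral
     (integral cell (\<lambda>x. (f x)\<^sup>2) - 2 * m * integral cell f + m\<^sup>2 / real n)) cell"
    using fc unfolding cell_def
    by (intro has_integral_add has_integral_diff has_integral_mult_right integrable_integral
        integrable_continuous_real continuous_intros)
  then have "((\<lambda>x. (f x - m)\<^sup>2) has_integral (integral cell (\<lambda>x. (f x)\<^sup>2) - m\<^sup>2 / real n)) cell"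
    unfolding m by (simp add: power2_eq_square algebra_simps)
  then show "integral cell (\<lambda>x. (f x - cell_avg n f i)\<^sup>2) = integral cell (\<lambda>x. (f x)\<^sup>2) - (cell_avg n f i)\<^sup>2 / real n"
    and "(\<lambda>x. (f x - cell_avg n f i)\<^sup>2) integrable_on cell"
    unfolding m_def by (auto intro: integral_unique)
qed

text \<open>On each cell the two sides differ by the integral of the squared deviation from the
  average, which is nonnegative.\<close>

lemma mean_sq_avg_le:
  assumes f: "continuous_on {0..1} f" and n: "0 < n"
  shows "mean_sq_avg n f \<le> (L2_norm f)\<^sup>2"
proof -
  have sq: "(\<lambda>x. (f x)\<^sup>2) integrable_on {0..1}"
    by (intro integrable_continuous_real continuous_intros f)
  have "mean_sq_avg n f = (\<Sum>i=1..n. (cell_avg n f i)\<^sup>2 / real n)"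
    by (simp add: mean_sq_avg_def sum_divide_distrib)
  also have "\<dots> \<le> (\<Sum>i=1..n. integral {(real i - 1) / real n..real i / real n} (\<lambda>x. (f x)\<^sup>2))"
  proof (rule sum_mono)
    fix i assume "i \<in> {1..n}"
    then have i: "1 \<le> i" "i \<le> n" by auto
    have "0 \<le> integral {(real i - 1) / real n..real i / real n} (\<lambda>x. (f x - cell_avg n f i)\<^sup>2)"
      by (intro integral_nonneg cell_variance(2)[OF f i]) auto
    then show "(cell_avg n f i)\<^sup>2 / real n \<le> integral {(real i - 1) / real n..real i / real n} (\<lambda>x. (f x)\<^sup>2)"
      unfolding cell_variance(1)[OF f i] by simp
  qed
  also have "\<dots> = (L2_norm f)\<^sup>2"
    unfolding integral_cells_unit[OF sq n] by (simp add: L2_norm_sq[OF L2_fun_continuous[OF f]])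
  finally show ?thesis .
qed

text \<open>The second summand is the square root of the constant in
  \<open>deriv_chain_interpolation\<close>. The leading 1 keeps the whole at least 1, which also
  covers the trivial order j = k.\<close>

definition interp_const :: "nat \<Rightarrow> real" where
  "interp_const k = 1 + 2 * real k * (2 ^ k * real (k + 1) ^ k)"

lemma interp_const_ge_1: "1 \<le> interp_const k"
  by (simp add: interp_const_def)

lemma sobolev_interpolation:
  assumes f: "f \<in> sobolev k" and k: "0 < k" and n: "k \<le> n" and j: "j \<le> k"
  shows "L2_norm (weak_deriv j f) \<le> interp_const k *
    (real n ^ j * sqrt (mean_sq_avg n f) + (1 / real n) ^ (k - j) * L2_norm (weak_deriv k f))"
proof -
  have rhs0: "0 \<le> real n ^ j * sqrt (mean_sq_avg n f)" by (simp add: mean_sq_avg_nonneg)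
  show ?thesis
  proof (cases "j = k")
    case True
    have "1 * L2_norm (weak_deriv k f) \<le> interp_const k * (real n ^ k * sqrt (mean_sq_avg n f) + L2_norm (weak_deriv k f))"
      using rhs0 interp_const_ge_1[of k] L2_norm_nonneg[of "weak_deriv k f"] True by (intro mult_mono) auto
    then show ?thesis using True by simp
  next
    case False
    with j have j: "j < k" by simp
    obtain u where u: "deriv_chain k u" "\<And>x. x \<in> {0..1} \<Longrightarrow> u 0 x = f x"
      "\<And>n. n \<le> k \<Longrightarrow> L2_norm (weak_deriv n f) = L2_norm (u n)"
      using sobolev_deriv_chain[OF f k] by metis
    have ms: "mean_sq_avg n (u 0) = mean_sq_avg n f"
      by (rule mean_sq_avg_cong[OF deriv_chainD(1)[OF u(1) k] sobolev_continuous[OF f] u(2)])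
    define c where "c = 2 * real k * (2 ^ k * real (k + 1) ^ k)"
    have c: "0 \<le> c" "c \<le> interp_const k" by (simp_all add: c_def interp_const_def)
    define X where "X = real n ^ j * sqrt (mean_sq_avg n f)"
    define Z where "Z = (1 / real n) ^ (k - j) * L2_norm (weak_deriv k f)"
    have XZ: "0 \<le> X" "0 \<le> Z" using rhs0 by (auto simp: X_def Z_def L2_norm_nonneg)
    have "(L2_norm (weak_deriv j f))\<^sup>2 \<le> c\<^sup>2 * (X\<^sup>2 + Z\<^sup>2)"
    proof -
      have "(L2_norm (weak_deriv j f))\<^sup>2 = integral {0..1} (\<lambda>x. (u j x)\<^sup>2)"
        using u(3)[of j] j by (simp add: L2_norm_sq deriv_chain_L2[OF u(1)])
      also have "\<dots> \<le> 4 * (real k)\<^sup>2 * (2 ^ k * real (k + 1) ^ k)\<^sup>2 *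
    (real n ^ (2 * j) * mean_sq_avg n (u 0) + (1 / real n) ^ (2 * (k - j)) * integral {0..1} (\<lambda>x. (u k x)\<^sup>2))"
        by (rule deriv_chain_interpolation[OF u(1) k n j])
      also have "integral {0..1} (\<lambda>x. (u k x)\<^sup>2) = (L2_norm (weak_deriv k f))\<^sup>2"
        using u(3)[of k] by (simp add: L2_norm_sq deriv_chain_L2[OF u(1)])
      also have "4 * (real k)\<^sup>2 * (2 ^ k * real (k + 1) ^ k)\<^sup>2 = c\<^sup>2"
        by (simp add: c_def power_mult_distrib)
      also have "real n ^ (2 * j) * mean_sq_avg n (u 0) = X\<^sup>2"
        by (simp add: X_def ms power_mult_distrib mean_sq_avg_nonneg power_mult[symmetric] mult.commute)
      also have "(1 / real n) ^ (2 * (k - j)) * (L2_norm (weak_deriv k f))\<^sup>2 = Z\<^sup>2"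
        unfolding Z_def power_mult_distrib by (simp only: power_mult[symmetric] mult.commute)
      finally show ?thesis .
    qed
    also have "\<dots> \<le> c\<^sup>2 * (X + Z)\<^sup>2"
      using XZ by (intro mult_left_mono) (auto simp: power2_sum)
    also have "\<dots> = (c * (X + Z))\<^sup>2" by (simp add: power_mult_distrib)
    finally have "(L2_norm (weak_deriv j f))\<^sup>2 \<le> (c * (X + Z))\<^sup>2" .
    then have "L2_norm (weak_deriv j f) \<le> c * (X + Z)"
      by (rule power2_le_imp_le) (use XZ c in simp)
    also have "\<dots> \<le> interp_const k * (X + Z)" using XZ c by (intro mult_right_mono) auto
    finally show ?thesis by (simp add: X_def Z_def)
  qed
qed

text \<open>Hoelder continuity of exponent 1/2 with the integral kept local to [a,b]. Only this
  local form can be summed over cells without losing a power of the mesh.\<close>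

lemma sobolev_chain_1:
  assumes f: "f \<in> sobolev k" and k: "1 \<le> k"
  obtains u where "L2_fun u" "L2_norm u = L2_norm (weak_deriv 1 f)"
    "\<And>a b x z. 0 \<le> a \<Longrightarrow> b \<le> 1 \<Longrightarrow> x \<in> {a..b} \<Longrightarrow> z \<in> {a..b} \<Longrightarrow>
      \<bar>f x - f z\<bar>\<^sup>2 \<le> (b - a) * integral {a..b} (\<lambda>t. (u t)\<^sup>2)"
proof -
  obtain u where u: "deriv_chain k u" "\<And>x. x \<in> {0..1} \<Longrightarrow> u 0 x = f x"
    "\<And>n. n \<le> k \<Longrightarrow> L2_norm (weak_deriv n f) = L2_norm (u n)"
    using sobolev_deriv_chain[OF f] k by (metis One_nat_def Suc_le_lessD)
  have L2: "L2_fun (u 1)" using deriv_chain_L2[OF u(1)] k by simp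
  have "\<bar>f x - f z\<bar>\<^sup>2 \<le> (b - a) * integral {a..b} (\<lambda>t. (u 1 t)\<^sup>2)"
    if ab: "0 \<le> a" "b \<le> 1" and x: "x \<in> {a..b}" and z: "z \<in> {a..b}" for a b x z
  proof -
    have ab': "a \<le> b" using x by auto
    have "\<bar>f x - f z\<bar> = \<bar>u 0 x - u 0 z\<bar>" using u(2) ab x z by auto
    also have "\<dots> \<le> integral {a..b} (\<lambda>t. \<bar>u 1 t\<bar>)"
      using deriv_chain_oscillation[OF u(1) _ ab x z, of 0] k by simp
    finally have "\<bar>f x - f z\<bar>\<^sup>2 \<le> (integral {a..b} (\<lambda>t. \<bar>u 1 t\<bar>))\<^sup>2" by (intro power_mono) auto
    also have "\<dots> \<le> (b - a) * integral {a..b} (\<lambda>t. (u 1 t)\<^sup>2)"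
    proof (rule integral_abs_sq_le[OF _ _ ab'])
      show "u 1 absolutely_integrable_on {a..b}"
        by (rule absolutely_integrable_on_Icc_subset[OF L2_funD(2)[OF L2] ab])
      show "(\<lambda>x. (u 1 x)\<^sup>2) integrable_on {a..b}"
        by (rule set_lebesgue_integral_eq_integral(1)[OF absolutely_integrable_on_Icc_subset[OF L2_funD(1)[OF L2] ab]])
    qed
    finally show ?thesis .
  qed
  then show thesis using that L2 u(3)[of 1] k by auto
qed

lemma cell_avg_deviation:
  assumes f: "continuous_on {0..1} f" and i: "1 \<le> i" "i \<le> n" and x: "x \<in> {(real i - 1) / real n..real i / real n}"
    and B: "\<And>z. z \<in> {(real i - 1) / real n..real i / real n} \<Longrightarrow> \<bar>f x - f z\<bar> \<le> B"
  shows "\<bar>f x - cell_avg n f i\<bar> \<le> B"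
proof -
  define \<alpha> where "\<alpha> = (real i - 1) / real n"
  define \<beta> where "\<beta> = real i / real n"
  have n: "0 < real n" using i by simp
  have len: "\<beta> - \<alpha> = 1 / real n" "\<alpha> \<le> \<beta>" using n by (simp_all add: \<alpha>_def \<beta>_def diff_divide_distrib divide_right_mono)
  have sub: "{\<alpha>..\<beta>} \<subseteq> {0..1}" using i by (auto simp: \<alpha>_def \<beta>_def field_simps)
  have fi: "f integrable_on {\<alpha>..\<beta>}" by (intro integrable_continuous_real continuous_on_subset[OF f sub])
  have "((\<lambda>z. f x - f z) has_integral ((\<beta> - \<alpha>) *\<^sub>R f x - integral {\<alpha>..\<beta>} f)) {\<alpha>..\<beta>}"
    using has_integral_const_real[of "f x" \<alpha> \<beta>] len
    by (intro has_integral_diff integrable_integral fi) auto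
  then have "norm ((\<beta> - \<alpha>) *\<^sub>R f x - integral {\<alpha>..\<beta>} f) \<le> B * measure lborel (cbox \<alpha> \<beta>)"
    using B[unfolded \<alpha>_def[symmetric] \<beta>_def[symmetric]] B[OF x]
    by (intro has_integral_bound[of B "\<lambda>z. f x - f z"]) auto
  then have "\<bar>f x / real n - integral {\<alpha>..\<beta>} f\<bar> \<le> B / real n"
    using len by simp
  moreover have "f x / real n - integral {\<alpha>..\<beta>} f = (f x - cell_avg n f i) / real n"
    using n by (simp add: cell_avg_eq[OF f i] \<alpha>_def \<beta>_def diff_divide_distrib)
  ultimately show ?thesis using n by (simp add: divide_le_cancel abs_divide)
qed

text \<open>On a cell the integral of f^2 is the contribution of the average plus the squared
  deviation. A point of the cell deviates from the average by at most the local Hoelder bound, so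
  the latter is at most n^-2 times the local integral of the squared derivative. Summation and the
  square root of a sum of squares give the claim.\<close>

lemma poincare_cells:
  assumes f: "f \<in> sobolev k" and k: "1 \<le> k" and n: "0 < n"
  shows "L2_norm f \<le> mesh n * L2_norm (weak_deriv 1 f) + sqrt (mean_sq_avg n f)"
proof -
  obtain u where u: "L2_fun u" "L2_norm u = L2_norm (weak_deriv 1 f)"
    "\<And>a b x z. 0 \<le> a \<Longrightarrow> b \<le> 1 \<Longrightarrow> x \<in> {a..b} \<Longrightarrow> z \<in> {a..b} \<Longrightarrow>
      \<bar>f x - f z\<bar>\<^sup>2 \<le> (b - a) * integral {a..b} (\<lambda>t. (u t)\<^sup>2)"
    using sobolev_chain_1[OF f k] by blast
  define cell where "cell i = {(real i - 1) / real n..real i / real n}" for i :: nat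
  have fc: "continuous_on {0..1} f" by (rule sobolev_continuous[OF f])
  have usq: "(\<lambda>x. (u x)\<^sup>2) integrable_on {0..1}"
    by (intro set_lebesgue_integral_eq_integral(1) L2_funD(1) u)
  have fsq: "(\<lambda>x. (f x)\<^sup>2) integrable_on {0..1}"
    by (intro integrable_continuous_real continuous_intros fc)
  have loc: "integral (cell i) (\<lambda>x. (f x)\<^sup>2) \<le> (cell_avg n f i)\<^sup>2 / real n + (1 / real n)\<^sup>2 * integral (cell i) (\<lambda>x. (u x)\<^sup>2)"
    if "i \<in> {1..n}" for i
  proof -
    have i: "1 \<le> i" "i \<le> n" using that by auto
    have e: "0 \<le> (real i - 1) / real n" "real i / real n \<le> 1" using i by auto
    have len: "real i / real n - (real i - 1) / real n = 1 / real n" by (simp add: diff_divide_distrib)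
    define I where "I = 1 / real n * integral (cell i) (\<lambda>x. (u x)\<^sup>2)"
    have I0: "0 \<le> I" unfolding I_def cell_def
      using e by (intro mult_nonneg_nonneg integral_nonneg integrable_on_subinterval[OF usq]) auto
    have dev: "(f x - cell_avg n f i)\<^sup>2 \<le> I" if x: "x \<in> cell i" for x
    proof -
      have "\<bar>f x - cell_avg n f i\<bar> \<le> sqrt I"
      proof (rule cell_avg_deviation[OF fc i x[unfolded cell_def]])
        fix z assume z: "z \<in> {(real i - 1) / real n..real i / real n}"
        show "\<bar>f x - f z\<bar> \<le> sqrt I"
          using u(3)[OF e x[unfolded cell_def] z] unfolding len I_def cell_def
          by (intro real_le_rsqrt) simp
      qed
      then have "\<bar>f x - cell_avg n f i\<bar>\<^sup>2 \<le> (sqrt I)\<^sup>2" by (intro power_mono) auto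
      then show ?thesis using I0 by simp
    qed
    have "integral (cell i) (\<lambda>x. (f x - cell_avg n f i)\<^sup>2) \<le> integral (cell i) (\<lambda>x. I)"
      using cell_variance(2)[OF fc i] dev by (intro integral_le) (auto simp: cell_def)
    also have "\<dots> = 1 / real n * I"
      using len n unfolding cell_def by (simp add: divide_right_mono)
    finally show ?thesis
      unfolding I_def using cell_variance(1)[OF fc i] by (simp add: cell_def power2_eq_square)
  qed
  have "(L2_norm f)\<^sup>2 = (\<Sum>i=1..n. integral (cell i) (\<lambda>x. (f x)\<^sup>2))"
    unfolding cell_def integral_cells_unit[OF fsq n] by (simp add: L2_norm_sq[OF L2_fun_continuous[OF fc]])
  also have "\<dots> \<le> (\<Sum>i=1..n. (cell_avg n f i)\<^sup>2 / real n + (1 / real n)\<^sup>2 * integral (cell i) (\<lambda>x. (u x)\<^sup>2))"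
    by (intro sum_mono loc)
  also have "\<dots> = mean_sq_avg n f + (1 / real n)\<^sup>2 * (\<Sum>i=1..n. integral (cell i) (\<lambda>x. (u x)\<^sup>2))"
    by (simp add: sum.distrib mean_sq_avg_def sum_divide_distrib sum_distrib_left)
  also have "(\<Sum>i=1..n. integral (cell i) (\<lambda>x. (u x)\<^sup>2)) = (L2_norm (weak_deriv 1 f))\<^sup>2"
    unfolding cell_def integral_cells_unit[OF usq n] by (simp add: L2_norm_sq[OF u(1), symmetric] u(2))
  also have "mean_sq_avg n f + (1 / real n)\<^sup>2 * (L2_norm (weak_deriv 1 f))\<^sup>2 \<le> (mesh n * L2_norm (weak_deriv 1 f) + sqrt (mean_sq_avg n f))\<^sup>2"
    using L2_norm_nonneg[of "weak_deriv 1 f"] mean_sq_avg_nonneg[of n f]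
    by (simp add: power2_sum mesh_def power_divide)
  finally show ?thesis
    by (rule power2_le_imp_le) (simp add: mesh_def L2_norm_nonneg mean_sq_avg_nonneg)
qed

section \<open>Sampling error of the exact data\<close>

lemma sum_over_groups:
  fixes g :: "nat \<Rightarrow> real"
  shows "(\<Sum>i=1..M. \<Sum>l\<in>{(i - 1) * N<..(i - 1) * N + N}. g l) = (\<Sum>l=1..M * N. g l)"
proof (induction M)
  case (Suc M)
  have "{1..Suc M * N} = {1..M * N} \<union> {M * N<..M * N + N}" by auto
  then have "(\<Sum>l=1..Suc M * N. g l) = (\<Sum>l=1..M * N. g l) + (\<Sum>l\<in>{M * N<..M * N + N}. g l)"
    by (simp only:) (rule sum.union_disjoint; auto)
  then show ?case using Suc by simp
qed simp

text \<open>The comparison takes place on the fine grid: a sample sits at the right end of its fine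
  cell and differs from the average there by the local Hoelder bound, while a coarse average is the
  mean of its N fine averages. Cauchy-Schwarz within groups and summation give the squared norm of
  y' over L^2, and 1/L is \<open>mesh M / N\<close>.\<close>

lemma quadrature_error:
  assumes y: "y \<in> sobolev k" and k: "1 \<le> k" and M: "0 < M" and N: "0 < N"
    and Q: "L2_norm (weak_deriv 1 y) \<le> Q"
  shows "(1 / real M) * (\<Sum>i=1..M. (group_avg N (exact_samples (M * N) y) i - cell_avg M y i)\<^sup>2)
    \<le> Q\<^sup>2 * (mesh M)\<^sup>2 / (real N)\<^sup>2"
proof -
  define L where "L = M * N"
  obtain u where u: "L2_fun u" "L2_norm u = L2_norm (weak_deriv 1 y)"
    "\<And>a b x z. 0 \<le> a \<Longrightarrow> b \<le> 1 \<Longrightarrow> x \<in> {a..b} \<Longrightarrow> z \<in> {a..b} \<Longrightarrow>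
      \<bar>y x - y z\<bar>\<^sup>2 \<le> (b - a) * integral {a..b} (\<lambda>t. (u t)\<^sup>2)"
    using sobolev_chain_1[OF y k] by blast
  define cell where "cell l = {(real l - 1) / real L..real l / real L}" for l :: nat
  define \<delta> where "\<delta> l = y (real l / real L) - cell_avg L y l" for l
  have L: "0 < L" using M N by (simp add: L_def)
  have yc: "continuous_on {0..1} y" by (rule sobolev_continuous[OF y])
  have yi: "y integrable_on {0..1}" by (intro integrable_continuous_real yc)
  have usq: "(\<lambda>x. (u x)\<^sup>2) integrable_on {0..1}"
    by (intro set_lebesgue_integral_eq_integral(1) L2_funD(1) u)
  have \<delta>: "(\<delta> l)\<^sup>2 \<le> 1 / real L * integral (cell l) (\<lambda>x. (u x)\<^sup>2)" if "l \<in> {1..L}" for l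
  proof -
    have l: "1 \<le> l" "l \<le> L" using that by auto
    have e: "0 \<le> (real l - 1) / real L" "real l / real L \<le> 1" using l by auto
    have len: "real l / real L - (real l - 1) / real L = 1 / real L" by (simp add: diff_divide_distrib)
    have x: "real l / real L \<in> {(real l - 1) / real L..real l / real L}" by (simp add: divide_right_mono)
    define I where "I = 1 / real L * integral (cell l) (\<lambda>x. (u x)\<^sup>2)"
    have I0: "0 \<le> I" unfolding I_def cell_def
      using e by (intro mult_nonneg_nonneg integral_nonneg integrable_on_subinterval[OF usq]) auto
    have "\<bar>\<delta> l\<bar> \<le> sqrt I"
      unfolding \<delta>_def
    proof (rule cell_avg_deviation[OF yc l x])
      fix z assume z: "z \<in> {(real l - 1) / real L..real l / real L}"
      show "\<bar>y (real l / real L) - y z\<bar> \<le> sqrt I"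
        using u(3)[OF e x z] unfolding len I_def cell_def by (intro real_le_rsqrt) simp
    qed
    then have "\<bar>\<delta> l\<bar>\<^sup>2 \<le> (sqrt I)\<^sup>2" by (intro power_mono) auto
    then show ?thesis using I0 by (simp add: I_def)
  qed
  have group: "(group_avg N (exact_samples L y) i - cell_avg M y i)\<^sup>2
      \<le> (1 / real N) * (\<Sum>l\<in>{(i - 1) * N<..(i - 1) * N + N}. (\<delta> l)\<^sup>2)" if "i \<in> {1..M}" for i
  proof -
    let ?J = "{(i - 1) * N<..(i - 1) * N + N}"
    have i: "1 \<le> i" "i \<le> M" using that by auto
    have iN: "(i - 1) * N + N = i * N" using i by (cases i) auto
    have top: "(i - 1) * N + N \<le> L" unfolding iN L_def using i by simp
    have ends: "real ((i - 1) * N) / real L = (real i - 1) / real M" "real ((i - 1) * N + N) / real L = real i / real M"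
      unfolding iN L_def using i N M by (simp_all add: of_nat_diff)
    have "cell_avg M y i = real M * (\<Sum>l\<in>?J. integral (cell l) y)"
      unfolding cell_def integral_cells[OF yi L top] ends by (rule cell_avg_eq[OF yc i])
    also have "\<dots> = (1 / real N) * (\<Sum>l\<in>?J. cell_avg L y l)"
      unfolding sum_distrib_left using top N M
      by (intro sum.cong refl) (simp add: cell_avg_eq[OF yc] cell_def L_def)
    finally have ca: "cell_avg M y i = (1 / real N) * (\<Sum>l\<in>?J. cell_avg L y l)" .
    have img: "?J = (\<lambda>j. (i - 1) * N + j) ` {1..N}"
    proof (intro set_eqI iffI)
      fix l assume "l \<in> ?J"
      then show "l \<in> (\<lambda>j. (i - 1) * N + j) ` {1..N}"
        by (intro image_eqI[of _ _ "l - (i - 1) * N"]) auto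
    qed auto
    have "(\<Sum>l\<in>?J. y (real l / real L)) = (\<Sum>j=1..N. exact_samples L y ((i - 1) * N + j))"
      unfolding img exact_samples_def by (subst sum.reindex) (auto simp: inj_on_def)
    then have "group_avg N (exact_samples L y) i - cell_avg M y i = (1 / real N) * (\<Sum>l\<in>?J. \<delta> l)"
      unfolding ca group_avg_def \<delta>_def by (simp add: sum_subtractf diff_divide_distrib)
    then have "(group_avg N (exact_samples L y) i - cell_avg M y i)\<^sup>2 = (1 / real N)\<^sup>2 * (\<Sum>l\<in>?J. 1 * \<delta> l)\<^sup>2"
      by (simp add: power_mult_distrib power_divide)
    also have "\<dots> \<le> (1 / real N)\<^sup>2 * ((\<Sum>l\<in>?J. 1\<^sup>2) * (\<Sum>l\<in>?J. (\<delta> l)\<^sup>2))"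
      by (intro mult_left_mono Cauchy_Schwarz_ineq_sum) auto
    finally show ?thesis using N by (simp add: power2_eq_square)
  qed
  have "(1 / real M) * (\<Sum>i=1..M. (group_avg N (exact_samples L y) i - cell_avg M y i)\<^sup>2)
    \<le> (1 / real M) * (\<Sum>i=1..M. (1 / real N) * (\<Sum>l\<in>{(i - 1) * N<..(i - 1) * N + N}. (\<delta> l)\<^sup>2))"
    by (intro mult_left_mono sum_mono group) auto
  also have "\<dots> = 1 / real L * (\<Sum>l=1..L. (\<delta> l)\<^sup>2)"
    unfolding sum_distrib_left[symmetric] sum_over_groups by (simp add: L_def)
  also have "\<dots> \<le> 1 / real L * (\<Sum>l=1..L. 1 / real L * integral (cell l) (\<lambda>x. (u x)\<^sup>2))"
    by (intro mult_left_mono sum_mono \<delta>) auto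
  also have "\<dots> = (1 / real L)\<^sup>2 * (\<Sum>l=1..L. integral (cell l) (\<lambda>x. (u x)\<^sup>2))"
    unfolding sum_distrib_left[symmetric] by (simp add: power2_eq_square)
  also have "(\<Sum>l=1..L. integral (cell l) (\<lambda>x. (u x)\<^sup>2)) = (L2_norm (weak_deriv 1 y))\<^sup>2"
    unfolding cell_def integral_cells_unit[OF usq L] by (simp add: L2_norm_sq[OF u(1), symmetric] u(2))
  also have "(1 / real L)\<^sup>2 * (L2_norm (weak_deriv 1 y))\<^sup>2 \<le> (1 / real L)\<^sup>2 * Q\<^sup>2"
    using Q L2_norm_nonneg[of "weak_deriv 1 y"] by (intro mult_left_mono power_mono) auto
  also have "\<dots> = Q\<^sup>2 * (mesh M)\<^sup>2 / (real N)\<^sup>2"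
    by (simp add: L_def mesh_def power_divide power_mult_distrib)
  finally show ?thesis by (simp add: L_def)
qed

section \<open>Comparison of the minimizer with the exact function\<close>

lemma mean_square_add_le:
  fixes a b :: "nat \<Rightarrow> real"
  shows "(1 / real M) * (\<Sum>i=1..M. (a i + b i)\<^sup>2)
    \<le> 2 * ((1 / real M) * (\<Sum>i=1..M. (a i)\<^sup>2)) + 2 * ((1 / real M) * (\<Sum>i=1..M. (b i)\<^sup>2))"
proof -
  have "(a i + b i)\<^sup>2 \<le> 2 * (a i)\<^sup>2 + 2 * (b i)\<^sup>2" for i
    using zero_le_power2[of "a i - b i"] by (simp add: power2_sum power2_diff)
  then have "(1 / real M) * (\<Sum>i=1..M. (a i + b i)\<^sup>2) \<le> (1 / real M) * (\<Sum>i=1..M. 2 * (a i)\<^sup>2 + 2 * (b i)\<^sup>2)"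
    by (intro mult_left_mono sum_mono) auto
  also have "\<dots> = 2 * ((1 / real M) * (\<Sum>i=1..M. (a i)\<^sup>2)) + 2 * ((1 / real M) * (\<Sum>i=1..M. (b i)\<^sup>2))"
    by (simp add: sum.distrib sum_distrib_left algebra_simps)
  finally show ?thesis .
qed

text \<open>Since \<open>y\<close> is admissible, its own functional value bounds that of
  \<open>f\<close>. \<open>T\<close> bounds the data misfit of \<open>y\<close>, the factors 2
  separating noise from quadrature error. The averages of f - y are differences of the two misfits;
  the misfit of \<open>f\<close> is at most \<open>T\<close> plus the penalty of \<open>y\<close>,
  which gives 4 T and twice that penalty.\<close>

lemma minimizer_estimate:
  assumes y: "y \<in> sobolev k" and k: "1 \<le> k" and M: "0 < M" and N: "0 < N" and \<alpha>: "0 < \<alpha>"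
    and Q: "L2_norm (weak_deriv 1 y) \<le> Q"
    and min: "is_arg_min (Phi k M \<alpha> (group_avg N (noisy_samples (M * N) y \<eta> \<omega>))) (\<lambda>f. f \<in> admissible k y) f"
    and noise: "noise_level_sq M N y \<eta> \<omega> \<le> \<epsilon>"
  defines "T \<equiv> 2 * \<epsilon> + 2 * (Q\<^sup>2 * (mesh M)\<^sup>2 / (real N)\<^sup>2)"
  shows "f \<in> sobolev k" and "f 0 = y 0" and "f 1 = y 1"
    and "L2_norm (weak_deriv k (\<lambda>x. f x - y x)) \<le> sqrt (T / \<alpha>) + 2 * L2_norm (weak_deriv k y)"
    and "mean_sq_avg M (\<lambda>x. f x - y x) \<le> 4 * T + 2 * \<alpha> * (L2_norm (weak_deriv k y))\<^sup>2"
proof -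
  define Y where "Y = group_avg N (noisy_samples (M * N) y \<eta> \<omega>)"
  define A where "A g = (1 / real M) * (\<Sum>i=1..M. (Y i - cell_avg M g i)\<^sup>2)" for g
  have adm: "f \<in> admissible k y" and le: "\<not> (\<exists>g. g \<in> admissible k y \<and> Phi k M \<alpha> Y g < Phi k M \<alpha> Y f)"
    using min by (auto simp: is_arg_min_def Y_def)
  then show f: "f \<in> sobolev k" and "f 0 = y 0" "f 1 = y 1" by (auto simp: admissible_def)
  have fc: "continuous_on {0..1} f" and yc: "continuous_on {0..1} y"
    using f y by (auto intro: sobolev_continuous)
  have "y \<in> admissible k y" using y by (simp add: admissible_def)
  with le have "Phi k M \<alpha> Y f \<le> Phi k M \<alpha> Y y" by (meson not_less)
  then have opt: "A f + \<alpha> * (L2_norm (weak_deriv k f))\<^sup>2 \<le> A y + \<alpha> * (L2_norm (weak_deriv k y))\<^sup>2"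
    by (simp add: Phi_def A_def)
  have "A y = (1 / real M) * (\<Sum>i=1..M. ((Y i - group_avg N (exact_samples (M * N) y) i)
      + (group_avg N (exact_samples (M * N) y) i - cell_avg M y i))\<^sup>2)"
    by (simp add: A_def)
  also have "\<dots> \<le> 2 * noise_level_sq M N y \<eta> \<omega> + 2 * ((1 / real M) * (\<Sum>i=1..M. (group_avg N (exact_samples (M * N) y) i - cell_avg M y i)\<^sup>2))"
    unfolding noise_level_sq_def Y_def by (rule mean_square_add_le)
  also have "\<dots> \<le> T"
    unfolding T_def using noise quadrature_error[OF y k M N Q] by simp
  finally have Ay: "A y \<le> T" .
  have A0: "0 \<le> A g" for g by (simp add: A_def sum_nonneg)
  have T0: "0 \<le> T" using A0[of y] Ay by linarith
  have "(L2_norm (weak_deriv k f))\<^sup>2 \<le> T / \<alpha> + (L2_norm (weak_deriv k y))\<^sup>2"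
    using opt Ay A0[of f] \<alpha> by (simp add: field_simps)
  also have "\<dots> \<le> (sqrt (T / \<alpha>) + L2_norm (weak_deriv k y))\<^sup>2"
    using T0 \<alpha> by (simp add: power2_sum L2_norm_nonneg)
  finally have "L2_norm (weak_deriv k f) \<le> sqrt (T / \<alpha>) + L2_norm (weak_deriv k y)"
    by (rule power2_le_imp_le) (use T0 \<alpha> in \<open>simp add: L2_norm_nonneg\<close>)
  moreover have "L2_norm (weak_deriv k (\<lambda>x. f x - y x)) \<le> L2_norm (weak_deriv k f) + L2_norm (weak_deriv k y)"
  proof -
    have L: "L2_fun (weak_deriv k f)" "L2_fun (\<lambda>x. - 1 * weak_deriv k y x)"
      using sobolev_weak_deriv(1)[OF f order_refl] L2_fun_lincomb(1)[OF sobolev_weak_deriv(1)[OF y order_refl] sobolev_weak_deriv(1)[OF y order_refl], of "-1" 0]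
      by simp_all
    show ?thesis
      using sobolev_lincomb(2)[OF f y order_refl, of 1 "-1"] L2_norm_triangle[OF L] L2_norm_cmult[of "-1" "weak_deriv k y"]
      by simp
  qed
  ultimately show "L2_norm (weak_deriv k (\<lambda>x. f x - y x)) \<le> sqrt (T / \<alpha>) + 2 * L2_norm (weak_deriv k y)"
    by simp
  have "mean_sq_avg M (\<lambda>x. f x - y x) = (1 / real M) * (\<Sum>i=1..M. ((Y i - cell_avg M y i) + - (Y i - cell_avg M f i))\<^sup>2)"
    unfolding mean_sq_avg_def by (intro arg_cong2[where f="(*)"] sum.cong refl) (simp add: cell_avg_diff[OF fc yc])
  also have "\<dots> \<le> 2 * A y + 2 * ((1 / real M) * (\<Sum>i=1..M. (- (Y i - cell_avg M f i))\<^sup>2))"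
    unfolding A_def by (rule mean_square_add_le)
  also have "\<dots> = 2 * A y + 2 * A f" by (simp only: A_def power2_minus)
  also have "\<dots> \<le> 4 * T + 2 * \<alpha> * (L2_norm (weak_deriv k y))\<^sup>2"
  proof -
    have "0 \<le> \<alpha> * (L2_norm (weak_deriv k f))\<^sup>2" using \<alpha> by simp
    then show ?thesis using Ay opt by linarith
  qed
  finally show "mean_sq_avg M (\<lambda>x. f x - y x) \<le> 4 * T + 2 * \<alpha> * (L2_norm (weak_deriv k y))\<^sup>2" .
qed

subsection \<open>Dependence of the minimizer on the data\<close>

text \<open>The first order condition at t = 0, obtained from one sufficiently small t instead of a
  limit.\<close>

lemma nonneg_if_quadratic_nonneg:
  fixes b q :: real
  assumes "\<And>t. 0 < t \<Longrightarrow> t \<le> 1 \<Longrightarrow> 0 \<le> 2 * t * b + t\<^sup>2 * q"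
  shows "0 \<le> b"
proof (rule ccontr)
  assume b: "\<not> 0 \<le> b"
  \<comment> \<open>Small enough that t q \<le> -b, so that 2 b + t q \<le> b < 0.\<close>
  define t where "t = min 1 (- b / (\<bar>q\<bar> + 1))"
  have t: "0 < t" "t \<le> 1" using b by (auto simp: t_def divide_neg_pos)
  have "t * (\<bar>q\<bar> + 1) \<le> (- b / (\<bar>q\<bar> + 1)) * (\<bar>q\<bar> + 1)"
    by (intro mult_right_mono) (auto simp: t_def)
  then have "t * (\<bar>q\<bar> + 1) \<le> - b" by simp
  moreover have "t * q \<le> t * (\<bar>q\<bar> + 1)" using t by (intro mult_left_mono) auto
  ultimately have "2 * b + t * q < 0" using b by simp
  then have "t * (2 * b + t * q) < 0" using t by (simp add: mult_pos_neg)
  with assms[OF t] show False by (simp add: power2_eq_square algebra_simps)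
qed

text \<open>Half the derivative of \<open>Phi\<close> at \<open>f\<close> along the segment towards
  \<open>g\<close>. The segment stays admissible because both ends have the same endpoint values,
  and \<open>Phi\<close> is an explicit quadratic polynomial on it.\<close>

lemma minimizer_variational:
  assumes k: "1 \<le> k" and M: "0 < M"
    and min: "is_arg_min (Phi k M \<alpha> Y) (\<lambda>f. f \<in> admissible k y) f" and g: "g \<in> admissible k y"
  shows "0 \<le> \<alpha> * (integral {0..1} (\<lambda>x. weak_deriv k f x * weak_deriv k g x) - (L2_norm (weak_deriv k f))\<^sup>2)
    - (1 / real M) * (\<Sum>i=1..M. (Y i - cell_avg M f i) * (cell_avg M g i - cell_avg M f i))"
proof (rule nonneg_if_quadratic_nonneg)
  define F where "F = weak_deriv k f"
  define G where "G = weak_deriv k g"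
  define a where "a i = Y i - cell_avg M f i" for i
  define h where "h i = cell_avg M g i - cell_avg M f i" for i
  define FG where "FG = integral {0..1} (\<lambda>x. F x * G x)"
  have f: "f \<in> sobolev k" "f 0 = y 0" "f 1 = y 1" and gs: "g \<in> sobolev k" "g 0 = y 0" "g 1 = y 1"
    using min g by (auto simp: is_arg_min_def admissible_def)
  have L: "L2_fun F" "L2_fun G" using f gs sobolev_weak_deriv by (auto simp: F_def G_def)
  fix t :: real assume t: "0 < t" "t \<le> 1"
  define w where "w x = (1 - t) * f x + t * g x" for x
  have "w \<in> sobolev k" unfolding w_def by (rule sobolev_lincomb(1)[OF f(1) gs(1)])
  then have "w \<in> admissible k y" using f gs by (simp add: admissible_def w_def algebra_simps)
  then have "Phi k M \<alpha> Y f \<le> Phi k M \<alpha> Y w" using min by (auto simp: is_arg_min_def not_less)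
  moreover have "Phi k M \<alpha> Y f = (1 / real M) * (\<Sum>i=1..M. (a i)\<^sup>2) + \<alpha> * (L2_norm F)\<^sup>2"
    by (simp add: Phi_def a_def F_def)
  moreover have "Phi k M \<alpha> Y w = (1 / real M) * (\<Sum>i=1..M. (a i)\<^sup>2)
      - 2 * t * ((1 / real M) * (\<Sum>i=1..M. a i * h i)) + t\<^sup>2 * ((1 / real M) * (\<Sum>i=1..M. (h i)\<^sup>2))
      + \<alpha> * ((1 - t)\<^sup>2 * (L2_norm F)\<^sup>2 + 2 * (1 - t) * t * FG + t\<^sup>2 * (L2_norm G)\<^sup>2)"
  proof -
    have "(L2_norm (weak_deriv k w))\<^sup>2 = (L2_norm (\<lambda>x. (1 - t) * F x + t * G x))\<^sup>2"
      unfolding w_def F_def G_def using sobolev_lincomb(2)[OF f(1) gs(1) order_refl] by simp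
    also have "\<dots> = (1 - t)\<^sup>2 * (L2_norm F)\<^sup>2 + 2 * (1 - t) * t * FG + t\<^sup>2 * (L2_norm G)\<^sup>2"
      unfolding L2_norm_sq[OF L2_fun_lincomb(1)[OF L]] L2_fun_lincomb(2)[OF L] FG_def L2_norm_sq[OF L(1)] L2_norm_sq[OF L(2)] ..
    finally have 1: "(L2_norm (weak_deriv k w))\<^sup>2 = (1 - t)\<^sup>2 * (L2_norm F)\<^sup>2 + 2 * (1 - t) * t * FG + t\<^sup>2 * (L2_norm G)\<^sup>2" .
    have "(\<Sum>i=1..M. (Y i - cell_avg M w i)\<^sup>2) = (\<Sum>i=1..M. (a i)\<^sup>2 - 2 * t * (a i * h i) + t\<^sup>2 * (h i)\<^sup>2)"
    proof (intro sum.cong refl)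
      fix i assume "i \<in> {1..M}"
      then have "cell_avg M w i = (1 - t) * cell_avg M f i + t * cell_avg M g i"
        unfolding w_def using f gs by (intro cell_avg_lincomb sobolev_continuous) auto
      then have eq: "Y i - cell_avg M w i = a i - t * h i" by (simp add: a_def h_def algebra_simps)
      show "(Y i - cell_avg M w i)\<^sup>2 = (a i)\<^sup>2 - 2 * t * (a i * h i) + t\<^sup>2 * (h i)\<^sup>2"
        unfolding eq by (simp add: power2_eq_square algebra_simps)
    qed
    also have "\<dots> = (\<Sum>i=1..M. (a i)\<^sup>2) - 2 * t * (\<Sum>i=1..M. a i * h i) + t\<^sup>2 * (\<Sum>i=1..M. (h i)\<^sup>2)"
      by (simp add: sum.distrib sum_subtractf sum_distrib_left)
    finally have S: "(\<Sum>i=1..M. (Y i - cell_avg M w i)\<^sup>2)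
      = (\<Sum>i=1..M. (a i)\<^sup>2) - 2 * t * (\<Sum>i=1..M. a i * h i) + t\<^sup>2 * (\<Sum>i=1..M. (h i)\<^sup>2)" .
    show ?thesis unfolding Phi_def 1 S by (simp add: algebra_simps)
  qed
  ultimately have "0 \<le> 2 * t * (\<alpha> * (FG - (L2_norm F)\<^sup>2) - (1 / real M) * (\<Sum>i=1..M. a i * h i))
    + t\<^sup>2 * ((1 / real M) * (\<Sum>i=1..M. (h i)\<^sup>2) + \<alpha> * ((L2_norm F)\<^sup>2 - 2 * FG + (L2_norm G)\<^sup>2))"
    by (simp add: power2_eq_square algebra_simps)
  then show "0 \<le> 2 * t * (\<alpha> * (integral {0..1} (\<lambda>x. weak_deriv k f x * weak_deriv k g x) - (L2_norm (weak_deriv k f))\<^sup>2)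
    - (1 / real M) * (\<Sum>i=1..M. (Y i - cell_avg M f i) * (cell_avg M g i - cell_avg M f i)))
    + t\<^sup>2 * ((1 / real M) * (\<Sum>i=1..M. (h i)\<^sup>2) + \<alpha> * ((L2_norm F)\<^sup>2 - 2 * FG + (L2_norm G)\<^sup>2))"
    unfolding FG_def F_def G_def a_def h_def .
qed

text \<open>Each minimizer is a competitor for the other, since the admissible set does not depend
  on the data. Adding the two variational inequalities bounds the mean square of the averages plus
  the penalty of f - g by the mean product of Y - Y' with the averages of f - g; Young's inequality
  absorbs half of the first term.\<close>

lemma minimizer_stability:
  assumes k: "1 \<le> k" and M: "0 < M" and \<alpha>: "0 < \<alpha>"
    and f: "is_arg_min (Phi k M \<alpha> Y) (\<lambda>f. f \<in> admissible k y) f"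
    and g: "is_arg_min (Phi k M \<alpha> Y') (\<lambda>f. f \<in> admissible k y) g"
  defines "D \<equiv> (1 / real M) * (\<Sum>i=1..M. (Y i - Y' i)\<^sup>2)"
  shows "mean_sq_avg M (\<lambda>x. f x - g x) \<le> D"
    and "\<alpha> * (L2_norm (weak_deriv k (\<lambda>x. f x - g x)))\<^sup>2 \<le> D"
proof -
  have fa: "f \<in> admissible k y" and ga: "g \<in> admissible k y" using f g by (auto simp: is_arg_min_def)
  then have fs: "f \<in> sobolev k" and gs: "g \<in> sobolev k" by (auto simp: admissible_def)
  define F where "F = weak_deriv k f"
  define G where "G = weak_deriv k g"
  define h where "h i = cell_avg M f i - cell_avg M g i" for i
  define FG where "FG = integral {0..1} (\<lambda>x. F x * G x)"
  have L: "L2_fun F" "L2_fun G" using fs gs sobolev_weak_deriv by (auto simp: F_def G_def)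
  have n: "(L2_norm (weak_deriv k (\<lambda>x. f x - g x)))\<^sup>2 = (L2_norm F)\<^sup>2 - 2 * FG + (L2_norm G)\<^sup>2"
  proof -
    have "(L2_norm (weak_deriv k (\<lambda>x. f x - g x)))\<^sup>2 = (L2_norm (\<lambda>x. 1 * F x + (-1) * G x))\<^sup>2"
      using sobolev_lincomb(2)[OF fs gs order_refl, of 1 "-1"] by (simp add: F_def G_def)
    also have "\<dots> = (L2_norm F)\<^sup>2 - 2 * FG + (L2_norm G)\<^sup>2"
      unfolding L2_norm_sq[OF L2_fun_lincomb(1)[OF L]] L2_fun_lincomb(2)[OF L] FG_def L2_norm_sq[OF L(1)] L2_norm_sq[OF L(2)] by simp
    finally show ?thesis .
  qed
  have m: "mean_sq_avg M (\<lambda>x. f x - g x) = (1 / real M) * (\<Sum>i=1..M. (h i)\<^sup>2)"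
    unfolding mean_sq_avg_def h_def using fs gs
    by (intro arg_cong2[where f="(*)"] sum.cong refl) (simp add: cell_avg_diff sobolev_continuous)
  have 1: "0 \<le> \<alpha> * (FG - (L2_norm F)\<^sup>2) - (1 / real M) * (\<Sum>i=1..M. (Y i - cell_avg M f i) * (cell_avg M g i - cell_avg M f i))"
    unfolding FG_def F_def G_def by (rule minimizer_variational[OF k M f ga])
  have 2: "0 \<le> \<alpha> * (FG - (L2_norm G)\<^sup>2) - (1 / real M) * (\<Sum>i=1..M. (Y' i - cell_avg M g i) * (cell_avg M f i - cell_avg M g i))"
    unfolding FG_def F_def G_def using minimizer_variational[OF k M g fa] by (simp add: mult.commute)
  have young: "(1/2) * a\<^sup>2 - (1/2) * d\<^sup>2 \<le> a\<^sup>2 - d * a" for a d :: real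
    using zero_le_power2[of "a - d"] by (simp add: power2_eq_square algebra_simps)
  have "(1 / real M) * (\<Sum>i=1..M. (Y i - cell_avg M f i) * (cell_avg M g i - cell_avg M f i))
      + (1 / real M) * (\<Sum>i=1..M. (Y' i - cell_avg M g i) * (cell_avg M f i - cell_avg M g i))
    = (1 / real M) * (\<Sum>i=1..M. (h i)\<^sup>2 - (Y i - Y' i) * h i)"
    unfolding distrib_left[symmetric] sum.distrib[symmetric] h_def
    by (intro arg_cong2[where f="(*)"] sum.cong refl) (simp add: power2_eq_square algebra_simps)
  also have "\<dots> \<ge> (1 / real M) * (\<Sum>i=1..M. (1/2) * (h i)\<^sup>2 - (1/2) * (Y i - Y' i)\<^sup>2)"
  proof (intro mult_left_mono sum_mono)
    fix i
    show "(1/2) * (h i)\<^sup>2 - (1/2) * (Y i - Y' i)\<^sup>2 \<le> (h i)\<^sup>2 - (Y i - Y' i) * h i"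
      by (rule young)
  qed auto
  also have "(1 / real M) * (\<Sum>i=1..M. (1/2) * (h i)\<^sup>2 - (1/2) * (Y i - Y' i)\<^sup>2)
    = (1/2) * mean_sq_avg M (\<lambda>x. f x - g x) - (1/2) * D"
    unfolding m D_def sum_subtractf sum_distrib_left[symmetric] by (simp add: algebra_simps)
  finally have "(1/2) * mean_sq_avg M (\<lambda>x. f x - g x) + \<alpha> * (L2_norm (weak_deriv k (\<lambda>x. f x - g x)))\<^sup>2 \<le> (1/2) * D"
    using 1 2 unfolding n by (simp add: algebra_simps)
  moreover have "0 \<le> \<alpha> * (L2_norm (weak_deriv k (\<lambda>x. f x - g x)))\<^sup>2" using \<alpha> by simp
  moreover have "0 \<le> D" by (simp add: D_def sum_nonneg)
  ultimately show "mean_sq_avg M (\<lambda>x. f x - g x) \<le> D"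
    and "\<alpha> * (L2_norm (weak_deriv k (\<lambda>x. f x - g x)))\<^sup>2 \<le> D"
    using mean_sq_avg_nonneg[of M "\<lambda>x. f x - g x"] by linarith+
qed

subsection \<open>Measurability of the error norms\<close>

text \<open>The sublevel sets of a functional that is Lipschitz in finitely many coordinates of the data are
  preimages of unions of open balls, whatever the range of the data is.\<close>

lemma measurable_lipschitz_in_data:
  fixes F :: "'w \<Rightarrow> real" and V :: "'w \<Rightarrow> nat \<Rightarrow> real"
  assumes V: "\<And>i. i \<in> I \<Longrightarrow> (\<lambda>\<omega>. V \<omega> i) \<in> borel_measurable P" and I: "finite I"
    and lip: "\<And>\<omega> \<omega>'. \<omega> \<in> space P \<Longrightarrow> \<omega>' \<in> space P \<Longrightarrow>
      F \<omega> - F \<omega>' \<le> C * sqrt (r * (\<Sum>i\<in>I. (V \<omega> i - V \<omega>' i)\<^sup>2))"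
  shows "F \<in> borel_measurable P"
proof (subst borel_measurable_iff_less, intro allI)
  fix a :: real
  \<comment> \<open>The open sets live in the product over all of \<open>nat\<close>; freezing the
    coordinates outside \<open>I\<close> at 0 makes the data map measurable in every
    coordinate.\<close>
  define W where "W \<omega> i = (if i \<in> I then V \<omega> i else 0)" for \<omega> i
  define U where "U = (\<Union>\<omega>'\<in>{\<omega>'\<in>space P. F \<omega>' < a}.
      {v. C * sqrt (r * (\<Sum>i\<in>I. (v i - V \<omega>' i)\<^sup>2)) < a - F \<omega>'})"
  have "open U"
    unfolding U_def
    by (intro open_UN ballI open_Collect_less continuous_intros continuous_on_product_coordinates)
  moreover have "W \<in> borel_measurable P"
  proof (rule measurable_coordinatewise_then_product)
    show "(\<lambda>\<omega>. W \<omega> i) \<in> borel_measurable P" for i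
      using V by (cases "i \<in> I") (simp_all add: W_def)
  qed
  ultimately have "W -` U \<inter> space P \<in> sets P"
    by (intro measurable_sets[of W P borel]) auto
  also have "W -` U \<inter> space P = {\<omega>\<in>space P. F \<omega> < a}"
  proof (intro set_eqI iffI)
    fix \<omega> assume "\<omega> \<in> W -` U \<inter> space P"
    then obtain \<omega>' where "\<omega> \<in> space P" "\<omega>' \<in> space P"
      "C * sqrt (r * (\<Sum>i\<in>I. (V \<omega> i - V \<omega>' i)\<^sup>2)) < a - F \<omega>'"
      by (auto simp: U_def W_def)
    then show "\<omega> \<in> {\<omega>\<in>space P. F \<omega> < a}" using lip[of \<omega> \<omega>'] by auto
  next
    fix \<omega> assume "\<omega> \<in> {\<omega>\<in>space P. F \<omega> < a}"
    then show "\<omega> \<in> W -` U \<inter> space P" by (auto simp: U_def W_def intro!: exI[of _ \<omega>])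
  qed
  finally show "{\<omega>\<in>space P. F \<omega> < a} \<in> sets P" .
qed

lemma sobolev_norm_diff_le:
  assumes f: "f \<in> sobolev k" and g: "g \<in> sobolev k" and j: "j \<le> k"
  shows "L2_norm (weak_deriv j f) - L2_norm (weak_deriv j g) \<le> L2_norm (weak_deriv j (\<lambda>x. f x - g x))"
proof -
  have "L2_norm (weak_deriv j (\<lambda>x. f x - g x)) = L2_norm (\<lambda>x. weak_deriv j f x - weak_deriv j g x)"
    using sobolev_lincomb(2)[OF f g j, of 1 "-1"] by simp
  then show ?thesis
    using L2_norm_diff_le[OF sobolev_weak_deriv(1)[OF f j] sobolev_weak_deriv(1)[OF g j]] by linarith
qed

lemma error_norm_measurable:
  assumes noise: "gaussian_noise P (M * N) \<sigma> \<eta>" and rec: "reconstruction k M N \<alpha> y P \<eta> fs"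
    and y: "y \<in> sobolev k" and k: "0 < k" "k \<le> M" and N: "0 < N" and \<alpha>: "0 < \<alpha>" and j: "j \<le> k"
  shows "(\<lambda>\<omega>. L2_norm (weak_deriv j (\<lambda>x. fs \<omega> x - y x))) \<in> borel_measurable P"
proof -
  define V where "V \<omega> = group_avg N (noisy_samples (M * N) y \<eta> \<omega>)" for \<omega>
  \<comment> \<open>Stability bounds the averages by sqrt D and the top derivative by sqrt D / sqrt
    \<alpha>; the two terms weight these as in the interpolation inequality with n = M
    cells.\<close>
  define c where "c = interp_const k * (real M ^ j + (1 / real M) ^ (k - j) / sqrt \<alpha>)"
  have M: "0 < M" using k by simp
  have P: "prob_space P" and indep: "prob_space.indep_vars P (\<lambda>_. borel) \<eta> {1..M * N}"
    using noise by (simp_all add: gaussian_noise_def)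
  have min: "is_arg_min (Phi k M \<alpha> (V \<omega>)) (\<lambda>f. f \<in> admissible k y) (fs \<omega>)" if "\<omega> \<in> space P" for \<omega>
    using rec that by (simp add: reconstruction_def V_def)
  have fs: "fs \<omega> \<in> sobolev k" if "\<omega> \<in> space P" for \<omega>
    using min[OF that] by (simp add: is_arg_min_def admissible_def)
  show ?thesis
  proof (rule measurable_lipschitz_in_data[where V=V and I="{1..M}" and C=c and r="1 / real M"])
    fix i assume i: "i \<in> {1..M}"
    have "\<eta> ((i - 1) * N + j) \<in> borel_measurable P" if "j \<in> {1..N}" for j
    proof -
      have "(i - 1) * N + j \<le> (i - 1) * N + N" using that by simp
      also have "\<dots> = i * N" using i by (cases i) auto
      also have "\<dots> \<le> M * N" using i by simp
      finally have "(i - 1) * N + j \<in> {1..M * N}" using that by simp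
      then show ?thesis
        using indep unfolding prob_space.indep_vars_def[OF P] by blast
    qed
    then show "(\<lambda>\<omega>. V \<omega> i) \<in> borel_measurable P"
      unfolding V_def group_avg_def noisy_samples_def
      by (intro borel_measurable_times borel_measurable_sum borel_measurable_add borel_measurable_const)
  next
    fix \<omega> \<omega>' assume w: "\<omega> \<in> space P" "\<omega>' \<in> space P"
    define D where "D = 1 / real M * (\<Sum>i=1..M. (V \<omega> i - V \<omega>' i)\<^sup>2)"
    define h where "h x = fs \<omega> x - fs \<omega>' x" for x
    have D0: "0 \<le> D" by (simp add: D_def sum_nonneg)
    have st: "mean_sq_avg M h \<le> D" "\<alpha> * (L2_norm (weak_deriv k h))\<^sup>2 \<le> D"
      unfolding h_def D_def using minimizer_stability[OF _ M \<alpha> min[OF w(1)] min[OF w(2)]] k by auto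
    have "(L2_norm (weak_deriv k h))\<^sup>2 \<le> D / \<alpha>" using st(2) \<alpha> by (simp add: field_simps)
    then have hk: "L2_norm (weak_deriv k h) \<le> sqrt D / sqrt \<alpha>"
      by (simp add: real_le_rsqrt flip: real_sqrt_divide)
    have "L2_norm (weak_deriv j (\<lambda>x. fs \<omega> x - y x)) - L2_norm (weak_deriv j (\<lambda>x. fs \<omega>' x - y x))
      \<le> L2_norm (weak_deriv j (\<lambda>x. (fs \<omega> x - y x) - (fs \<omega>' x - y x)))"
      by (intro sobolev_norm_diff_le[OF _ _ j] sobolev_diff fs w y)
    also have "\<dots> = L2_norm (weak_deriv j h)" by (simp add: h_def[abs_def])
    also have "\<dots> \<le> interp_const k * (real M ^ j * sqrt (mean_sq_avg M h) + (1 / real M) ^ (k - j) * L2_norm (weak_deriv k h))"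
      unfolding h_def by (rule sobolev_interpolation[OF sobolev_diff[OF fs[OF w(1)] fs[OF w(2)]] k j])
    also have "\<dots> \<le> interp_const k * (real M ^ j * sqrt D + (1 / real M) ^ (k - j) * (sqrt D / sqrt \<alpha>))"
      using st(1) hk interp_const_ge_1[of k] by (intro mult_left_mono add_mono) auto
    also have "\<dots> = c * sqrt D" by (simp add: c_def algebra_simps)
    finally show "L2_norm (weak_deriv j (\<lambda>x. fs \<omega> x - y x)) - L2_norm (weak_deriv j (\<lambda>x. fs \<omega>' x - y x))
      \<le> c * sqrt (1 / real M * (\<Sum>i=1..M. (V \<omega> i - V \<omega>' i)\<^sup>2))" by (simp add: D_def)
  qed simp
qed

subsection \<open>Convergence rates\<close>

text \<open>Rolle gives a zero of e', so e' is bounded pointwise by the norm of e''. With k = 2 the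
  penalised derivative thus controls e' without any help from the data, however large the
  noise.\<close>

lemma first_deriv_le_second:
  assumes e: "e \<in> sobolev k" and k: "2 \<le> k" and bc: "e 0 = e 1"
  shows "L2_norm (weak_deriv 1 e) \<le> L2_norm (weak_deriv 2 e)"
proof -
  obtain u where u: "deriv_chain k u" "\<And>x. x \<in> {0..1} \<Longrightarrow> u 0 x = e x"
    "\<And>n. n \<le> k \<Longrightarrow> L2_norm (weak_deriv n e) = L2_norm (u n)"
    using sobolev_deriv_chain[OF e] k by (metis less_le_trans zero_less_numeral)
  have L: "L2_fun (u 1)" "L2_fun (u 2)" using deriv_chain_L2[OF u(1)] k by auto
  have eq: "u 0 0 = u 0 1" using u(2)[of 0] u(2)[of 1] bc by simp
  have "\<exists>\<xi>\<in>{0<..<1}. u 0 1 - u 0 0 = u 1 \<xi> * (1 - 0)"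
  proof (rule mvt_simple[of 0 1 "u 0" "\<lambda>x. (*) (u 1 x)"])
    fix x :: real assume "0 \<le> x" "x \<le> 1"
    then show "(u 0 has_derivative (*) (u 1 x)) (at x within {0..1})"
      using deriv_chain_derivative[OF u(1), of 0 x] k by (simp add: has_field_derivative_def)
  qed simp
  then obtain \<xi> where \<xi>: "\<xi> \<in> {0<..<1}" "u 0 1 - u 0 0 = u 1 \<xi> * (1 - 0)" by blast
  then have \<xi>: "\<xi> \<in> {0..1}" "u 1 \<xi> = 0" using eq by auto
  define I where "I = integral {0..1} (\<lambda>x. (u 2 x)\<^sup>2)"
  have pt: "(u 1 x)\<^sup>2 \<le> I" if "x \<in> {0..1}" for x
  proof -
    have "\<bar>u 1 x\<bar> \<le> integral {0..1} (\<lambda>t. \<bar>u 2 t\<bar>)"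
      using deriv_chain_oscillation[OF u(1), of 1 0 1 x \<xi>] k that \<xi> by (simp add: numeral_2_eq_2)
    then have "\<bar>u 1 x\<bar>\<^sup>2 \<le> (integral {0..1} (\<lambda>t. \<bar>u 2 t\<bar>))\<^sup>2" by (intro power_mono) auto
    also have "\<dots> \<le> (1 - 0) * I"
      unfolding I_def by (intro integral_abs_sq_le L2_funD[OF L(2)] set_lebesgue_integral_eq_integral(1)) auto
    finally show ?thesis by simp
  qed
  have "(L2_norm (u 1))\<^sup>2 \<le> integral {0..1} (\<lambda>x::real. I)"
    unfolding L2_norm_sq[OF L(1)]
    by (intro integral_le pt set_lebesgue_integral_eq_integral(1)[OF L2_funD(1)[OF L(1)]] integrable_const_ivl)
  also have "\<dots> = (L2_norm (u 2))\<^sup>2" by (simp add: I_def L2_norm_sq[OF L(2)])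
  finally have "L2_norm (u 1) \<le> L2_norm (u 2)" by (rule power2_le_imp_le) (rule L2_norm_nonneg)
  then show ?thesis using u(3)[of 1] u(3)[of 2] k by simp
qed

text \<open>With the averages replaced by the norm of \<open>e\<close>, the number \<open>n\<close>
  of cells is free and no longer tied to the grid of the data.\<close>

lemma interpolation_L2:
  assumes e: "e \<in> sobolev k" and k: "0 < k" and n: "k \<le> n" and j: "j \<le> k"
  shows "L2_norm (weak_deriv j e) \<le> interp_const k *
    (real n ^ j * L2_norm e + (1 / real n) ^ (k - j) * L2_norm (weak_deriv k e))"
proof -
  have "mean_sq_avg n e \<le> (L2_norm e)\<^sup>2"
    using mean_sq_avg_le[OF sobolev_continuous[OF e], of n] k n by simp
  then have "sqrt (mean_sq_avg n e) \<le> L2_norm e"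
    using L2_norm_nonneg[of e] by (simp add: real_le_lsqrt mean_sq_avg_nonneg)
  then have "interp_const k * (real n ^ j * sqrt (mean_sq_avg n e) + (1 / real n) ^ (k - j) * L2_norm (weak_deriv k e))
    \<le> interp_const k * (real n ^ j * L2_norm e + (1 / real n) ^ (k - j) * L2_norm (weak_deriv k e))"
    using interp_const_ge_1[of k] by (intro mult_left_mono add_mono) auto
  then show ?thesis using sobolev_interpolation[OF assms] by linarith
qed

text \<open>Interpolation at the scale \<open>r = max h (s\<^sup>1\<^sup>/\<^sup>2\<^sup>k)\<close> balances the two error terms.\<close>

lemma error_rate_small:
  assumes e: "e \<in> sobolev k" and k: "0 < k" and j: "j \<le> k"
    and K: "L2_norm (weak_deriv k e) \<le> K" and A: "L2_norm e \<le> A * (sqrt s + h ^ k)" "0 \<le> A"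
    and h: "0 < h" "h \<le> 1" and s: "0 < s" "s \<le> 1"
  shows "L2_norm (weak_deriv j e) \<le> interp_const k * (2 * A * real (k + 1) ^ j + K) *
     (h ^ (k - j) + s powr (real (k - j) / (2 * real k)))"
proof -
  define t where "t = s powr (1 / (2 * real k))"
  define r where "r = max h t"
  have t: "0 < t" "t \<le> 1" using s by (auto simp: t_def powr_le1)
  have r: "0 < r" "r \<le> 1" using h t by (auto simp: r_def)
  have tpow: "t ^ m = s powr (real m / (2 * real k))" for m
    using s by (simp add: t_def powr_realpow[symmetric] powr_powr)
  have K0: "0 \<le> K" using K L2_norm_nonneg[of "weak_deriv k e"] by linarith
  have "sqrt s = t ^ k" using s k by (simp add: tpow powr_half_sqrt[symmetric])
  also have "\<dots> \<le> r ^ k" using t by (intro power_mono) (auto simp: r_def)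
  finally have "sqrt s \<le> r ^ k" .
  moreover have "h ^ k \<le> r ^ k" using h by (intro power_mono) (auto simp: r_def)
  ultimately have "A * (sqrt s + h ^ k) \<le> A * (2 * r ^ k)" using A(2) by (intro mult_left_mono) auto
  then have eA: "L2_norm e \<le> 2 * A * r ^ k" using A(1) by simp
  \<comment> \<open>The number of cells of size about r. The factor k guarantees k \<le> n because r
    \<le> 1, at the price of n \<le> (k + 1)/r instead of about 1/r.\<close>
  define n where "n = nat \<lceil>real k / r\<rceil>"
  have nlow: "real k / r \<le> real n" unfolding n_def by (rule real_nat_ceiling_ge)
  have "real k \<le> real k / r" using r by (simp add: pos_le_divide_eq mult_left_le)
  then have nk: "k \<le> n" using nlow by linarith
  have "real n \<le> real k / r + 1"
    unfolding n_def using r by (simp add: of_nat_nat)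
  also have "\<dots> \<le> real (k + 1) / r" using r by (simp add: add_divide_distrib)
  finally have nhigh: "real n \<le> real (k + 1) / r" .
  have "1 / r \<le> real k / r" using k r by (intro divide_right_mono) auto
  then have "1 / r \<le> real n" using nlow by linarith
  then have ninv: "1 / real n \<le> r" using r k nk by (simp add: field_simps)
  have "L2_norm (weak_deriv j e) \<le> interp_const k *
    (real n ^ j * L2_norm e + (1 / real n) ^ (k - j) * L2_norm (weak_deriv k e))"
    by (rule interpolation_L2[OF e k nk j])
  also have "\<dots> \<le> interp_const k * ((real (k + 1) / r) ^ j * (2 * A * r ^ k) + r ^ (k - j) * K)"
    using nhigh ninv eA K r interp_const_ge_1[of k]
    by (intro mult_left_mono add_mono mult_mono power_mono) (auto simp: L2_norm_nonneg)
  also have "(real (k + 1) / r) ^ j * (2 * A * r ^ k) = 2 * A * real (k + 1) ^ j * r ^ (k - j)"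
    using r j by (simp add: power_divide power_diff)
  also have "interp_const k * (2 * A * real (k + 1) ^ j * r ^ (k - j) + r ^ (k - j) * K)
    = interp_const k * (2 * A * real (k + 1) ^ j + K) * r ^ (k - j)"
    by (simp add: algebra_simps)
  also have "\<dots> \<le> interp_const k * (2 * A * real (k + 1) ^ j + K) * (h ^ (k - j) + t ^ (k - j))"
    using h t A(2) K0 interp_const_ge_1[of k] by (intro mult_left_mono) (auto simp: r_def max_def)
  finally show ?thesis unfolding tpow .
qed

text \<open>Interpolation at the balancing scale needs s \<le> 1, since no scale exceeds the length
  of the interval. Beyond that the right-hand factor is at least 1, and a bound by a constant is
  enough where one exists. The constant is the sum of one constant per regime: \<open>A\<close> for
  j = 0, the first \<open>interp_const\<close> term for s \<le> 1, \<open>K\<close> for k = 2, and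
  the last term for s \<le> B.\<close>

lemma error_rate:
  assumes e: "e \<in> sobolev k" and k: "1 < k" and j: "j \<le> k - 1" and bc: "e 0 = 0" "e 1 = 0"
    and K: "L2_norm (weak_deriv k e) \<le> K" and A: "L2_norm e \<le> A * (sqrt s + h ^ k)" "0 \<le> A"
    and h: "0 < h" "h \<le> 1" and s: "0 < s" and case_: "j = 0 \<or> k = 2 \<or> s \<le> B"
  defines "C \<equiv> A + K + interp_const k * (2 * A * real (k + 1) ^ j + K)
    + interp_const k * (real k ^ j * (A * (sqrt \<bar>B\<bar> + 1)) + K)"
  shows "L2_norm (weak_deriv j e) \<le> C * h ^ (k - j) + C * s powr (real (k - j) / (2 * real k))"
proof -
  define R where "R = h ^ (k - j) + s powr (real (k - j) / (2 * real k))"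
  have K0: "0 \<le> K" using K L2_norm_nonneg[of "weak_deriv k e"] by linarith
  have i0: "0 \<le> interp_const k" using interp_const_ge_1[of k] by linarith
  have R0: "0 \<le> R" using h by (simp add: R_def)
  define C1 where "C1 = interp_const k * (2 * A * real (k + 1) ^ j + K)"
  define C2 where "C2 = interp_const k * (real k ^ j * (A * (sqrt \<bar>B\<bar> + 1)) + K)"
  have nn: "0 \<le> C1" "0 \<le> C2" using A(2) K0 i0 by (auto simp: C1_def C2_def)
  have C: "C = A + K + C1 + C2" by (simp add: C_def C1_def C2_def)
  consider "j = 0" | "j \<noteq> 0" "s \<le> 1" | "j \<noteq> 0" "1 < s" "k = 2" | "j \<noteq> 0" "1 < s" "s \<le> B"
    using case_ by fastforce
  then have "\<exists>c. c \<le> C \<and> L2_norm (weak_deriv j e) \<le> c * R"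
  proof cases
    case 1
    have "s powr (real k / (2 * real k)) = sqrt s" using s k by (simp add: powr_half_sqrt[symmetric])
    then have "L2_norm (weak_deriv j e) \<le> A * R"
      using A(1) 1 unfolding R_def by (simp add: L2_norm_weak_deriv_0[OF sobolev_L2_fun[OF e]] add.commute)
    then show ?thesis using nn A K0 C by (intro exI[of _ A]) auto
  next
    case 2
    then have "L2_norm (weak_deriv j e) \<le> C1 * R"
      unfolding C1_def R_def using k j by (intro error_rate_small[OF e _ _ K A h s]) auto
    then show ?thesis using nn A K0 C by (intro exI[of _ C1]) auto
  next
    case 3
    then have j1: "j = 1" using j by auto
    have "1 \<le> R"
      unfolding R_def using h 3 by (intro add_increasing ge_one_powr_ge_zero) auto
    have "L2_norm (weak_deriv j e) \<le> K"
      using first_deriv_le_second[OF e] bc K 3 j1 by simp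
    also have "\<dots> \<le> K * R" using K0 \<open>1 \<le> R\<close> by (simp add: mult_le_cancel_left1)
    finally show ?thesis using nn A K0 C by (intro exI[of _ K]) auto
  next
    case 4
    \<comment> \<open>In this regime a bound by a constant suffices, and the coarsest admissible
      interpolation, with n = k cells, provides it.\<close>
    have "1 \<le> R"
      unfolding R_def using h 4 by (intro add_increasing ge_one_powr_ge_zero) auto
    have "sqrt s \<le> sqrt \<bar>B\<bar>" using 4 by simp
    moreover have "h ^ k \<le> 1" using h by (simp add: power_le_one)
    ultimately have "A * (sqrt s + h ^ k) \<le> A * (sqrt \<bar>B\<bar> + 1)"
      by (intro mult_left_mono add_mono A(2))
    then have eA: "L2_norm e \<le> A * (sqrt \<bar>B\<bar> + 1)" using A(1) by linarith
    have "L2_norm (weak_deriv j e) \<le> interp_const k * (real k ^ j * L2_norm e + (1 / real k) ^ (k - j) * L2_norm (weak_deriv k e))"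
      using k j by (intro interpolation_L2[OF e]) auto
    also have "\<dots> \<le> interp_const k * (real k ^ j * (A * (sqrt \<bar>B\<bar> + 1)) + 1 * K)"
      using eA K k i0 by (intro mult_left_mono add_mono mult_mono) (auto simp: L2_norm_nonneg power_le_one)
    also have "\<dots> = C2" by (simp add: C2_def)
    also have "\<dots> \<le> C2 * R" using nn \<open>1 \<le> R\<close> by (simp add: mult_le_cancel_left1)
    finally show ?thesis using nn A K0 C by (intro exI[of _ C2]) auto
  qed
  then obtain c where c: "c \<le> C" "L2_norm (weak_deriv j e) \<le> c * R" by blast
  have "c * R \<le> C * R" using c R0 by (intro mult_right_mono)
  then show ?thesis using c unfolding R_def by (simp add: algebra_simps)
qed

section \<open>Bounds on the high-probability event\<close>

lemma error_bounds:
  assumes y: "y \<in> sobolev k" and k: "1 < k" and M: "0 < M" and N: "0 < N" and \<sigma>: "0 < \<sigma>" and c: "0 < c"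
    and Q: "L2_norm (weak_deriv 1 y) \<le> Q"
    and rec: "reconstruction k M N (c * \<sigma>\<^sup>2 / real N) y P \<eta> fs" and \<omega>: "\<omega> \<in> space P"
    and noise: "noise_level_sq M N y \<eta> \<omega> \<le> z * \<sigma>\<^sup>2 / real N"
  defines "e \<equiv> \<lambda>x. fs \<omega> x - y x"
  defines "\<Delta> \<equiv> (8 * z * \<sigma>\<^sup>2 + 2 * c * \<sigma>\<^sup>2 * (L2_norm (weak_deriv k y))\<^sup>2) / real N + 8 * Q\<^sup>2 * (mesh M)\<^sup>2 / (real N)\<^sup>2"
  shows "e \<in> sobolev k" and "e 0 = 0" and "e 1 = 0"
    and "L2_norm (weak_deriv k e) \<le> sqrt (2 * z / c + 2 * Q\<^sup>2 * (mesh M)\<^sup>2 / (c * real N * \<sigma>\<^sup>2)) + 2 * L2_norm (weak_deriv k y)"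
    and "mean_sq_avg M e \<le> \<Delta>"
    and "L2_norm e \<le> mesh M * L2_norm (weak_deriv 1 e) + sqrt \<Delta>"
proof -
  define \<alpha> where "\<alpha> = c * \<sigma>\<^sup>2 / real N"
  define T where "T = 2 * (z * \<sigma>\<^sup>2 / real N) + 2 * (Q\<^sup>2 * (mesh M)\<^sup>2 / (real N)\<^sup>2)"
  have \<alpha>: "0 < \<alpha>" using c \<sigma> N by (simp add: \<alpha>_def)
  have min: "is_arg_min (Phi k M \<alpha> (group_avg N (noisy_samples (M * N) y \<eta> \<omega>))) (\<lambda>f. f \<in> admissible k y) (fs \<omega>)"
    using rec \<omega> by (simp add: reconstruction_def \<alpha>_def)
  have k1: "1 \<le> k" using k by simp
  note est = minimizer_estimate[OF y k1 M N \<alpha> Q min noise, folded T_def]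
  show es: "e \<in> sobolev k" unfolding e_def by (rule sobolev_diff[OF est(1) y])
  show "e 0 = 0" "e 1 = 0" using est(2,3) by (simp_all add: e_def)
  have "T / \<alpha> = 2 * z / c + 2 * Q\<^sup>2 * (mesh M)\<^sup>2 / (c * real N * \<sigma>\<^sup>2)"
    using c \<sigma> N by (simp add: T_def \<alpha>_def field_simps power2_eq_square)
  then show "L2_norm (weak_deriv k e) \<le> sqrt (2 * z / c + 2 * Q\<^sup>2 * (mesh M)\<^sup>2 / (c * real N * \<sigma>\<^sup>2)) + 2 * L2_norm (weak_deriv k y)"
    using est(4) by (simp add: e_def)
  have "4 * T + 2 * \<alpha> * (L2_norm (weak_deriv k y))\<^sup>2 = \<Delta>"
    by (simp add: T_def \<alpha>_def \<Delta>_def add_divide_distrib)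
  then show ms: "mean_sq_avg M e \<le> \<Delta>" using est(5) by (simp add: e_def)
  have "L2_norm e \<le> mesh M * L2_norm (weak_deriv 1 e) + sqrt (mean_sq_avg M e)"
    by (rule poincare_cells[OF es k1 M])
  with ms show "L2_norm e \<le> mesh M * L2_norm (weak_deriv 1 e) + sqrt \<Delta>"
    by (meson add_left_mono order_trans real_sqrt_le_mono)
qed

text \<open>Measurability has to be supplied separately: \<open>measure\<close> is 0 by convention
  on a set outside the sigma-algebra, so containing a likely event would not by itself give a lower
  bound.\<close>

lemma high_probability_event:
  assumes noise: "gaussian_noise P (M * N) \<sigma> \<eta>" and M: "0 < M" and N: "0 < N" and \<sigma>: "0 < \<sigma>"
    and p: "0 < p" "p < 1" and meas: "{\<omega> \<in> space P. R \<omega>} \<in> sets P"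
    and imp: "\<And>\<omega>. \<omega> \<in> space P \<Longrightarrow> noise_level_sq M N y \<eta> \<omega> \<le> zbar M p * \<sigma>\<^sup>2 / real N \<Longrightarrow> R \<omega>"
  shows "measure P {\<omega> \<in> space P. R \<omega>} \<ge> 1 - p"
proof -
  interpret prob_space P using noise by (simp add: gaussian_noise_def)
  have "1 - p \<le> prob {\<omega> \<in> space P. noise_level_sq M N y \<eta> \<omega> \<le> zbar M p * \<sigma>\<^sup>2 / real N}"
    by (rule noise_level_concentration(2)[OF noise M N \<sigma> p])
  also have "\<dots> \<le> prob {\<omega> \<in> space P. R \<omega>}"
    using imp by (intro finite_measure_mono meas) auto
  finally show ?thesis .
qed

text \<open>Stated for single outcomes, so that \<open>C\<close> can be chosen before the
  probability space. Two replacements make \<open>C\<close> uniform: \<open>zbar M p\<close> by the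
  bound \<open>Z\<close>, which depends on p alone, and the quadrature terms by multiples of 1 and
  of \<open>s\<close>, because the assumption on \<sigma> says that the squared mesh over N
  \<sigma>^2 is below 1.\<close>

lemma error_rate_constants:
  fixes y :: "real \<Rightarrow> real"
  assumes y: "y \<in> sobolev k" and k: "1 < k" and p: "0 < p" "p < 1" and c: "0 < c"
    and Q: "L2_norm (weak_deriv 1 y) \<le> Q" and j: "j \<le> k - 1"
  shows "\<exists>C. \<forall>M N \<sigma> (P :: 'w measure) \<eta> fs \<omega>. k < M \<longrightarrow> 0 < N \<longrightarrow> 0 < \<sigma> \<longrightarrow>
    reconstruction k M N (c * \<sigma>\<^sup>2 / real N) y P \<eta> fs \<longrightarrow> \<omega> \<in> space P \<longrightarrow>
    noise_level_sq M N y \<eta> \<omega> \<le> zbar M p * \<sigma>\<^sup>2 / real N \<longrightarrow>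
    (mesh M)\<^sup>2 / real N < \<sigma>\<^sup>2 \<longrightarrow> j = 0 \<or> k = 2 \<or> \<sigma>\<^sup>2 / real N \<le> B \<longrightarrow>
    L2_norm (weak_deriv j (\<lambda>x. fs \<omega> x - y x))
      \<le> C * mesh M ^ (k - j) + C * (\<sigma>\<^sup>2 / real N) powr (real (k - j) / (2 * real k))"
proof -
  define Z where "Z = 2 * (1 + ln (2 / p\<^sup>2))"
  define Yk where "Yk = L2_norm (weak_deriv k y)"
  define K where "K = sqrt (2 * Z / c + 2 * Q\<^sup>2 / c) + 2 * Yk"
  define D where "D = 8 * Z + 2 * c * Yk\<^sup>2 + 8 * Q\<^sup>2"
  define A where "A = interp_const k * (sqrt D + K)"
  define C where "C = A + K + interp_const k * (2 * A * real (k + 1) ^ j + K)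
    + interp_const k * (real k ^ j * (A * (sqrt \<bar>B\<bar> + 1)) + K)"
  have Z0: "0 \<le> Z" using zbar(1,3)[OF p, of 1] by (simp add: Z_def)
  have K0: "0 \<le> K" using Z0 c by (simp add: K_def Yk_def L2_norm_nonneg)
  have D0: "0 \<le> D" using Z0 c by (simp add: D_def)
  have i0: "0 \<le> interp_const k" using interp_const_ge_1[of k] by linarith
  have A0: "0 \<le> A" using i0 D0 K0 by (simp add: A_def)
  show ?thesis
  proof (intro exI[of _ C] allI impI)
    fix M N \<sigma> and P :: "'w measure" and \<eta> fs \<omega>
    assume M: "k < M" and N: "0 < N" and \<sigma>: "0 < \<sigma>"
      and rec: "reconstruction k M N (c * \<sigma>\<^sup>2 / real N) y P \<eta> fs" and \<omega>: "\<omega> \<in> space P"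
      and noise: "noise_level_sq M N y \<eta> \<omega> \<le> zbar M p * \<sigma>\<^sup>2 / real N"
      and large: "(mesh M)\<^sup>2 / real N < \<sigma>\<^sup>2" and B: "j = 0 \<or> k = 2 \<or> \<sigma>\<^sup>2 / real N \<le> B"
    define e where "e = (\<lambda>x. fs \<omega> x - y x)"
    define h where "h = mesh M"
    define s where "s = \<sigma>\<^sup>2 / real N"
    have M0: "0 < M" using M by simp
    have h: "0 < h" "h \<le> 1" "h = 1 / real M" using M by (auto simp: h_def mesh_def)
    have s: "0 < s" using \<sigma> N by (simp add: s_def)
    have z: "zbar M p \<le> Z" unfolding Z_def by (rule zbar(3)[OF p M0])
    note eb = error_bounds[OF y k M0 N \<sigma> c Q rec \<omega> noise, folded e_def, folded Yk_def h_def]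
    have e01: "e 0 = 0" "e 1 = 0" using eb(2,3) by (simp_all add: e_def)
    have ratio: "h\<^sup>2 / (real N * \<sigma>\<^sup>2) \<le> 1"
      using large N \<sigma> by (simp add: h_def field_simps)
    have "2 * Q\<^sup>2 * h\<^sup>2 / (c * real N * \<sigma>\<^sup>2) = (2 * Q\<^sup>2 / c) * (h\<^sup>2 / (real N * \<sigma>\<^sup>2))"
      by simp
    also have "\<dots> \<le> (2 * Q\<^sup>2 / c) * 1" using ratio c by (intro mult_left_mono) auto
    finally have q1: "2 * Q\<^sup>2 * h\<^sup>2 / (c * real N * \<sigma>\<^sup>2) \<le> 2 * Q\<^sup>2 / c" by simp
    have "2 * zbar M p / c \<le> 2 * Z / c" using z c by (intro divide_right_mono) auto
    with q1 have "sqrt (2 * zbar M p / c + 2 * Q\<^sup>2 * h\<^sup>2 / (c * real N * \<sigma>\<^sup>2)) \<le> sqrt (2 * Z / c + 2 * Q\<^sup>2 / c)"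
      by (intro real_sqrt_le_mono add_mono)
    then have eK: "L2_norm (weak_deriv k e) \<le> K" using eb(4) unfolding K_def by linarith
    have "8 * Q\<^sup>2 * h\<^sup>2 / (real N)\<^sup>2 = 8 * Q\<^sup>2 * (h\<^sup>2 / (real N * \<sigma>\<^sup>2)) * s"
      using N \<sigma> by (simp add: s_def power2_eq_square)
    also have "\<dots> \<le> 8 * Q\<^sup>2 * 1 * s" using ratio s by (intro mult_right_mono mult_left_mono) auto
    finally have q2: "8 * Q\<^sup>2 * h\<^sup>2 / (real N)\<^sup>2 \<le> 8 * Q\<^sup>2 * s" by simp
    have "(8 * zbar M p * \<sigma>\<^sup>2 + 2 * c * \<sigma>\<^sup>2 * Yk\<^sup>2) / real N = 8 * zbar M p * s + 2 * c * Yk\<^sup>2 * s"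
      by (simp add: s_def add_divide_distrib)
    also have "\<dots> \<le> 8 * Z * s + 2 * c * Yk\<^sup>2 * s" using z s by (intro add_right_mono mult_right_mono) auto
    finally have "mean_sq_avg M e \<le> D * s" using eb(5) q2 by (simp add: D_def algebra_simps)
    then have ms: "sqrt (mean_sq_avg M e) \<le> sqrt D * sqrt s"
      using real_sqrt_le_mono[of "mean_sq_avg M e" "D * s"] by (simp add: real_sqrt_mult)
    have "L2_norm e = L2_norm (weak_deriv 0 e)"
      by (rule L2_norm_weak_deriv_0[OF sobolev_L2_fun[OF eb(1)], symmetric])
    also have "\<dots> \<le> interp_const k * (real M ^ 0 * sqrt (mean_sq_avg M e) + (1 / real M) ^ (k - 0) * L2_norm (weak_deriv k e))"
      using k M by (intro sobolev_interpolation[OF eb(1)]) auto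
    also have "\<dots> \<le> interp_const k * (sqrt D * sqrt s + h ^ k * K)"
      using ms eK h i0 by (intro mult_left_mono add_mono) (auto intro: mult_left_mono)
    also have "\<dots> \<le> interp_const k * ((sqrt D + K) * (sqrt s + h ^ k))"
      using i0 D0 K0 s h by (intro mult_left_mono) (auto simp: algebra_simps)
    finally have eA: "L2_norm e \<le> A * (sqrt s + h ^ k)" by (simp add: A_def mult.assoc)
    have "L2_norm (weak_deriv j e) \<le> C * h ^ (k - j) + C * s powr (real (k - j) / (2 * real k))"
      unfolding C_def by (rule error_rate[OF eb(1) k j e01 eK eA A0 h(1,2) s B[folded s_def]])
    then show "L2_norm (weak_deriv j (\<lambda>x. fs \<omega> x - y x))
      \<le> C * mesh M ^ (k - j) + C * (\<sigma>\<^sup>2 / real N) powr (real (k - j) / (2 * real k))"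
      by (simp add: e_def h_def s_def)
  qed
qed

theorem theorem3p8:
  fixes k :: nat and p c Q :: real and y :: "real \<Rightarrow> real"
  assumes "1 < k"
    and "y \<in> sobolev k"
    and "0 < p" and "p < 0.37"
    and "0 < c"
    and "L2_norm (weak_deriv 1 y) \<le> Q"
  shows
    "(\<forall>M N \<sigma> (P :: 'w measure) \<eta>.
        k < M \<and> k < N \<and> 0 < \<sigma> \<and> gaussian_noise P (M * N) \<sigma> \<eta> \<longrightarrow>
        measure P {\<omega> \<in> space P. noise_level_sq M N y \<eta> \<omega> \<le> zbar M p * \<sigma>\<^sup>2 / real N} \<ge> 1 - p)
   \<and> (\<forall>M N \<sigma> (P :: 'w measure) \<eta> fs.
        k < M \<and> k < N \<and> 0 < \<sigma> \<and> gaussian_noise P (M * N) \<sigma> \<eta>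
        \<and> reconstruction k M N (c * \<sigma>\<^sup>2 / real N) y P \<eta> fs \<longrightarrow>
        measure P {\<omega> \<in> space P. let e = (\<lambda>x. fs \<omega> x - y x) in
            L2_norm (weak_deriv k e)
              \<le> sqrt (2 * zbar M p / c + 2 * Q\<^sup>2 * (mesh M)\<^sup>2 / (c * real N * \<sigma>\<^sup>2))
                + 2 * L2_norm (weak_deriv k y)
          \<and> L2_norm e
              \<le> mesh M * L2_norm (weak_deriv 1 e)
                + sqrt ((8 * zbar M p * \<sigma>\<^sup>2 + 2 * c * \<sigma>\<^sup>2 * (L2_norm (weak_deriv k y))\<^sup>2) / real N
                        + 8 * Q\<^sup>2 * (mesh M)\<^sup>2 / (real N)\<^sup>2)} \<ge> 1 - p)
   \<and> (\<forall>j\<le>k - 1. \<forall>B :: real. \<exists>C1 C2 :: real. \<forall>M N \<sigma> (P :: 'w measure) \<eta> fs.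
        k < M \<and> k < N \<and> 0 < \<sigma> \<and> gaussian_noise P (M * N) \<sigma> \<eta>
        \<and> reconstruction k M N (c * \<sigma>\<^sup>2 / real N) y P \<eta> fs
        \<and> \<sigma>\<^sup>2 > (mesh M)\<^sup>2 / real N
        \<and> (j = 0 \<or> k = 2 \<or> \<sigma>\<^sup>2 / real N \<le> B) \<longrightarrow>
        measure P {\<omega> \<in> space P.
            L2_norm (weak_deriv j (\<lambda>x. fs \<omega> x - y x))
              \<le> C1 * mesh M ^ (k - j)
                + C2 * (\<sigma>\<^sup>2 / real N) powr (real (k - j) / (2 * real k))} \<ge> 1 - p)"
proof -
  note k = \<open>1 < k\<close> and y = \<open>y \<in> sobolev k\<close> and c = \<open>0 < c\<close> and Q = \<open>L2_norm (weak_deriv 1 y) \<le> Q\<close>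
  have p: "0 < p" "p < 1" using \<open>0 < p\<close> \<open>p < 0.37\<close> by auto
  have norm_meas: "(\<lambda>\<omega>. L2_norm (weak_deriv j (\<lambda>x. fs \<omega> x - y x))) \<in> borel_measurable P"
    if "gaussian_noise P (M * N) \<sigma> \<eta>" "reconstruction k M N (c * \<sigma>\<^sup>2 / real N) y P \<eta> fs"
      "k < M" "k < N" "0 < \<sigma>" "j \<le> k" for M N \<sigma> and P :: "'w measure" and \<eta> fs j
    using that k c by (intro error_norm_measurable[OF that(1,2) y]) auto
  show ?thesis
  proof (intro conjI allI impI)
    fix M N \<sigma> and P :: "'w measure" and \<eta>
    assume "k < M \<and> k < N \<and> 0 < \<sigma> \<and> gaussian_noise P (M * N) \<sigma> \<eta>"
    then show "1 - p \<le> measure P {\<omega> \<in> space P. noise_level_sq M N y \<eta> \<omega> \<le> zbar M p * \<sigma>\<^sup>2 / real N}"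
      using k by (intro noise_level_concentration(2) p) auto
  next
    fix M N \<sigma> and P :: "'w measure" and \<eta> fs
    assume "k < M \<and> k < N \<and> 0 < \<sigma> \<and> gaussian_noise P (M * N) \<sigma> \<eta>
        \<and> reconstruction k M N (c * \<sigma>\<^sup>2 / real N) y P \<eta> fs"
    then have MN: "k < M" "k < N" "0 < \<sigma>" and noise: "gaussian_noise P (M * N) \<sigma> \<eta>"
      and rec: "reconstruction k M N (c * \<sigma>\<^sup>2 / real N) y P \<eta> fs" by auto
    have pos: "0 < M" "0 < N" using MN by auto
    have "1 \<le> k" using k by simp
    note meas = norm_meas[OF noise rec MN order_refl] norm_meas[OF noise rec MN this]
    have fs: "fs \<omega> \<in> sobolev k" if "\<omega> \<in> space P" for \<omega>
      using rec that by (simp add: reconstruction_def is_arg_min_def admissible_def)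
    \<comment> \<open>The measurability result concerns weak derivatives. Order 0 gives the norm of
      the error itself, but only on \<open>space P\<close>, where the reconstruction is known to be
      a Sobolev function.\<close>
    have "(\<lambda>\<omega>. L2_norm (weak_deriv 0 (\<lambda>x. fs \<omega> x - y x))) \<in> borel_measurable P"
      by (rule norm_meas[OF noise rec MN]) simp
    also have "?this \<longleftrightarrow> (\<lambda>\<omega>. L2_norm (\<lambda>x. fs \<omega> x - y x)) \<in> borel_measurable P"
      by (intro measurable_cong L2_norm_weak_deriv_0 sobolev_L2_fun[OF sobolev_diff[OF fs y]])
    finally have meas0: "(\<lambda>\<omega>. L2_norm (\<lambda>x. fs \<omega> x - y x)) \<in> borel_measurable P" .
    show "1 - p \<le> measure P {\<omega> \<in> space P. let e = (\<lambda>x. fs \<omega> x - y x) in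
            L2_norm (weak_deriv k e)
              \<le> sqrt (2 * zbar M p / c + 2 * Q\<^sup>2 * (mesh M)\<^sup>2 / (c * real N * \<sigma>\<^sup>2))
                + 2 * L2_norm (weak_deriv k y)
          \<and> L2_norm e
              \<le> mesh M * L2_norm (weak_deriv 1 e)
                + sqrt ((8 * zbar M p * \<sigma>\<^sup>2 + 2 * c * \<sigma>\<^sup>2 * (L2_norm (weak_deriv k y))\<^sup>2) / real N
                        + 8 * Q\<^sup>2 * (mesh M)\<^sup>2 / (real N)\<^sup>2)}"
      unfolding Let_def
    proof (rule high_probability_event[OF noise pos MN(3) p, of _ y])
      show "{\<omega> \<in> space P. L2_norm (weak_deriv k (\<lambda>x. fs \<omega> x - y x))
              \<le> sqrt (2 * zbar M p / c + 2 * Q\<^sup>2 * (mesh M)\<^sup>2 / (c * real N * \<sigma>\<^sup>2))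
                + 2 * L2_norm (weak_deriv k y)
          \<and> L2_norm (\<lambda>x. fs \<omega> x - y x)
              \<le> mesh M * L2_norm (weak_deriv 1 (\<lambda>x. fs \<omega> x - y x))
                + sqrt ((8 * zbar M p * \<sigma>\<^sup>2 + 2 * c * \<sigma>\<^sup>2 * (L2_norm (weak_deriv k y))\<^sup>2) / real N
                        + 8 * Q\<^sup>2 * (mesh M)\<^sup>2 / (real N)\<^sup>2)} \<in> sets P"
        by (intro sets.sets_Collect_conj borel_measurable_le borel_measurable_add borel_measurable_times
            borel_measurable_const meas meas0)
      show "L2_norm (weak_deriv k (\<lambda>x. fs \<omega> x - y x))
              \<le> sqrt (2 * zbar M p / c + 2 * Q\<^sup>2 * (mesh M)\<^sup>2 / (c * real N * \<sigma>\<^sup>2))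
                + 2 * L2_norm (weak_deriv k y)
          \<and> L2_norm (\<lambda>x. fs \<omega> x - y x)
              \<le> mesh M * L2_norm (weak_deriv 1 (\<lambda>x. fs \<omega> x - y x))
                + sqrt ((8 * zbar M p * \<sigma>\<^sup>2 + 2 * c * \<sigma>\<^sup>2 * (L2_norm (weak_deriv k y))\<^sup>2) / real N
                        + 8 * Q\<^sup>2 * (mesh M)\<^sup>2 / (real N)\<^sup>2)"
        if "\<omega> \<in> space P" "noise_level_sq M N y \<eta> \<omega> \<le> zbar M p * \<sigma>\<^sup>2 / real N" for \<omega>
        using error_bounds(4,6)[OF y k pos MN(3) c Q rec that] by blast
    qed
  next
    fix j :: nat and B :: real
    assume j: "j \<le> k - 1"
    obtain C where C: "\<And>M N \<sigma> (P :: 'w measure) \<eta> fs \<omega>. k < M \<Longrightarrow> 0 < N \<Longrightarrow> 0 < \<sigma> \<Longrightarrow>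
      reconstruction k M N (c * \<sigma>\<^sup>2 / real N) y P \<eta> fs \<Longrightarrow> \<omega> \<in> space P \<Longrightarrow>
      noise_level_sq M N y \<eta> \<omega> \<le> zbar M p * \<sigma>\<^sup>2 / real N \<Longrightarrow>
      (mesh M)\<^sup>2 / real N < \<sigma>\<^sup>2 \<Longrightarrow> j = 0 \<or> k = 2 \<or> \<sigma>\<^sup>2 / real N \<le> B \<Longrightarrow>
      L2_norm (weak_deriv j (\<lambda>x. fs \<omega> x - y x))
        \<le> C * mesh M ^ (k - j) + C * (\<sigma>\<^sup>2 / real N) powr (real (k - j) / (2 * real k))"
      using error_rate_constants[OF y k p c Q j, of B, where 'w='w] by blast
    show "\<exists>C1 C2 :: real. \<forall>M N \<sigma> (P :: 'w measure) \<eta> fs.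
        k < M \<and> k < N \<and> 0 < \<sigma> \<and> gaussian_noise P (M * N) \<sigma> \<eta>
        \<and> reconstruction k M N (c * \<sigma>\<^sup>2 / real N) y P \<eta> fs
        \<and> \<sigma>\<^sup>2 > (mesh M)\<^sup>2 / real N
        \<and> (j = 0 \<or> k = 2 \<or> \<sigma>\<^sup>2 / real N \<le> B) \<longrightarrow>
        measure P {\<omega> \<in> space P.
            L2_norm (weak_deriv j (\<lambda>x. fs \<omega> x - y x))
              \<le> C1 * mesh M ^ (k - j)
                + C2 * (\<sigma>\<^sup>2 / real N) powr (real (k - j) / (2 * real k))} \<ge> 1 - p"
    proof (intro exI[of _ C] allI impI)
      fix M N \<sigma> and P :: "'w measure" and \<eta> fs
      assume asm: "k < M \<and> k < N \<and> 0 < \<sigma> \<and> gaussian_noise P (M * N) \<sigma> \<eta>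
        \<and> reconstruction k M N (c * \<sigma>\<^sup>2 / real N) y P \<eta> fs
        \<and> \<sigma>\<^sup>2 > (mesh M)\<^sup>2 / real N
        \<and> (j = 0 \<or> k = 2 \<or> \<sigma>\<^sup>2 / real N \<le> B)"
      then have MN: "k < M" "k < N" "0 < \<sigma>" and noise: "gaussian_noise P (M * N) \<sigma> \<eta>"
        and rec: "reconstruction k M N (c * \<sigma>\<^sup>2 / real N) y P \<eta> fs" by auto
      have pos: "0 < M" "0 < N" using MN by auto
      have meas: "(\<lambda>\<omega>. L2_norm (weak_deriv j (\<lambda>x. fs \<omega> x - y x))) \<in> borel_measurable P"
        using j by (intro norm_meas[OF noise rec MN]) simp
      show "1 - p \<le> measure P {\<omega> \<in> space P.
            L2_norm (weak_deriv j (\<lambda>x. fs \<omega> x - y x))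
              \<le> C * mesh M ^ (k - j)
                + C * (\<sigma>\<^sup>2 / real N) powr (real (k - j) / (2 * real k))}"
      proof (rule high_probability_event[OF noise pos MN(3) p, of _ y])
        show "{\<omega> \<in> space P. L2_norm (weak_deriv j (\<lambda>x. fs \<omega> x - y x))
              \<le> C * mesh M ^ (k - j)
                + C * (\<sigma>\<^sup>2 / real N) powr (real (k - j) / (2 * real k))} \<in> sets P"
          by (intro borel_measurable_le borel_measurable_const meas)
      qed (use C[OF MN(1) pos(2) MN(3) rec] asm in blast)
    qed
  qed
qed

end
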